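(* Let $x\in\mathbb{T}^d$. The following are equivalent: (i) $x\in\mathcal{A}$; (ii) there exists a trajectory-control pair $(\gamma_x,u_x)$ defined on $\mathbb{R}$ (with $\gamma_x$ locally absolutely continuous, $u_x\in L^2_{loc}(\mathbb{R};\mathbb{R}^m)$, $\dot\gamma_x=F(\gamma_x)u_x$ a.e.) with $\gamma_x(0)=x$ such that, for all $t\ge0$, $$h(\gamma_x(t),x)=-\int_0^tL(\gamma_x(s),u_x(s))\,ds+\bar c\,t,\qquad h(x,\gamma_x(-t))=-\int_{-t}^0L(\gamma_x(s),u_x(s))\,ds+\bar c\,t.$$ Moreover, any trajectory $\gamma_x$ as in (ii) satisfies $\gamma_x(t)\in\mathcal{A}$ for all $t\in\mathbb{R}$.
   Context: Setting: $1\le m\le d$, $\mathbb{T}^d=\mathbb{R}^d/\mathbb{Z}^d$. $f_1,\dots,f_m$ smooth vector fields on $\mathbb{T}^d$ satisfying the Hörmander condition; $F(x)=[f_1(x)|\cdots|f_m(x)]$. (F): $F\in C^{1,1}$, rank $F(x)=m$. Admissible pairs: $\gamma$ absolutely continuous, $u\in L^2$, $\dot\gamma=F(\gamma)u$ a.e.; $\Gamma^{x\to y}_{0,t}$ those on $[0,t]$ from $x$ to $y$. (L): $L\in C^2(\mathbb{T}^d\times\mathbb{R}^m)$, $D^2_uL\ge0$, $L(x,u)\ge K_1|u|^\sigma-K_2$ ($\sigma>1$). $H(x,p)=\sup_u\{\langle F^*(x)p,u\rangle-L(x,u)\}$. (S): no singular minimizing controls other than zero for $V^T(x)=\inf\{\int_0^TL(\gamma,u):\gamma(0)=x\}$.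 $\bar c=\lim_{T\to\infty}V^T(x)/T$. $A_t(x,y)=\inf_{\Gamma^{x\to y}_{0,t}}\int_0^tL$. Peierls barrier $h(x,y)=\liminf_{t\to\infty}[A_t(x,y)-\bar c t]$. Projected Aubry set $\mathcal{A}=\{x:h(x,x)=0\}$. Assumptions (F), (L), (S) are in force. *)

theory Defs
  imports "HOL-Analysis.Analysis"
begin

fun Dlist :: "'a::real_normed_vector list \<Rightarrow> ('a \<Rightarrow> 'b::real_normed_vector) \<Rightarrow> 'a \<Rightarrow> 'b" where
  "Dlist [] g = g"
| "Dlist (v # vs) g = (\<lambda>x. frechet_derivative (Dlist vs g) (at x) v)"

definition Ck :: "nat \<Rightarrow> ('a::real_normed_vector \<Rightarrow> 'b::real_normed_vector) \<Rightarrow> bool" where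
  "Ck k g \<longleftrightarrow>
     (\<forall>vs. length vs < k \<longrightarrow> (\<forall>x. Dlist vs g differentiable (at x))) \<and>
     (\<forall>vs. length vs \<le> k \<longrightarrow> continuous_on UNIV (Dlist vs g))"

definition smooth :: "('a::real_normed_vector \<Rightarrow> 'b::real_normed_vector) \<Rightarrow> bool" where
  "smooth g \<longleftrightarrow> (\<forall>k. Ck k g)"

definition C11 :: "('a::real_normed_vector \<Rightarrow> 'b::real_normed_vector) \<Rightarrow> bool" where
  "C11 g \<longleftrightarrow> Ck 1 g \<and>
     (\<exists>K. \<forall>x y v. norm (Dlist [v] g x - Dlist [v] g y) \<le> K * norm v * dist x y)"

section \<open>The torus T^d, represented through Z^d-periodic objects on R^d\<close>

definition intvec :: "real^'d \<Rightarrow> bool" where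
  "intvec k \<longleftrightarrow> (\<forall>i. k $ i \<in> \<int>)"

definition periodic :: "(real^'d \<Rightarrow> 'b) \<Rightarrow> bool" where
  "periodic g \<longleftrightarrow> (\<forall>x k. intvec k \<longrightarrow> g (x + k) = g x)"

definition Fmap :: "('m::finite \<Rightarrow> real^'d \<Rightarrow> real^'d) \<Rightarrow> real^'d \<Rightarrow> real^'m \<Rightarrow> real^'d" where
  "Fmap f x u = (\<Sum>i\<in>UNIV. (u $ i) *\<^sub>R f i x)"

definition Fmat :: "('m::finite \<Rightarrow> real^'d \<Rightarrow> real^'d) \<Rightarrow> real^'d \<Rightarrow> real^'m^'d" where
  "Fmat f x = (\<chi> j i. f i x $ j)"

definition lie_bracket :: "(real^'d \<Rightarrow> real^'d) \<Rightarrow> (real^'d \<Rightarrow> real^'d) \<Rightarrow> real^'d \<Rightarrow> real^'d" where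
  "lie_bracket X Y = (\<lambda>x. frechet_derivative Y (at x) (X x) - frechet_derivative X (at x) (Y x))"

inductive_set lie_gen :: "('m \<Rightarrow> real^'d \<Rightarrow> real^'d) \<Rightarrow> (real^'d \<Rightarrow> real^'d) set"
  for f where
  gen: "f i \<in> lie_gen f"
| bracket: "X \<in> lie_gen f \<Longrightarrow> Y \<in> lie_gen f \<Longrightarrow> lie_bracket X Y \<in> lie_gen f"

definition hoermander :: "('m \<Rightarrow> real^'d \<Rightarrow> real^'d) \<Rightarrow> bool" where
  "hoermander f \<longleftrightarrow> (\<forall>x. span ((\<lambda>X. X x) ` lie_gen f) = UNIV)"

definition abs_cont_on :: "(real \<Rightarrow> 'a::real_normed_vector) \<Rightarrow> real \<Rightarrow> real \<Rightarrow> bool" where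
  "abs_cont_on g a b \<longleftrightarrow>
    (\<forall>\<epsilon>>0. \<exists>\<delta>>0. \<forall>(n::nat) (s::nat \<Rightarrow> real) t.
       (\<forall>k<n. a \<le> s k \<and> s k \<le> t k \<and> t k \<le> b) \<and>
       (\<forall>k<n. \<forall>j<n. k \<noteq> j \<longrightarrow> t k \<le> s j \<or> t j \<le> s k) \<and>
       (\<Sum>k<n. t k - s k) < \<delta> \<longrightarrow>
       (\<Sum>k<n. norm (g (t k) - g (s k))) < \<epsilon>)"

definition L2_on :: "(real \<Rightarrow> real^'m) \<Rightarrow> real \<Rightarrow> real \<Rightarrow> bool" where
  "L2_on u a b \<longleftrightarrow> u \<in> borel_measurable (lebesgue_on {a..b}) \<and>
                    (\<lambda>t. norm (u t) ^ 2) integrable_on {a..b}"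

text \<open>Admissible pair on [a,b] (trajectories are lifted to R^d).\<close>
definition admissible :: "('m::finite \<Rightarrow> real^'d \<Rightarrow> real^'d) \<Rightarrow> (real \<Rightarrow> real^'d) \<Rightarrow> (real \<Rightarrow> real^'m) \<Rightarrow> real \<Rightarrow> real \<Rightarrow> bool" where
  "admissible f \<gamma> u a b \<longleftrightarrow> abs_cont_on \<gamma> a b \<and> L2_on u a b \<and>
     (\<exists>N. negligible N \<and> (\<forall>t\<in>{a..b} - N. (\<gamma> has_vector_derivative Fmap f (\<gamma> t) (u t)) (at t)))"

text \<open>Action on [a,b], as an extended real: L is bounded below, so a non-integrable
  (measurable) Lagrangian along the pair has action +infinity.\<close>
definition action :: "(real^'d \<Rightarrow> real^'m \<Rightarrow> real) \<Rightarrow> (real \<Rightarrow> real^'d) \<Rightarrow> (real \<Rightarrow> real^'m) \<Rightarrow> real \<Rightarrow> real \<Rightarrow> ereal" where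
  "action L \<gamma> u a b =
     (if (\<lambda>s. L (\<gamma> s) (u s)) integrable_on {a..b}
      then ereal (integral {a..b} (\<lambda>s. L (\<gamma> s) (u s))) else \<infinity>)"

definition Vfun :: "('m::finite \<Rightarrow> real^'d \<Rightarrow> real^'d) \<Rightarrow> (real^'d \<Rightarrow> real^'m \<Rightarrow> real) \<Rightarrow> real \<Rightarrow> real^'d \<Rightarrow> ereal" where
  "Vfun f L T x = (INF p \<in> {(\<gamma>, u). admissible f \<gamma> u 0 T \<and> \<gamma> 0 = x}. action L (fst p) (snd p) 0 T)"

text \<open>Critical value cbar = lim_{T->oo} V^T(x)/T (independent of x; computed at x = 0).\<close>
definition cbar :: "('m::finite \<Rightarrow> real^'d \<Rightarrow> real^'d) \<Rightarrow> (real^'d \<Rightarrow> real^'m \<Rightarrow> real) \<Rightarrow> real" where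
  "cbar f L = Lim at_top (\<lambda>T. real_of_ereal (Vfun f L T 0) / T)"

text \<open>A_t(x,y): minimal action from x to y in time t on the torus, i.e. over lifted curves
  from x to some y + k, k in Z^d.\<close>
definition Afun :: "('m::finite \<Rightarrow> real^'d \<Rightarrow> real^'d) \<Rightarrow> (real^'d \<Rightarrow> real^'m \<Rightarrow> real) \<Rightarrow> real \<Rightarrow> real^'d \<Rightarrow> real^'d \<Rightarrow> ereal" where
  "Afun f L t x y = (INF p \<in> {(\<gamma>, u). admissible f \<gamma> u 0 t \<and> \<gamma> 0 = x \<and> intvec (\<gamma> t - y)}.
                        action L (fst p) (snd p) 0 t)"

definition peierls :: "('m::finite \<Rightarrow> real^'d \<Rightarrow> real^'d) \<Rightarrow> (real^'d \<Rightarrow> real^'m \<Rightarrow> real) \<Rightarrow> real^'d \<Rightarrow> real^'d \<Rightarrow> ereal" where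
  "peierls f L x y = Liminf at_top (\<lambda>t. Afun f L t x y - ereal (cbar f L * t))"

text \<open>Projected Aubry set (as a Z^d-periodic subset of R^d).\<close>
definition aubry :: "('m::finite \<Rightarrow> real^'d \<Rightarrow> real^'d) \<Rightarrow> (real^'d \<Rightarrow> real^'m \<Rightarrow> real) \<Rightarrow> (real^'d) set" where
  "aubry f L = {x. peierls f L x x = 0}"

definition assm_F :: "('m::finite \<Rightarrow> real^'d \<Rightarrow> real^'d) \<Rightarrow> bool" where
  "assm_F f \<longleftrightarrow> (\<forall>i. C11 (f i)) \<and> (\<forall>x. rank (Fmat f x) = CARD('m))"

definition assm_L :: "(real^'d \<Rightarrow> real^'m \<Rightarrow> real) \<Rightarrow> bool" where
  "assm_L L \<longleftrightarrow> periodic L \<and> Ck 2 (\<lambda>p. L (fst p) (snd p)) \<and>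
     (\<forall>x u v. Dlist [(0, v), (0, v)] (\<lambda>p. L (fst p) (snd p)) (x, u) \<ge> 0) \<and>
     (\<exists>K1 K2 \<sigma>. K1 > 0 \<and> \<sigma> > 1 \<and> (\<forall>x u. L x u \<ge> K1 * norm u powr \<sigma> - K2))"

definition minimizing :: "('m::finite \<Rightarrow> real^'d \<Rightarrow> real^'d) \<Rightarrow> (real^'d \<Rightarrow> real^'m \<Rightarrow> real) \<Rightarrow> real \<Rightarrow> real^'d \<Rightarrow> (real \<Rightarrow> real^'d) \<Rightarrow> (real \<Rightarrow> real^'m) \<Rightarrow> bool" where
  "minimizing f L T x \<gamma> u \<longleftrightarrow> admissible f \<gamma> u 0 T \<and> \<gamma> 0 = x \<and> action L \<gamma> u 0 T = Vfun f L T x"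

text \<open>Singular control on [0,T] (non-surjective differential of the end-point map),
  expressed through a nontrivial abnormal covector p: p' = - sum_i u_i (Df_i(gamma))^* p
  and <p, f_i(gamma)> = 0 a.e.\<close>
definition singular :: "('m::finite \<Rightarrow> real^'d \<Rightarrow> real^'d) \<Rightarrow> real \<Rightarrow> (real \<Rightarrow> real^'d) \<Rightarrow> (real \<Rightarrow> real^'m) \<Rightarrow> bool" where
  "singular f T \<gamma> u \<longleftrightarrow>
     (\<exists>p :: real \<Rightarrow> real^'d. abs_cont_on p 0 T \<and> (\<exists>t\<in>{0..T}. p t \<noteq> 0) \<and>
        (\<exists>N. negligible N \<and> (\<forall>t\<in>{0..T} - N.
            (\<exists>q. (p has_vector_derivative q) (at t) \<and>
                 (\<forall>v. q \<bullet> v = - (\<Sum>i\<in>UNIV. u t $ i * (p t \<bullet> frechet_derivative (f i) (at (\<gamma> t)) v)))) \<and>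
            (\<forall>i. p t \<bullet> f i (\<gamma> t) = 0))))"

definition assm_S :: "('m::finite \<Rightarrow> real^'d \<Rightarrow> real^'d) \<Rightarrow> (real^'d \<Rightarrow> real^'m \<Rightarrow> real) \<Rightarrow> bool" where
  "assm_S f L \<longleftrightarrow> (\<forall>T>0. \<forall>x \<gamma> u. minimizing f L T x \<gamma> u \<and> singular f T \<gamma> u \<longrightarrow>
                       (\<exists>N. negligible N \<and> (\<forall>t\<in>{0..T} - N. u t = 0)))"

end

theory Submission
  imports Defs
begin

text \<open>By convexity and superlinearity of \<open>L\<close>, an admissible pair of bounded mean cost can be
  slowed down where it is fast, and accelerated elsewhere to keep the total time, without increasing
  the action; so only uniformly bounded controls matter. For these, weak limits exist and the action
  is lower semicontinuous along them. If \<open>h(x, x) = 0\<close>, take loops at \<open>x\<close> of length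
  \<open>t\<^sub>n \<rightarrow> \<infinity>\<close> and cost almost \<open>c t\<^sub>n\<close>, wind them around to two-sided curves, and pass to a
  limit \<open>\<gamma>\<close>. The triangle inequality for \<open>h\<close> gives one half of the calibration identities. For the
  other half, steer by a short arc (Chow's theorem in small time) from \<open>\<gamma>(t)\<close> onto the loops, whose
  remaining cost is controlled by lower semicontinuity. Conversely, the identities at \<open>t = 0\<close> read
  \<open>h(x, x) = 0\<close>, and at \<open>t\<close> they give \<open>h(\<gamma>(t), \<gamma>(t)) \<le> 0\<close> by the triangle inequality; a
  negative value would propagate to \<open>h(\<gamma>(t), x) = -\<infinity>\<close>, which global controllability excludes.

  For Chow's theorem, words in the flows of the \<open>f\<^sub>i\<close> are expanded in the Magnus ring of formal
  noncommutative series: commutator words have the iterated Lie brackets as leading terms.\<close>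

section \<open>Smooth vector fields\<close>

text \<open>A change of time keeps the traced curve, hence its endpoints, the closing of a loop and
  the constraint \<gamma>' = F(\<gamma>)u. The resulting bound on the control depends only on the
  mean cost per unit of time, so one constant serves loops of arbitrary length; a limit on the whole
  line requires exactly this. Limits of loops pass only near the points where they are wanted, and
  the connecting arc must cost arbitrarily little. Hence controllability is proved in arbitrarily
  short time with controls of norm at most 1: the cost of an arc is then bounded by a multiple of
  its duration. A word of flows reaches its target only up to an error of higher order. Repeated
  correction halves the error within a geometric series of durations, and the exact endpoint comes
  from the same compactness theorem that produces the limits of loops. Trajectories are lifted to
  R^d. Periodicity supplies bounds uniform in the base point, and pieces are glued after translation
  by integer vectors.\<close>

lemma smooth_iff:
  fixes g :: "'a::real_normed_vector \<Rightarrow> 'b::real_normed_vector"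
  shows "smooth g \<longleftrightarrow> (\<forall>(vs::'a list) x. Dlist vs g differentiable (at x))"
proof
  assume g: "smooth g"
  show "\<forall>vs x. Dlist vs g differentiable (at x)"
  proof (intro allI)
    fix vs :: "'a list" and x :: 'a
    from g have "Ck (Suc (length vs)) g" by (simp add: smooth_def)
    then show "Dlist vs g differentiable (at x)" by (simp add: Ck_def)
  qed
next
  assume "\<forall>vs x. Dlist vs g differentiable (at x)"
  then show "smooth g"
    by (auto simp: smooth_def Ck_def continuous_on_eq_continuous_at differentiable_imp_continuous_within)
qed

lemma smooth_imp_differentiable: "smooth g \<Longrightarrow> g differentiable (at x)"
  unfolding smooth_iff by (metis Dlist.simps(1))

lemma smooth_has_derivative: "smooth g \<Longrightarrow> (g has_derivative frechet_derivative g (at x)) (at x)"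
  using smooth_imp_differentiable frechet_derivative_works by blast

lemma Dlist_append:
  fixes g :: "'a::real_normed_vector \<Rightarrow> 'b::real_normed_vector"
  shows "Dlist (vs @ ws) g = Dlist vs (Dlist ws g)"
  by (induction vs) auto

lemma smooth_directional:
  fixes g :: "'a::real_normed_vector \<Rightarrow> 'b::real_normed_vector"
  shows "smooth g \<Longrightarrow> smooth (\<lambda>x. frechet_derivative g (at x) v)"
  unfolding smooth_iff
proof (intro allI)
  fix vs :: "'a list" and x :: 'a
  assume "\<forall>(vs::'a list) x. Dlist vs g differentiable at x"
  then have "Dlist (vs @ [v]) g differentiable at x" by blast
  then show "Dlist vs (\<lambda>x. frechet_derivative g (at x) v) differentiable at x"
    by (simp add: Dlist_append)
qed

lemma smooth_imp_continuous: "smooth g \<Longrightarrow> continuous_on UNIV g"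
  by (simp add: continuous_on_eq_continuous_at differentiable_imp_continuous_within smooth_imp_differentiable)

text \<open>Every iterated directional derivative stays in \<open>S\<close>, by induction on the
  list of directions. Smoothness of a construction is thereby reduced to naming a class closed under
  one derivative.\<close>

lemma smooth_coinduct:
  fixes g :: "'a::real_normed_vector \<Rightarrow> 'b::real_normed_vector"
  assumes "g \<in> S" and "\<And>g x. g \<in> S \<Longrightarrow> g differentiable (at x)"
    and "\<And>g v. g \<in> S \<Longrightarrow> (\<lambda>x. frechet_derivative g (at x) v) \<in> S"
  shows "smooth g"
proof -
  have "Dlist vs g \<in> S" for vs :: "'a list"
    by (induction vs) (use assms in auto)
  then show ?thesis using assms(2) by (auto simp: smooth_iff)
qed

text \<open>The derivative of a product is a sum of products, so products alone are not closed under
  differentiation; the algebra generated by the smooth functions is, and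
  \<open>smooth_coinduct\<close> applies to it.\<close>

inductive_set smooth_alg :: "('a::real_normed_vector \<Rightarrow> real) set" where
  base: "smooth g \<Longrightarrow> g \<in> smooth_alg"
| add: "g \<in> smooth_alg \<Longrightarrow> h \<in> smooth_alg \<Longrightarrow> (\<lambda>x. g x + h x) \<in> smooth_alg"
| mult: "g \<in> smooth_alg \<Longrightarrow> h \<in> smooth_alg \<Longrightarrow> (\<lambda>x. g x * h x) \<in> smooth_alg"

lemma frechet_derivative_eq:
  "(g has_derivative g') (at x) \<Longrightarrow> frechet_derivative g (at x) = g'"
  by (metis frechet_derivative_at)

lemma smooth_alg_deriv:
  assumes "g \<in> smooth_alg"
  shows "(\<forall>x. g differentiable (at x)) \<and> (\<forall>v. (\<lambda>x. frechet_derivative g (at x) v) \<in> smooth_alg)"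
  using assms
proof induction
  case (base g)
  then show ?case
    by (simp add: smooth_alg.base smooth_directional smooth_imp_differentiable)
next
  case (add g h)
  have "frechet_derivative (\<lambda>x. g x + h x) (at x) = (\<lambda>v. frechet_derivative g (at x) v + frechet_derivative h (at x) v)" for x
    using add by (intro frechet_derivative_eq has_derivative_add) (auto simp: frechet_derivative_works[symmetric])
  then show ?case using add by (auto intro!: smooth_alg.add differentiable_add)
next
  case (mult g h)
  have "frechet_derivative (\<lambda>x. g x * h x) (at x) =
      (\<lambda>v. g x * frechet_derivative h (at x) v + frechet_derivative g (at x) v * h x)" for x
    using mult by (intro frechet_derivative_eq has_derivative_mult) (auto simp: frechet_derivative_works[symmetric])
  then show ?case using mult by (auto intro!: smooth_alg.add smooth_alg.mult differentiable_mult)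
qed

lemma smooth_alg_smooth: "g \<in> smooth_alg \<Longrightarrow> smooth g"
  by (rule smooth_coinduct[where S = smooth_alg]) (use smooth_alg_deriv in auto)

lemma smooth_add: "smooth g \<Longrightarrow> smooth h \<Longrightarrow> smooth (\<lambda>x. g x + h x :: real)"
  by (rule smooth_alg_smooth, rule smooth_alg.add; rule smooth_alg.base)

lemma smooth_mult: "smooth g \<Longrightarrow> smooth h \<Longrightarrow> smooth (\<lambda>x. g x * h x :: real)"
  by (rule smooth_alg_smooth, rule smooth_alg.mult; rule smooth_alg.base)

lemma smooth_const: "smooth (\<lambda>x. c)"
  by (rule smooth_coinduct[where S = "{\<lambda>x. d | d. True}"])
     (auto simp: frechet_derivative_const)

lemma smooth_diff: "smooth g \<Longrightarrow> smooth h \<Longrightarrow> smooth (\<lambda>x. g x - h x :: real)"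
  using smooth_add[of g "\<lambda>x. (-1) * h x"] smooth_mult[OF smooth_const, of h "-1"] by simp

lemma smooth_sum: "(\<And>i. i \<in> I \<Longrightarrow> smooth (g i)) \<Longrightarrow> smooth (\<lambda>x. \<Sum>i\<in>I. g i x :: real)"
  by (induction I rule: infinite_finite_induct) (auto intro: smooth_add smooth_const)

lemma frechet_derivative_component:
  fixes g :: "'a::real_normed_vector \<Rightarrow> real^'n"
  assumes "g differentiable (at x)"
  shows "((\<lambda>x. g x $ j) has_derivative (\<lambda>v. frechet_derivative g (at x) v $ j)) (at x)"
  using assms
  by (intro bounded_linear.has_derivative[OF bounded_linear_vec_nth]) (simp add: frechet_derivative_works[symmetric])

lemma smooth_component:
  fixes g :: "'a::real_normed_vector \<Rightarrow> real^'n"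
  assumes "smooth g"
  shows "smooth (\<lambda>x. g x $ j)"
proof (rule smooth_coinduct[where S = "{\<lambda>x. g x $ j | g :: 'a \<Rightarrow> real^'n. smooth g}"])
  show "(\<lambda>x. g x $ j) \<in> {\<lambda>x. g x $ j | g :: 'a \<Rightarrow> real^'n. smooth g}"
    using assms by blast
next
  fix k :: "'a \<Rightarrow> real" and x
  assume "k \<in> {\<lambda>x. g x $ j | g :: 'a \<Rightarrow> real^'n. smooth g}"
  then show "k differentiable at x"
    using frechet_derivative_component smooth_imp_differentiable by (force simp: differentiable_def)
next
  fix k :: "'a \<Rightarrow> real" and v
  assume "k \<in> {\<lambda>x. g x $ j | g :: 'a \<Rightarrow> real^'n. smooth g}"
  then obtain g :: "'a \<Rightarrow> real^'n" where g: "smooth g" "k = (\<lambda>x. g x $ j)" by blast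
  have "(\<lambda>x. frechet_derivative k (at x) v) = (\<lambda>x. (\<lambda>x. frechet_derivative g (at x) v) x $ j)"
    unfolding g(2)
    by (simp only: frechet_derivative_eq[OF frechet_derivative_component[OF smooth_imp_differentiable[OF g(1)]]])
  then show "(\<lambda>x. frechet_derivative k (at x) v) \<in> {\<lambda>x. g x $ j | g :: 'a \<Rightarrow> real^'n. smooth g}"
    using smooth_directional[OF g(1), of v]
    by (intro CollectI exI[of _ "\<lambda>x. frechet_derivative g (at x) v"] conjI)
qed

lemma differentiable_vec:
  fixes g :: "'a::real_normed_vector \<Rightarrow> real^'n"
  assumes "\<And>j. (\<lambda>x. g x $ j) differentiable (at x)"
  shows "g differentiable (at x)"
proof -
  have "g = (\<lambda>x. \<Sum>j\<in>UNIV. (g x $ j) *\<^sub>R axis j 1)"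
    by (auto simp: vec_eq_iff axis_def if_distrib cong: if_cong)
  moreover have "(\<lambda>x. \<Sum>j\<in>UNIV. (g x $ j) *\<^sub>R (axis j 1 :: real^'n)) differentiable (at x)"
    by (intro differentiable_sum differentiable_scaleR[OF assms differentiable_const] finite_class.finite_UNIV ballI)
  ultimately show ?thesis by simp
qed

lemma smooth_vec:
  fixes g :: "'a::real_normed_vector \<Rightarrow> real^'n"
  assumes "\<And>j. smooth (\<lambda>x. g x $ j)"
  shows "smooth g"
proof (rule smooth_coinduct[where S = "{g. \<forall>j. smooth (\<lambda>x. g x $ j)}"])
  show "g \<in> {g. \<forall>j. smooth (\<lambda>x. g x $ j)}" using assms by simp
next
  fix k :: "'a \<Rightarrow> real^'n" and x assume k: "k \<in> {g. \<forall>j. smooth (\<lambda>x. g x $ j)}"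
  then show "k differentiable at x" by (intro differentiable_vec smooth_imp_differentiable) auto
next
  fix k :: "'a \<Rightarrow> real^'n" and v assume k: "k \<in> {g. \<forall>j. smooth (\<lambda>x. g x $ j)}"
  have "k differentiable at x" for x
    using k by (intro differentiable_vec smooth_imp_differentiable) auto
  then have "frechet_derivative (\<lambda>x. k x $ j) (at x) = (\<lambda>v. frechet_derivative k (at x) v $ j)" for x j
    by (intro frechet_derivative_eq frechet_derivative_component)
  then have "smooth (\<lambda>x. frechet_derivative k (at x) v $ j)" for j
    using k smooth_directional[of "\<lambda>x. k x $ j" v] by simp
  then show "(\<lambda>x. frechet_derivative k (at x) v) \<in> {g. \<forall>j. smooth (\<lambda>x. g x $ j)}" by simp
qed

section \<open>Symmetry of second derivatives\<close>

declare Dlist.simps [simp del]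

text \<open>Two applications of the mean value theorem: along \<open>v\<close> for the difference of
  \<open>g\<close> on two parallel segments, then along \<open>w\<close>. The left side is symmetric
  in \<open>v\<close> and \<open>w\<close> while the right side prefers an order, which forces the
  mixed derivatives to agree in the limit.\<close>

lemma second_difference:
  fixes g :: "'a::real_normed_vector \<Rightarrow> real"
  assumes g: "smooth g" and h: "h > 0"
  shows "\<exists>a b. 0 < a \<and> a < h \<and> 0 < b \<and> b < h \<and>
    g (x + h *\<^sub>R v + h *\<^sub>R w) - g (x + h *\<^sub>R v) - g (x + h *\<^sub>R w) + g x
      = h * (h * Dlist [w, v] g (x + a *\<^sub>R v + b *\<^sub>R w))"
proof -
  define Gv where "Gv = Dlist [v] g"
  have Gv: "smooth Gv" using smooth_directional[OF g] by (simp add: Gv_def Dlist.simps)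
  have d1: "((\<lambda>s. g (z + s *\<^sub>R v)) has_real_derivative Gv (z + s *\<^sub>R v)) (at s)" for z s
  proof -
    have "((\<lambda>s. g (z + s *\<^sub>R v)) has_derivative (\<lambda>r. frechet_derivative g (at (z + s *\<^sub>R v)) (r *\<^sub>R v))) (at s)"
      by (rule has_derivative_compose[where f = "\<lambda>s. z + s *\<^sub>R v"])
         (auto intro!: derivative_eq_intros smooth_has_derivative[OF g])
    moreover have "frechet_derivative g (at (z + s *\<^sub>R v)) (r *\<^sub>R v) = Gv (z + s *\<^sub>R v) * r" for r
      using linear_frechet_derivative[OF smooth_imp_differentiable[OF g]]
      by (simp add: Gv_def linear_scale Dlist.simps)
    ultimately show ?thesis by (simp only: has_field_derivative_def)
  qed
  have d2: "((\<lambda>s. Gv (z + s *\<^sub>R w)) has_real_derivative Dlist [w, v] g (z + s *\<^sub>R w)) (at s)" for z s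
  proof -
    have "((\<lambda>s. Gv (z + s *\<^sub>R w)) has_derivative (\<lambda>r. frechet_derivative Gv (at (z + s *\<^sub>R w)) (r *\<^sub>R w))) (at s)"
      by (rule has_derivative_compose[where f = "\<lambda>s. z + s *\<^sub>R w"])
         (auto intro!: derivative_eq_intros smooth_has_derivative[OF Gv])
    moreover have "frechet_derivative Gv (at (z + s *\<^sub>R w)) (r *\<^sub>R w) = Dlist [w, v] g (z + s *\<^sub>R w) * r" for r
      using linear_frechet_derivative[OF smooth_imp_differentiable[OF Gv]]
      by (simp add: Gv_def linear_scale Dlist.simps)
    ultimately show ?thesis by (simp only: has_field_derivative_def)
  qed
  have "\<exists>a>0. a < h \<and> (g (x + h *\<^sub>R w + h *\<^sub>R v) - g (x + h *\<^sub>R v)) - (g (x + h *\<^sub>R w + 0 *\<^sub>R v) - g (x + 0 *\<^sub>R v))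
      = (h - 0) * (Gv (x + h *\<^sub>R w + a *\<^sub>R v) - Gv (x + a *\<^sub>R v))"
    by (rule MVT2[OF h]) (auto intro!: derivative_eq_intros d1)
  then obtain a where a: "a > 0" "a < h"
    "(g (x + h *\<^sub>R w + h *\<^sub>R v) - g (x + h *\<^sub>R v)) - (g (x + h *\<^sub>R w) - g x)
      = h * (Gv (x + h *\<^sub>R w + a *\<^sub>R v) - Gv (x + a *\<^sub>R v))" by auto
  have "\<exists>b>0. b < h \<and> Gv (x + a *\<^sub>R v + h *\<^sub>R w) - Gv (x + a *\<^sub>R v + 0 *\<^sub>R w) = (h - 0) * Dlist [w, v] g (x + a *\<^sub>R v + b *\<^sub>R w)"
    by (rule MVT2[OF h]) (auto intro!: derivative_eq_intros d2)
  then obtain b where b: "b > 0" "b < h"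
    "Gv (x + a *\<^sub>R v + h *\<^sub>R w) - Gv (x + a *\<^sub>R v) = h * Dlist [w, v] g (x + a *\<^sub>R v + b *\<^sub>R w)" by auto
  show ?thesis
    using a b by (intro exI[of _ a] exI[of _ b]) (auto simp: algebra_simps)
qed

lemma smooth_symmetric:
  fixes g :: "'a::real_normed_vector \<Rightarrow> real"
  assumes g: "smooth g"
  shows "Dlist [v, w] g x = Dlist [w, v] g x"
proof (rule ccontr)
  assume ne: "Dlist [v, w] g x \<noteq> Dlist [w, v] g x"
  define e where "e = \<bar>Dlist [v, w] g x - Dlist [w, v] g x\<bar> / 2"
  have e: "e > 0" using ne by (simp add: e_def)
  have c: "isCont (Dlist [v, w] g) x" for v w
    using g unfolding smooth_iff by (blast intro: differentiable_imp_continuous_within)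
  obtain d1 where d1: "d1 > 0" "\<And>y. dist y x < d1 \<Longrightarrow> \<bar>Dlist [v, w] g y - Dlist [v, w] g x\<bar> < e"
    using c[of v w, unfolded continuous_at_eps_delta, rule_format, OF e] unfolding dist_real_def by blast
  obtain d2 where d2: "d2 > 0" "\<And>y. dist y x < d2 \<Longrightarrow> \<bar>Dlist [w, v] g y - Dlist [w, v] g x\<bar> < e"
    using c[of w v, unfolded continuous_at_eps_delta, rule_format, OF e] unfolding dist_real_def by blast
  \<comment> \<open>Small enough for every point x + a v + b w with a and b below \<open>h\<close>
    to lie in both continuity neighbourhoods; the 1 keeps the denominator positive when v = w =
    0.\<close>
  define h where "h = min d1 d2 / (2 * (norm v + norm w + 1))"
  have h: "h > 0" using d1 d2 by (simp add: h_def add_nonneg_pos)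
  have near: "dist (x + a *\<^sub>R v' + b *\<^sub>R w') x < min d1 d2"
    if "0 < a" "a < h" "0 < b" "b < h" "norm v' + norm w' = norm v + norm w" for a b v' w'
  proof -
    have "norm (a *\<^sub>R v' + b *\<^sub>R w') \<le> a * norm v' + b * norm w'"
      using that norm_triangle_ineq[of "a *\<^sub>R v'" "b *\<^sub>R w'"] by simp
    also have "\<dots> \<le> h * (norm v' + norm w')"
      unfolding distrib_left using that by (intro add_mono mult_right_mono) auto
    also have "\<dots> < h * (2 * (norm v + norm w + 1))"
    proof -
      have "norm v + norm w < 2 * (norm v + norm w + 1)"
      proof -
        have "0 < (norm v + norm w) + 2" by (intro add_nonneg_pos add_nonneg_nonneg) auto
        then show ?thesis by (simp add: algebra_simps)
      qed
      then show ?thesis unfolding that(5) using h by (rule mult_strict_left_mono)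
    qed
    also have "\<dots> = min d1 d2" 
    proof -
      have "norm v + norm w + 1 > 0" by (simp add: add_nonneg_pos)
      then show ?thesis by (simp add: h_def)
    qed
    finally show ?thesis by (simp add: dist_norm algebra_simps)
  qed
  obtain a b where ab: "0 < a" "a < h" "0 < b" "b < h"
    "g (x + h *\<^sub>R v + h *\<^sub>R w) - g (x + h *\<^sub>R v) - g (x + h *\<^sub>R w) + g x
      = h * (h * Dlist [w, v] g (x + a *\<^sub>R v + b *\<^sub>R w))"
    using second_difference[OF g h, of x v w] by blast
  obtain a' b' where ab': "0 < a'" "a' < h" "0 < b'" "b' < h"
    "g (x + h *\<^sub>R w + h *\<^sub>R v) - g (x + h *\<^sub>R w) - g (x + h *\<^sub>R v) + g x
      = h * (h * Dlist [v, w] g (x + a' *\<^sub>R w + b' *\<^sub>R v))"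
    using second_difference[OF g h, of x w v] by blast
  have "h * (h * Dlist [w, v] g (x + a *\<^sub>R v + b *\<^sub>R w)) = h * (h * Dlist [v, w] g (x + a' *\<^sub>R w + b' *\<^sub>R v))"
    using ab(5) ab'(5) by (simp add: algebra_simps)
  then have eq: "Dlist [w, v] g (x + a *\<^sub>R v + b *\<^sub>R w) = Dlist [v, w] g (x + a' *\<^sub>R w + b' *\<^sub>R v)"
    using h by simp
  have "\<bar>Dlist [w, v] g (x + a *\<^sub>R v + b *\<^sub>R w) - Dlist [w, v] g x\<bar> < e"
    using near[OF ab(1-4), of v w] by (intro d2) auto
  moreover have "\<bar>Dlist [v, w] g (x + a' *\<^sub>R w + b' *\<^sub>R v) - Dlist [v, w] g x\<bar> < e"
    using near[OF ab'(1-4), of w v] by (intro d1) auto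
  ultimately show False using eq unfolding e_def by argo
qed

section \<open>Lie derivatives and the commutator formula\<close>

definition lie_deriv :: "(real^'d \<Rightarrow> real^'d) \<Rightarrow> (real^'d \<Rightarrow> real) \<Rightarrow> real^'d \<Rightarrow> real" where
  "lie_deriv X g = (\<lambda>x. frechet_derivative g (at x) (X x))"

lemma linear_smooth_derivative: "smooth g \<Longrightarrow> linear (frechet_derivative g (at x))"
  by (simp add: linear_frechet_derivative smooth_imp_differentiable)

lemma lie_deriv_coords:
  assumes "smooth g"
  shows "lie_deriv X g x = (\<Sum>j\<in>UNIV. X x $ j * frechet_derivative g (at x) (axis j 1))"
proof -
  have "X x = (\<Sum>j\<in>UNIV. (X x $ j) *\<^sub>R axis j 1)"
    by (auto simp: vec_eq_iff axis_def if_distrib cong: if_cong)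
  then have "lie_deriv X g x = frechet_derivative g (at x) (\<Sum>j\<in>UNIV. (X x $ j) *\<^sub>R axis j 1)"
    by (simp add: lie_deriv_def)
  then show ?thesis
    by (simp add: linear_sum linear_scale linear_smooth_derivative[OF assms])
qed

lemma smooth_lie_deriv:
  assumes "smooth X" "smooth g"
  shows "smooth (lie_deriv X g)"
proof -
  have "lie_deriv X g = (\<lambda>x. \<Sum>j\<in>UNIV. X x $ j * frechet_derivative g (at x) (axis j 1))"
    using lie_deriv_coords[OF assms(2)] by blast
  then show ?thesis
    by (simp add: smooth_sum smooth_mult smooth_component[OF assms(1)] smooth_directional[OF assms(2)])
qed

lemma smooth_lie_bracket:
  assumes X: "smooth X" and Y: "smooth Y"
  shows "smooth (lie_bracket X Y)"
proof (rule smooth_vec)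
  fix j
  have "lie_bracket X Y x $ j = lie_deriv X (\<lambda>x. Y x $ j) x - lie_deriv Y (\<lambda>x. X x $ j) x" for x
    unfolding lie_bracket_def lie_deriv_def
    by (simp add: frechet_derivative_eq[OF frechet_derivative_component] smooth_imp_differentiable X Y)
  then have "(\<lambda>x. lie_bracket X Y x $ j) = (\<lambda>x. lie_deriv X (\<lambda>x. Y x $ j) x - lie_deriv Y (\<lambda>x. X x $ j) x)"
    by blast
  then show "smooth (\<lambda>x. lie_bracket X Y x $ j)"
    by (simp add: smooth_diff smooth_lie_deriv smooth_component X Y)
qed

text \<open>The product rule yields a second-order part, symmetric in the two fields up to the order
  of differentiation, and a first-order part containing the derivative of \<open>Y\<close>. Only the
  latter survives in a commutator.\<close>

lemma lie_deriv_lie_deriv: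
  assumes g: "smooth g" and X: "smooth X" and Y: "smooth Y"
  shows "lie_deriv X (lie_deriv Y g) x =
    (\<Sum>j\<in>UNIV. \<Sum>i\<in>UNIV. X x $ i * (Y x $ j * Dlist [axis i 1, axis j 1] g x))
      + frechet_derivative g (at x) (frechet_derivative Y (at x) (X x))"
proof -
  let ?D = "\<lambda>j x. frechet_derivative g (at x) (axis j 1)"
  have "lie_deriv Y g = (\<lambda>x. \<Sum>j\<in>UNIV. Y x $ j * ?D j x)"
    using lie_deriv_coords[OF g] by blast
  then have "lie_deriv X (lie_deriv Y g) x = frechet_derivative (\<lambda>x. \<Sum>j\<in>UNIV. Y x $ j * ?D j x) (at x) (X x)"
    by (simp only: lie_deriv_def)
  moreover have "((\<lambda>x. \<Sum>j\<in>UNIV. Y x $ j * ?D j x) has_derivative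
     (\<lambda>v. \<Sum>j\<in>UNIV. Y x $ j * frechet_derivative (?D j) (at x) v + frechet_derivative Y (at x) v $ j * ?D j x)) (at x)"
    by (intro has_derivative_sum has_derivative_mult frechet_derivative_component smooth_imp_differentiable Y
        smooth_has_derivative smooth_directional g)
  ultimately have "lie_deriv X (lie_deriv Y g) x =
    (\<Sum>j\<in>UNIV. Y x $ j * lie_deriv X (?D j) x + frechet_derivative Y (at x) (X x) $ j * ?D j x)"
    by (simp add: frechet_derivative_eq lie_deriv_def[of X "?D _"])
  also have "\<dots> = (\<Sum>j\<in>UNIV. Y x $ j * lie_deriv X (?D j) x) + (\<Sum>j\<in>UNIV. frechet_derivative Y (at x) (X x) $ j * ?D j x)"
    by (simp add: sum.distrib)
  also have "(\<Sum>j\<in>UNIV. frechet_derivative Y (at x) (X x) $ j * ?D j x) = frechet_derivative g (at x) (frechet_derivative Y (at x) (X x))"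
    using lie_deriv_coords[OF g, of "\<lambda>x. frechet_derivative Y (at x) (X x)" x] by (simp add: lie_deriv_def)
  finally have "lie_deriv X (lie_deriv Y g) x = (\<Sum>j\<in>UNIV. Y x $ j * lie_deriv X (?D j) x)
    + frechet_derivative g (at x) (frechet_derivative Y (at x) (X x))" .
  moreover have "Y x $ j * lie_deriv X (?D j) x = (\<Sum>i\<in>UNIV. X x $ i * (Y x $ j * Dlist [axis i 1, axis j 1] g x))" for j
    unfolding lie_deriv_coords[OF smooth_directional[OF g]] Dlist.simps
    by (simp add: sum_distrib_left mult.left_commute)
  ultimately show ?thesis by simp
qed

lemma lie_deriv_commutator:
  assumes g: "smooth g" and X: "smooth X" and Y: "smooth Y"
  shows "lie_deriv X (lie_deriv Y g) x - lie_deriv Y (lie_deriv X g) x = lie_deriv (lie_bracket X Y) g x"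
proof -
  have sym: "X x $ i * (Y x $ j * Dlist [axis i 1, axis j 1] g x) =
    Y x $ j * (X x $ i * Dlist [axis j 1, axis i 1] g x)" for i j
    using smooth_symmetric[OF g, of "axis i 1" "axis j 1" x] by simp
  have "(\<Sum>j\<in>UNIV. \<Sum>i\<in>UNIV. X x $ i * (Y x $ j * Dlist [axis i 1, axis j 1] g x)) =
    (\<Sum>j\<in>UNIV. \<Sum>i\<in>UNIV. Y x $ i * (X x $ j * Dlist [axis i 1, axis j 1] g x))"
    unfolding sym by (rule sum.swap)
  then have "lie_deriv X (lie_deriv Y g) x - lie_deriv Y (lie_deriv X g) x =
     frechet_derivative g (at x) (frechet_derivative Y (at x) (X x)) - frechet_derivative g (at x) (frechet_derivative X (at x) (Y x))"
    unfolding lie_deriv_lie_deriv[OF g X Y] lie_deriv_lie_deriv[OF g Y X] by linarith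
  also have "\<dots> = lie_deriv (lie_bracket X Y) g x"
    unfolding lie_deriv_def lie_bracket_def linear_diff[OF linear_smooth_derivative[OF g]] ..
  finally show ?thesis .
qed

lemma lie_gen_smooth:
  assumes "Z \<in> lie_gen f" "\<And>i. smooth (f i)"
  shows "smooth Z"
  using assms(1) by induction (auto intro: smooth_lie_bracket assms(2))

section \<open>The Magnus ring\<close>

text \<open>A series assigns a real coefficient to every word; the separate type lets the product be
  convolution over all cuts of a word into prefix and suffix. Each coefficient of a product is a
  finite sum, so convergence is no issue.\<close>

typedef 'm magnus = "UNIV :: ('m list \<Rightarrow> real) set" morphisms mcoeff Magnus ..

lemma mcoeff_Magnus [simp]: "mcoeff (Magnus f) = f"
  by (simp add: Magnus_inverse)

lemma magnus_eqI: "(\<And>w. mcoeff a w = mcoeff b w) \<Longrightarrow> a = b"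
  by (metis ext mcoeff_inverse)

instantiation magnus :: (type) ring_1
begin
definition "0 = Magnus (\<lambda>w. 0)"
definition "1 = Magnus (\<lambda>w. if w = [] then 1 else 0)"
definition "a + b = Magnus (\<lambda>w. mcoeff a w + mcoeff b w)"
definition "a - b = Magnus (\<lambda>w. mcoeff a w - mcoeff b w)"
definition "- a = Magnus (\<lambda>w. - mcoeff a w)"
definition "a * b = Magnus (\<lambda>w. \<Sum>n=0..length w. mcoeff a (take n w) * mcoeff b (drop n w))"

lemma mcoeff_zero [simp]: "mcoeff 0 w = 0" by (simp add: zero_magnus_def)
lemma mcoeff_one: "mcoeff 1 w = (if w = [] then 1 else 0)" by (simp add: one_magnus_def)
lemma mcoeff_add [simp]: "mcoeff (a + b) w = mcoeff a w + mcoeff b w" by (simp add: plus_magnus_def)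
lemma mcoeff_diff [simp]: "mcoeff (a - b) w = mcoeff a w - mcoeff b w" by (simp add: minus_magnus_def)
lemma mcoeff_uminus [simp]: "mcoeff (- a) w = - mcoeff a w" by (simp add: uminus_magnus_def)
lemma mcoeff_mult: "mcoeff (a * b) w = (\<Sum>n=0..length w. mcoeff a (take n w) * mcoeff b (drop n w))"
  by (simp add: times_magnus_def)

instance
proof
  fix a b c :: "'a magnus"
  show "a * b * c = a * (b * c)"
  proof (rule magnus_eqI)
    fix w :: "'a list"
    \<comment> \<open>The indices are the lengths of the three pieces of \<open>w\<close>; in this
      shape the reindexing \<open>fps_mult_assoc_lemma\<close> for power series applies.\<close>
    define f where "f i d r = mcoeff a (take i w) * mcoeff b (take d (drop i w)) * mcoeff c (drop (i + d) w)"
      for i d and r :: nat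
    have "mcoeff (a * b * c) w = (\<Sum>j=0..length w. \<Sum>i=0..j. f i (j - i) (length w - j))"
      unfolding mcoeff_mult f_def
      by (intro sum.cong refl) (auto simp: sum_distrib_right min_def drop_take intro!: sum.cong)
    also have "\<dots> = (\<Sum>j=0..length w. \<Sum>i=0..length w - j. f j i (length w - j - i))"
      by (rule fps_mult_assoc_lemma)
    also have "\<dots> = mcoeff (a * (b * c)) w"
      unfolding mcoeff_mult f_def
      by (intro sum.cong refl) (auto simp: sum_distrib_left mult.assoc add.commute intro!: sum.cong)
    finally show "mcoeff (a * b * c) w = mcoeff (a * (b * c)) w" .
  qed
  show "1 * a = a"
  proof (rule magnus_eqI)
    fix w :: "'a list"
    have "mcoeff (1 * a) w = (\<Sum>n\<in>{0..length w}. if n = 0 then mcoeff a w else 0)"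
      unfolding mcoeff_mult by (intro sum.cong) (auto simp: mcoeff_one)
    then show "mcoeff (1 * a) w = mcoeff a w" by simp
  qed
  show "a * 1 = a"
  proof (rule magnus_eqI)
    fix w :: "'a list"
    have "mcoeff (a * 1) w = (\<Sum>n\<in>{0..length w}. if n = length w then mcoeff a w else 0)"
      unfolding mcoeff_mult by (intro sum.cong) (auto simp: mcoeff_one)
    then show "mcoeff (a * 1) w = mcoeff a w" by simp
  qed
  show "(0 :: 'a magnus) \<noteq> 1"
    by (metis mcoeff_one mcoeff_zero zero_neq_one)
qed (rule magnus_eqI, simp add: mcoeff_mult algebra_simps sum.distrib)+

end

text \<open>The filtration by order; for k = 1 it is the augmentation ideal.\<close>

definition vanishes_below :: "nat \<Rightarrow> 'm magnus \<Rightarrow> bool" where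
  "vanishes_below k a \<longleftrightarrow> (\<forall>w. length w < k \<longrightarrow> mcoeff a w = 0)"

text \<open>A cut before position \<open>k\<close> kills the first factor; any other cut, except the
  one exactly at \<open>k\<close> in a word of length k + l, leaves a suffix too short for the
  second factor. Leading forms therefore multiply like words.\<close>

lemma mcoeff_mult_vanishes:
  assumes a: "vanishes_below k a" and b: "vanishes_below l b" and w: "length w \<le> k + l"
  shows "mcoeff (a * b) w = (if length w = k + l then mcoeff a (take k w) * mcoeff b (drop k w) else 0)"
proof -
  have z: "mcoeff a (take n w) * mcoeff b (drop n w) = 0" if "n \<le> length w" "\<not> (n = k \<and> length w = k + l)" for n
  proof (cases "n < k")
    case True
    then show ?thesis using a that by (simp add: vanishes_below_def)
  next
    case False
    then have "length (drop n w) < l" using that w by auto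
    then show ?thesis using b by (simp add: vanishes_below_def)
  qed
  have "mcoeff (a * b) w = (\<Sum>n\<in>{0..length w}. if n = k \<and> length w = k + l then mcoeff a (take k w) * mcoeff b (drop k w) else 0)"
    unfolding mcoeff_mult by (intro sum.cong refl) (use z in auto)
  then show ?thesis by (auto cong: conj_cong)
qed

lemma vanishes_below_mult:
  "vanishes_below k a \<Longrightarrow> vanishes_below l b \<Longrightarrow> vanishes_below (k + l) (a * b)"
  unfolding vanishes_below_def[of "k + l"]
  by (simp add: mcoeff_mult_vanishes[where k = k and l = l])

lemma vanishes_below_diff:
  "vanishes_below k a \<Longrightarrow> vanishes_below k b \<Longrightarrow> vanishes_below k (a - b)"
  by (simp add: vanishes_below_def)

lemma vanishes_below_0: "vanishes_below 0 a"
  by (simp add: vanishes_below_def)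

lemma mcoeff_mult_lead:
  assumes a: "vanishes_below k a" and c: "mcoeff c [] = 1" and w: "length w = k"
  shows "mcoeff (a * c) w = mcoeff a w"
  using mcoeff_mult_vanishes[OF a vanishes_below_0, of w c] w c by simp

text \<open>The formal exponential of \<sigma> times the letter \<open>i\<close>. It stands for the
  flow of \<sigma> f_i; the duration t is restored later by weighting a word of length n with
  t^n.\<close>

fun mexp :: "real \<times> 'm \<Rightarrow> 'm magnus" where
  "mexp (\<sigma>, i) = Magnus (\<lambda>w. if w = replicate (length w) i then \<sigma> ^ length w / fact (length w) else 0)"

fun mword :: "(real \<times> 'm) list \<Rightarrow> 'm magnus" where
  "mword [] = 1"
| "mword (a # W) = mexp a * mword W"

fun winv :: "(real \<times> 'm) list \<Rightarrow> (real \<times> 'm) list" where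
  "winv [] = []"
| "winv (a # W) = winv W @ [(- fst a, snd a)]"

lemma mword_append: "mword (V @ W) = mword V * mword W"
  by (induction V) (auto simp: mult.assoc)

text \<open>On a power of the letter \<open>i\<close> the coefficient is the binomial expansion of
  (\<sigma> - \<sigma>)^N / N!; any other word cannot be cut into two powers of
  \<open>i\<close>.\<close>

lemma mexp_inverse: "mexp (\<sigma>, i) * mexp (- \<sigma>, i) = (1 :: 'm magnus)"
proof (rule magnus_eqI)
  fix w :: "'m list"
  show "mcoeff (mexp (\<sigma>, i) * mexp (- \<sigma>, i)) w = mcoeff 1 w"
  proof (cases "w = replicate (length w) i")
    case True
    define N where "N = length w"
    have w: "w = replicate N i" using True by (simp add: N_def)
    have "mcoeff (mexp (\<sigma>, i) * mexp (- \<sigma>, i)) w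
       = (\<Sum>n=0..N. \<sigma> ^ n / fact n * ((- \<sigma>) ^ (N - n) / fact (N - n)))"
      unfolding mcoeff_mult w by (intro sum.cong) (auto simp: min_def)
    also have "\<dots> = (\<Sum>n\<le>N. of_nat (N choose n) * \<sigma> ^ n * (- \<sigma>) ^ (N - n)) / fact N"
      unfolding sum_divide_distrib atMost_atLeast0
      by (intro sum.cong refl) (simp add: binomial_fact field_simps)
    also have "\<dots> = (\<sigma> + - \<sigma>) ^ N / fact N"
      by (simp only: binomial_ring)
    also have "\<dots> = mcoeff 1 w" by (simp add: mcoeff_one w)
    finally show ?thesis .
  next
    case False
    have "\<not> (take n w = replicate (length (take n w)) i \<and> drop n w = replicate (length (drop n w)) i)" for n
      using False by (metis append_take_drop_id length_append replicate_add)
    then have "mcoeff (mexp (\<sigma>, i) * mexp (- \<sigma>, i)) w = 0"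
      unfolding mcoeff_mult by (intro sum.neutral) (auto simp del: length_take length_drop)
    moreover have "w \<noteq> []" using False by auto
    ultimately show ?thesis by (simp add: mcoeff_one)
  qed
qed

lemma mword_winv: "mword W * mword (winv W) = 1" "mword (winv W) * mword W = 1"
proof -
  have "mword W * mword (winv W) = 1 \<and> mword (winv W) * mword W = 1"
  proof (induction W)
    case (Cons a W)
    obtain \<sigma> i where a: "a = (\<sigma>, i)" by (cases a)
    have 1: "mword W * (mword (winv W) * c) = c" "mword (winv W) * (mword W * c) = c" for c
      using Cons by (metis mult.assoc mult_1)+
    have 2: "mexp (\<sigma>, i) * mexp (- \<sigma>, i) = 1" "mexp (- \<sigma>, i) * (mexp (\<sigma>, i) * c) = c" for c
      using mexp_inverse[of \<sigma> i] mexp_inverse[of "- \<sigma>" i] by (simp_all add: mult.assoc[symmetric])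
    show ?case
      using Cons 1 2 by (simp add: a mword_append mult.assoc del: mexp.simps)
  qed simp
  then show "mword W * mword (winv W) = 1" "mword (winv W) * mword W = 1" by auto
qed

lemma mword_Nil_coeff: "mcoeff (mword W) [] = 1"
proof (induction W)
  case (Cons a W)
  then show ?case by (cases a) (simp add: mcoeff_mult)
qed (simp add: mcoeff_one)

text \<open>With V = 1 + a and W = 1 + b, the group commutator minus 1 equals (a b - b a) times a
  series with constant term 1, and such a factor does not touch the lowest order. So the leading
  form of the commutator word is the bracket of the leading forms.\<close>

lemma mword_commutator_lead:
  fixes V W :: "(real \<times> 'm) list"
  assumes V: "vanishes_below k (mword V - 1)" and W: "vanishes_below l (mword W - 1)"
  defines "U \<equiv> V @ W @ winv V @ winv W"
  shows "vanishes_below (k + l) (mword U - 1)"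
    and "length w = k + l \<Longrightarrow> mcoeff (mword U - 1) w =
      mcoeff (mword V - 1) (take k w) * mcoeff (mword W - 1) (drop k w)
    - mcoeff (mword W - 1) (take l w) * mcoeff (mword V - 1) (drop l w)"
proof -
  define a where "a = mword V - 1"
  define b where "b = mword W - 1"
  have VW: "mword V = 1 + a" "mword W = 1 + b" by (simp_all add: a_def b_def)
  have "mword W * mword V * (mword (winv V) * mword (winv W)) = 1"
    by (metis mult.assoc mult_1 mword_winv(1))
  then have "mword U - 1 = (mword V * mword W - mword W * mword V) * (mword (winv V) * mword (winv W))"
    unfolding U_def mword_append by (simp add: left_diff_distrib mult.assoc)
  also have "mword V * mword W - mword W * mword V = a * b - b * a"
    unfolding VW by (simp add: algebra_simps)
  finally have U: "mword U - 1 = (a * b - b * a) * mword (winv V @ winv W)"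
    by (simp add: mword_append)
  have ab: "vanishes_below (k + l) (a * b - b * a)"
    using V W vanishes_below_mult[of k a l b] vanishes_below_mult[of l b k a]
    by (auto intro!: vanishes_below_diff simp: a_def b_def add.commute)
  show "vanishes_below (k + l) (mword U - 1)"
    using vanishes_below_mult[OF ab vanishes_below_0] U by simp
  assume w: "length w = k + l"
  have "mcoeff (mword U - 1) w = mcoeff (a * b - b * a) w"
    unfolding U by (rule mcoeff_mult_lead[OF ab mword_Nil_coeff w])
  also have "\<dots> = mcoeff a (take k w) * mcoeff b (drop k w) - mcoeff b (take l w) * mcoeff a (drop l w)"
    using mcoeff_mult_vanishes[of k a l b w] mcoeff_mult_vanishes[of l b k a w] V W w
    by (simp add: a_def b_def add.commute)
  finally show "mcoeff (mword U - 1) w =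
      mcoeff (mword V - 1) (take k w) * mcoeff (mword W - 1) (drop k w)
    - mcoeff (mword W - 1) (take l w) * mcoeff (mword V - 1) (drop l w)"
    by (simp add: a_def b_def)
qed

text \<open>From \<open>V^-1 - 1 = -(V - 1) V^-1\<close>, where the last factor has constant term
  1.\<close>

lemma mword_inverse_lead:
  assumes V: "vanishes_below k (mword V - 1)"
  shows "vanishes_below k (mword (winv V) - 1)"
    and "length w = k \<Longrightarrow> mcoeff (mword (winv V) - 1) w = - mcoeff (mword V - 1) w"
proof -
  have eq: "mword (winv V) - 1 = - (mword V - 1) * mword (winv V)"
    using mword_winv(1)[of V] by (simp add: algebra_simps)
  have m: "vanishes_below k (- (mword V - 1))"
    using V by (simp add: vanishes_below_def)
  show "vanishes_below k (mword (winv V) - 1)"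
    using vanishes_below_mult[OF m vanishes_below_0] eq by simp
  show "mcoeff (mword (winv V) - 1) w = - mcoeff (mword V - 1) w" if "length w = k"
    unfolding eq using mcoeff_mult_lead[OF m mword_Nil_coeff that] by simp
qed

section \<open>Taylor expansion along words\<close>

text \<open>The first letter is outermost, in accordance with the action of flows on functions: the
  flow that is run first is the pullback applied last.\<close>

fun word_deriv :: "('m \<Rightarrow> real^'d \<Rightarrow> real^'d) \<Rightarrow> 'm list \<Rightarrow> (real^'d \<Rightarrow> real) \<Rightarrow> real^'d \<Rightarrow> real" where
  "word_deriv f [] g = g"
| "word_deriv f (i # w) g = lie_deriv (f i) (word_deriv f w g)"

lemma word_deriv_append: "word_deriv f (v @ w) g = word_deriv f v (word_deriv f w g)"
  by (induction v) auto

lemma smooth_word_deriv: "(\<And>i. smooth (f i)) \<Longrightarrow> smooth g \<Longrightarrow> smooth (word_deriv f w g)"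
  by (induction w) (auto intro: smooth_lie_deriv)

lemma lie_deriv_sum:
  assumes "\<And>q. q \<in> Q \<Longrightarrow> smooth (h q)"
  shows "lie_deriv X (\<lambda>x. \<Sum>q\<in>Q. c q * h q x) = (\<lambda>x. \<Sum>q\<in>Q. c q * lie_deriv X (h q) x)"
proof
  fix x
  have "((\<lambda>x. \<Sum>q\<in>Q. c q * h q x) has_derivative (\<lambda>v. \<Sum>q\<in>Q. c q * frechet_derivative (h q) (at x) v)) (at x)"
    by (intro has_derivative_sum has_derivative_mult_right smooth_has_derivative assms)
  then show "lie_deriv X (\<lambda>x. \<Sum>q\<in>Q. c q * h q x) x = (\<Sum>q\<in>Q. c q * lie_deriv X (h q) x)"
    by (simp add: lie_deriv_def frechet_derivative_eq)
qed

lemma word_deriv_sum: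
  assumes "\<And>i. smooth (f i)" "\<And>q. q \<in> Q \<Longrightarrow> smooth (h q)"
  shows "word_deriv f w (\<lambda>x. \<Sum>q\<in>Q. c q * h q x) = (\<lambda>x. \<Sum>q\<in>Q. c q * word_deriv f w (h q) x)"
  by (induction w) (auto simp: lie_deriv_sum smooth_word_deriv assms)

lemma finite_words: "finite {w :: 'm::finite list. length w = n}" "finite {w :: 'm::finite list. length w \<le> n}"
  using finite_lists_length_eq[of "UNIV :: 'm set" n] finite_lists_length_le[of "UNIV :: 'm set" n] by auto

lemma sum_words_split:
  fixes F :: "'m::finite list \<Rightarrow> 'm list \<Rightarrow> real"
  shows "(\<Sum>w | length w = k + l. F (take k w) (drop k w)) = (\<Sum>p | length p = k. \<Sum>q | length q = l. F p q)"
  unfolding sum.cartesian_product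
  by (rule sum.reindex_bij_witness[where i = "\<lambda>(p, q). p @ q" and j = "\<lambda>w. (take k w, drop k w)"]) auto

text \<open>Evaluating words as differential operators turns the lowest-order part of
  \<open>mword W - 1\<close> into the derivative along \<open>Z\<close>: for small t the word moves
  by about t^k Z. The bound on the exponents keeps remainders and controls uniform.\<close>

definition word_leads :: "('m::finite \<Rightarrow> real^'d \<Rightarrow> real^'d) \<Rightarrow> (real \<times> 'm) list \<Rightarrow> nat \<Rightarrow> (real^'d \<Rightarrow> real^'d) \<Rightarrow> bool" where
  "word_leads f W k Z \<longleftrightarrow> k \<ge> 1 \<and> vanishes_below k (mword W - 1) \<and> (\<forall>a\<in>set W. \<bar>fst a\<bar> \<le> 1) \<and>
     (\<forall>g z. smooth g \<longrightarrow> (\<Sum>w | length w = k. mcoeff (mword W - 1) w * word_deriv f w g z) = lie_deriv Z g z)"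

lemma word_leadsD:
  assumes "word_leads f W k Z"
  shows "k \<ge> 1" "vanishes_below k (mword W - 1)" "\<forall>a\<in>set W. \<bar>fst a\<bar> \<le> 1"
    "smooth g \<Longrightarrow> (\<Sum>w | length w = k. mcoeff (mword W - 1) w * word_deriv f w g z) = lie_deriv Z g z"
  using assms unfolding word_leads_def by blast+

text \<open>Concatenation of words is composition of operators, so the product of two leading forms
  acts as one Lie derivative after the other. The inner sum is differentiated further, hence the
  hypothesis on \<open>Y\<close> is used as an equality of functions.\<close>

lemma sum_word_pair_lead:
  fixes f :: "'m::finite \<Rightarrow> real^'d \<Rightarrow> real^'d"
  assumes f: "\<And>i. smooth (f i)" and g: "smooth g" and Y: "smooth Y"
    and a: "\<And>g z. smooth g \<Longrightarrow> (\<Sum>w | length w = k. a w * word_deriv f w g z) = lie_deriv X g z"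
    and b: "\<And>g z. smooth g \<Longrightarrow> (\<Sum>w | length w = l. b w * word_deriv f w g z) = lie_deriv Y g z"
  shows "(\<Sum>w | length w = k + l. a (take k w) * b (drop k w) * word_deriv f w g z) = lie_deriv X (lie_deriv Y g) z"
proof -
  have Yg: "(\<lambda>x. \<Sum>q | length q = l. b q * word_deriv f q g x) = lie_deriv Y g"
    using b[OF g] by blast
  have "(\<Sum>w | length w = k + l. a (take k w) * b (drop k w) * word_deriv f w g z) =
    (\<Sum>w | length w = k + l. a (take k w) * b (drop k w) * word_deriv f (take k w @ drop k w) g z)"
    by simp
  also have "\<dots> = (\<Sum>p | length p = k. \<Sum>q | length q = l. a p * b q * word_deriv f (p @ q) g z)"
    by (rule sum_words_split)
  also have "\<dots> = (\<Sum>p | length p = k. a p * word_deriv f p (\<lambda>x. \<Sum>q | length q = l. b q * word_deriv f q g x) z)"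
    by (simp add: word_deriv_sum smooth_word_deriv f g word_deriv_append sum_distrib_left mult.assoc)
  also have "\<dots> = lie_deriv X (lie_deriv Y g) z"
    unfolding Yg by (rule a) (intro smooth_lie_deriv Y g)
  finally show ?thesis .
qed

lemma winv_signs: "(\<forall>a\<in>set W. \<bar>fst a\<bar> \<le> 1) \<Longrightarrow> (\<forall>a\<in>set (winv W). \<bar>fst a\<bar> \<le> (1::real))"
  by (induction W) auto

lemma word_leads_winv:
  assumes "word_leads f W k Z"
  shows "word_leads f (winv W) k (\<lambda>x. - Z x)"
proof -
  have W: "vanishes_below k (mword W - 1)" using assms by (simp add: word_leads_def)
  have "lie_deriv (\<lambda>x. - Z x) g z = - lie_deriv Z g z" if "smooth g" for g z
    using that by (simp add: lie_deriv_def linear_neg linear_smooth_derivative)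
  moreover have "(\<Sum>w | length w = k. mcoeff (mword (winv W) - 1) w * word_deriv f w g z)
      = - (\<Sum>w | length w = k. mcoeff (mword W - 1) w * word_deriv f w g z)" for g z
    unfolding sum_negf[symmetric] 
    by (intro sum.cong refl) (simp only: mword_inverse_lead(2)[OF W] mem_Collect_eq minus_mult_left)
  ultimately have "(\<Sum>w | length w = k. mcoeff (mword (winv W) - 1) w * word_deriv f w g z) = lie_deriv (\<lambda>x. - Z x) g z"
    if "smooth g" for g z
    using that word_leadsD(4)[OF assms] by simp
  moreover have "1 \<le> k" "\<forall>a\<in>set (winv W). \<bar>fst a\<bar> \<le> 1"
    using word_leadsD[OF assms] winv_signs[of W] by blast+
  ultimately show ?thesis
    using mword_inverse_lead(1)[OF W] unfolding word_leads_def by blast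
qed

text \<open>The leading form of the commutator word acts as the commutator of the Lie derivatives
  along \<open>X\<close> and \<open>Y\<close>, which \<open>lie_deriv_commutator\<close> identifies
  with the derivative along the bracket; the orders add.\<close>

lemma word_leads_bracket:
  assumes f: "\<And>i. smooth (f i)" and X: "smooth X" and Y: "smooth Y"
    and V: "word_leads f V k X" and W: "word_leads f W l Y"
  shows "word_leads f (V @ W @ winv V @ winv W) (k + l) (lie_bracket X Y)"
proof -
  let ?U = "V @ W @ winv V @ winv W"
  let ?a = "mcoeff (mword V - 1)" and ?b = "mcoeff (mword W - 1)"
  note v = word_leadsD(2)[OF V] word_leadsD(2)[OF W]
  note aX = word_leadsD(4)[OF V] and bY = word_leadsD(4)[OF W]
  have "(\<Sum>w | length w = k + l. mcoeff (mword ?U - 1) w * word_deriv f w g z) = lie_deriv (lie_bracket X Y) g z"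
    if g: "smooth g" for g z
  proof -
    have "(\<Sum>w | length w = k + l. mcoeff (mword ?U - 1) w * word_deriv f w g z) =
      (\<Sum>w | length w = k + l. (?a (take k w) * ?b (drop k w) - ?b (take l w) * ?a (drop l w)) * word_deriv f w g z)"
      using mword_commutator_lead(2)[OF v] by (intro sum.cong refl) simp
    also have "\<dots> = (\<Sum>w | length w = k + l. ?a (take k w) * ?b (drop k w) * word_deriv f w g z)
      - (\<Sum>w | length w = l + k. ?b (take l w) * ?a (drop l w) * word_deriv f w g z)"
      by (simp only: left_diff_distrib sum_subtractf add.commute)
    also have "\<dots> = lie_deriv X (lie_deriv Y g) z - lie_deriv Y (lie_deriv X g) z"
      using sum_word_pair_lead[OF f g Y aX bY, of z] sum_word_pair_lead[OF f g X bY aX, of z] by simp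
    finally show ?thesis by (simp add: lie_deriv_commutator g X Y)
  qed
  moreover have "\<forall>a\<in>set ?U. \<bar>fst a\<bar> \<le> 1"
    using word_leadsD(3)[OF V] word_leadsD(3)[OF W] winv_signs[of V] winv_signs[of W] by auto
  moreover have "1 \<le> k + l" using word_leadsD(1)[OF V] by simp
  ultimately show ?thesis
    using mword_commutator_lead(1)[OF v] unfolding word_leads_def by blast
qed

lemma word_leads_generator: "word_leads f [(1, i)] 1 (f i)"
proof -
  have coeff: "mcoeff (mword [(1, i)] - 1) [j] = (if j = i then 1 else 0)" for j
    by (auto simp: mcoeff_one)
  have "(\<Sum>w | length w = 1. mcoeff (mword [(1, i)] - 1) w * word_deriv f w g z) = lie_deriv (f i) g z" for g z
  proof -
    have "(\<Sum>w | length w = 1. mcoeff (mword [(1, i)] - 1) w * word_deriv f w g z)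
      = (\<Sum>j\<in>UNIV. mcoeff (mword [(1, i)] - 1) [j] * word_deriv f [j] g z)"
      by (rule sum.reindex_bij_witness[where i = "\<lambda>j. [j]" and j = hd]) (auto simp: length_Suc_conv)
    also have "\<dots> = (\<Sum>j\<in>UNIV. if j = i then lie_deriv (f i) g z else 0)"
      unfolding coeff by (intro sum.cong) auto
    finally show ?thesis by simp
  qed
  then show ?thesis
    by (auto simp: word_leads_def vanishes_below_def mcoeff_one simp del: One_nat_def)
qed

lemma lie_gen_word_leads:
  assumes "Z \<in> lie_gen f" and f: "\<And>i. smooth (f i)"
  shows "\<exists>W k. word_leads f W k Z"
  using assms(1)
proof induction
  case (gen i)
  show ?case using word_leads_generator by blast
next
  case (bracket X Y)
  moreover have "smooth X" "smooth Y" using bracket.hyps lie_gen_smooth f by blast+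
  ultimately obtain V k W l where "word_leads f V k X" "word_leads f W l Y" by blast
  then show ?case using word_leads_bracket[of f X Y V k W l] f \<open>smooth X\<close> \<open>smooth Y\<close> by blast
qed

text \<open>A relation between endpoints rather than a composition of flow maps: the expansions
  below speak of arbitrary integral curves, and existence is supplied separately by
  \<open>word_traj\<close>.\<close>

fun word_path :: "('m \<Rightarrow> real^'d \<Rightarrow> real^'d) \<Rightarrow> real \<Rightarrow> (real \<times> 'm) list \<Rightarrow> real^'d \<Rightarrow> real^'d \<Rightarrow> bool" where
  "word_path f t [] z z' \<longleftrightarrow> z' = z"
| "word_path f t (a # W) z z' \<longleftrightarrow>
    (\<exists>\<gamma>. (\<forall>s\<in>{0..t}. (\<gamma> has_vector_derivative fst a *\<^sub>R f (snd a) (\<gamma> s)) (at s within {0..t})) \<and>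
         \<gamma> 0 = z \<and> word_path f t W (\<gamma> t) z')"

text \<open>The empty word is excluded because the intended \<open>g\<close> are the coordinates,
  unbounded on R^d, whose derivatives along the periodic fields are periodic and hence
  bounded.\<close>

definition bounded_derivs :: "('m \<Rightarrow> real^'d \<Rightarrow> real^'d) \<Rightarrow> (real^'d \<Rightarrow> real) \<Rightarrow> bool" where
  "bounded_derivs f g \<longleftrightarrow> smooth g \<and> (\<forall>w. w \<noteq> [] \<longrightarrow> (\<exists>B. \<forall>z. \<bar>word_deriv f w g z\<bar> \<le> B))"

lemma bounded_derivs_word_deriv:
  assumes "\<And>i. smooth (f i)" "bounded_derivs f g"
  shows "bounded_derivs f (word_deriv f w g)"
  using assms unfolding bounded_derivs_def
  by (auto simp: smooth_word_deriv simp flip: word_deriv_append)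

text \<open>Along the curve, differentiating X^j g gives \<sigma> X^(j+1) g, so this is the Taylor
  formula in one variable. The quantifier order matters: \<open>B\<close> serves all curves and all
  durations at once.\<close>

lemma taylor_integral_curve:
  fixes f :: "'m::finite \<Rightarrow> real^'d \<Rightarrow> real^'d"
  assumes f: "\<And>i. smooth (f i)" and g: "bounded_derivs f g" and s: "\<bar>\<sigma>\<bar> \<le> 1"
  shows "\<exists>B. \<forall>t \<gamma>. 0 \<le> t \<and> (\<forall>s\<in>{0..t}. (\<gamma> has_vector_derivative \<sigma> *\<^sub>R f i (\<gamma> s)) (at s within {0..t})) \<longrightarrow>
     \<bar>g (\<gamma> t) - (\<Sum>j\<le>k. (\<sigma> * t) ^ j / fact j * word_deriv f (replicate j i) g (\<gamma> 0))\<bar> \<le> B * t ^ Suc k"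
proof -
  obtain B where B: "\<And>z. \<bar>word_deriv f (replicate (Suc k) i) g z\<bar> \<le> B"
    using g unfolding bounded_derivs_def by (metis replicate_Suc list.distinct(1))
  have B0: "B \<ge> 0" using B[of 0] by linarith
  have sg: "smooth g" using g by (simp add: bounded_derivs_def)
  have "\<bar>g (\<gamma> t) - (\<Sum>j\<le>k. (\<sigma> * t) ^ j / fact j * word_deriv f (replicate j i) g (\<gamma> 0))\<bar> \<le> B * t ^ Suc k"
    if t: "0 \<le> t" and c: "\<forall>s\<in>{0..t}. (\<gamma> has_vector_derivative \<sigma> *\<^sub>R f i (\<gamma> s)) (at s within {0..t})" for t \<gamma>
  proof -
    define F where "F j s = \<sigma> ^ j * word_deriv f (replicate j i) g (\<gamma> s)" for j and s :: real
    have d: "(F j has_field_derivative F (Suc j) s) (at s within {0..t})" if "s \<in> {0..t}" for j s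
    proof -
      let ?h = "word_deriv f (replicate j i) g"
      have h: "smooth ?h" by (intro smooth_word_deriv f sg)
      have "((\<lambda>s. ?h (\<gamma> s)) has_derivative (\<lambda>r. frechet_derivative ?h (at (\<gamma> s)) (r *\<^sub>R (\<sigma> *\<^sub>R f i (\<gamma> s))))) (at s within {0..t})"
        by (rule has_derivative_compose) (use c that in \<open>auto simp: has_vector_derivative_def intro!: smooth_has_derivative h\<close>)
      moreover have "frechet_derivative ?h (at (\<gamma> s)) (r *\<^sub>R (\<sigma> *\<^sub>R f i (\<gamma> s))) = (\<sigma> * word_deriv f (replicate (Suc j) i) g (\<gamma> s)) * r" for r
        using linear_smooth_derivative[OF h] by (simp add: linear_scale lie_deriv_def)
      ultimately have "((\<lambda>s. ?h (\<gamma> s)) has_field_derivative (\<sigma> * word_deriv f (replicate (Suc j) i) g (\<gamma> s))) (at s within {0..t})"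
        by (simp only: has_field_derivative_def)
      from DERIV_cmult[OF this, of "\<sigma> ^ j"] show ?thesis
        unfolding F_def by (simp add: mult_ac)
    qed
    have "norm (F 0 t - (\<Sum>j\<le>k. F j 0 * (t - 0) ^ j / fact j)) \<le> B * norm (t - 0) ^ Suc k / fact k"
    proof (rule field_Taylor[where S = "{0..t}"])
      fix s assume "s \<in> {0..t}"
      have "\<bar>\<sigma>\<bar> ^ Suc k * \<bar>word_deriv f (replicate (Suc k) i) g (\<gamma> s)\<bar> \<le> 1 * B"
        using s B[of "\<gamma> s"] by (intro mult_mono power_le_one) auto
      then show "norm (F (Suc k) s) \<le> B" unfolding F_def by (simp only: real_norm_def abs_mult power_abs)
    qed (use d t in auto)
    also have "\<dots> \<le> B * norm (t - 0) ^ Suc k / 1"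
      by (rule divide_left_mono) (use B0 in \<open>auto simp: fact_ge_1\<close>)
    also have "\<dots> = B * t ^ Suc k"
      using t by simp
    finally show ?thesis by (simp add: F_def power_mult_distrib mult_ac)
  qed
  then show ?thesis by blast
qed

lemma sum_mexp:
  fixes h :: "'m::finite list \<Rightarrow> real"
  shows "(\<Sum>p | length p \<le> n. mcoeff (mexp (\<sigma>, i)) p * h p) = (\<Sum>j\<le>n. \<sigma> ^ j / fact j * h (replicate j i))"
proof -
  have "(\<Sum>p | length p \<le> n. mcoeff (mexp (\<sigma>, i)) p * h p)
    = (\<Sum>p\<in>(\<lambda>j. replicate j i) ` {..n}. mcoeff (mexp (\<sigma>, i)) p * h p)"
  proof (rule sum.mono_neutral_right)
    show "\<forall>p\<in>{p. length p \<le> n} - (\<lambda>j. replicate j i) ` {..n}. mcoeff (mexp (\<sigma>, i)) p * h p = 0"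
      by (auto simp: image_iff)
  qed (auto simp: finite_words)
  also have "\<dots> = (\<Sum>j\<le>n. \<sigma> ^ j / fact j * h (replicate j i))"
    by (subst sum.reindex) (auto simp: inj_on_def)
  finally show ?thesis .
qed

text \<open>Words are regrouped by their cut: the suffix \<open>v\<close> belongs to the second
  factor, and the prefix \<open>p\<close> may use the remaining length.\<close>

lemma sum_mult_words:
  fixes H :: "'m::finite list \<Rightarrow> real"
  shows "(\<Sum>w | length w \<le> k. mcoeff (a * b) w * H w)
    = (\<Sum>v | length v \<le> k. \<Sum>p | length p \<le> k - length v. mcoeff a p * mcoeff b v * H (p @ v))"
proof -
  have "(\<Sum>w | length w \<le> k. mcoeff (a * b) w * H w)
     = (\<Sum>(w, n)\<in>(SIGMA w:{w. length w \<le> k}. {0..length w}). mcoeff a (take n w) * mcoeff b (drop n w) * H w)"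
    unfolding mcoeff_mult sum_distrib_right
    by (subst sum.Sigma) (auto simp: finite_words)
  also have "\<dots> = (\<Sum>(v, p)\<in>(SIGMA v:{v. length v \<le> k}. {p. length p \<le> k - length v}). mcoeff a p * mcoeff b v * H (p @ v))"
    by (rule sum.reindex_bij_witness[where i = "\<lambda>(v, p). (p @ v, length p)" and j = "\<lambda>(w, n). (drop n w, take n w)"]) auto
  also have "\<dots> = (\<Sum>v | length v \<le> k. \<Sum>p | length p \<le> k - length v. mcoeff a p * mcoeff b v * H (p @ v))"
    by (subst sum.Sigma) (auto simp: finite_words)
  finally show ?thesis .
qed

text \<open>Induction peels off the first letter. The rest of the word is expanded at the
  intermediate point \<open>\<gamma> t\<close>; each derivative along \<open>v\<close> already
  carries the weight t^|v|, so expanding it along the first letter to order k - |v| leaves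
  remainders of order t^(k+1). The double sum that arises is the product in the Magnus ring.\<close>

lemma word_expansion:
  fixes f :: "'m::finite \<Rightarrow> real^'d \<Rightarrow> real^'d"
  assumes f: "\<And>i. smooth (f i)" and g: "bounded_derivs f g" and W: "\<forall>a\<in>set W. \<bar>fst a\<bar> \<le> 1"
  shows "\<exists>B. \<forall>t z z'. 0 \<le> t \<and> word_path f t W z z' \<longrightarrow>
    \<bar>g z' - (\<Sum>w | length w \<le> k. mcoeff (mword W) w * (t ^ length w * word_deriv f w g z))\<bar> \<le> B * t ^ Suc k"
  using W
proof (induction W)
  case Nil
  have "(\<Sum>w | length w \<le> k. mcoeff (1 :: 'm magnus) w * (t ^ length w * word_deriv f w g z)) = g z" for t z
  proof -
    have "(\<Sum>w | length w \<le> k. mcoeff (1 :: 'm magnus) w * (t ^ length w * word_deriv f w g z)) = (\<Sum>w\<in>{w :: 'm list. length w \<le> k}. if w = [] then g z else 0)"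
      by (intro sum.cong) (auto simp: mcoeff_one)
    then show ?thesis by (simp add: finite_words)
  qed
  then show ?case by (intro exI[of _ 0]) auto
next
  case (Cons a W)
  obtain \<sigma> i where a: "a = (\<sigma>, i)" by (cases a)
  have s: "\<bar>\<sigma>\<bar> \<le> 1" using Cons.prems by (simp add: a)
  let ?M = "mcoeff (mword W)"
  obtain B0 where B0: "\<And>t z z'. 0 \<le> t \<Longrightarrow> word_path f t W z z' \<Longrightarrow>
    \<bar>g z' - (\<Sum>v | length v \<le> k. ?M v * (t ^ length v * word_deriv f v g z))\<bar> \<le> B0 * t ^ Suc k"
    using Cons by auto
  define Q where "Q v B \<longleftrightarrow> (\<forall>t \<gamma>. 0 \<le> t \<and> (\<forall>s\<in>{0..t}. (\<gamma> has_vector_derivative \<sigma> *\<^sub>R f i (\<gamma> s)) (at s within {0..t})) \<longrightarrow>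
     \<bar>word_deriv f v g (\<gamma> t) - (\<Sum>j\<le>k - length v. (\<sigma> * t) ^ j / fact j * word_deriv f (replicate j i) (word_deriv f v g) (\<gamma> 0))\<bar> \<le> B * t ^ Suc (k - length v))"
    for v B
  have "\<exists>B. Q v B" for v
    unfolding Q_def by (rule taylor_integral_curve[OF f bounded_derivs_word_deriv[OF f g] s])
  then obtain Bv where "Q v (Bv v)" for v by metis
  then have Bv: "\<And>v t \<gamma>. 0 \<le> t \<Longrightarrow> (\<forall>s\<in>{0..t}. (\<gamma> has_vector_derivative \<sigma> *\<^sub>R f i (\<gamma> s)) (at s within {0..t})) \<Longrightarrow>
     \<bar>word_deriv f v g (\<gamma> t) - (\<Sum>j\<le>k - length v. (\<sigma> * t) ^ j / fact j * word_deriv f (replicate j i) (word_deriv f v g) (\<gamma> 0))\<bar> \<le> Bv v * t ^ Suc (k - length v)"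
    unfolding Q_def by (simp only: conj_absorb)
  have "\<bar>g z' - (\<Sum>w | length w \<le> k. mcoeff (mword (a # W)) w * (t ^ length w * word_deriv f w g z))\<bar>
      \<le> (B0 + (\<Sum>v | length v \<le> k. \<bar>?M v\<bar> * Bv v)) * t ^ Suc k"
    if t: "0 \<le> t" and p: "word_path f t (a # W) z z'" for t z z'
  proof -
    obtain \<gamma> where c: "\<forall>s\<in>{0..t}. (\<gamma> has_vector_derivative \<sigma> *\<^sub>R f i (\<gamma> s)) (at s within {0..t})"
      and z: "\<gamma> 0 = z" and p': "word_path f t W (\<gamma> t) z'" using p by (auto simp: a)
    define T where "T v = (\<Sum>j\<le>k - length v. (\<sigma> * t) ^ j / fact j * word_deriv f (replicate j i) (word_deriv f v g) z)" for v
    have expand: "(\<Sum>w | length w \<le> k. mcoeff (mword (a # W)) w * (t ^ length w * word_deriv f w g z))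
       = (\<Sum>v | length v \<le> k. ?M v * (t ^ length v * T v))"
    proof -
      have "(\<Sum>p | length p \<le> k - length v. mcoeff (mexp (\<sigma>, i)) p * ?M v * (t ^ length (p @ v) * word_deriv f (p @ v) g z)) = ?M v * (t ^ length v * T v)" for v
      proof -
        have "(\<Sum>p | length p \<le> k - length v. mcoeff (mexp (\<sigma>, i)) p * ?M v * (t ^ length (p @ v) * word_deriv f (p @ v) g z))
          = (\<Sum>p | length p \<le> k - length v. mcoeff (mexp (\<sigma>, i)) p * (?M v * (t ^ length (p @ v) * word_deriv f (p @ v) g z)))"
          by (simp only: mult.assoc)
        also have "\<dots> = (\<Sum>j\<le>k - length v. \<sigma> ^ j / fact j * (?M v * (t ^ length (replicate j i @ v) * word_deriv f (replicate j i @ v) g z)))"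
          by (rule sum_mexp)
        also have "\<dots> = ?M v * (t ^ length v * T v)"
          unfolding T_def sum_distrib_left
          by (intro sum.cong refl) (simp add: word_deriv_append power_add power_mult_distrib)
        finally show ?thesis .
      qed
      then show ?thesis by (simp only: a mword.simps sum_mult_words)
    qed
    have "\<bar>(\<Sum>v | length v \<le> k. ?M v * (t ^ length v * word_deriv f v g (\<gamma> t))) - (\<Sum>v | length v \<le> k. ?M v * (t ^ length v * T v))\<bar>
      \<le> (\<Sum>v | length v \<le> k. \<bar>?M v * (t ^ length v * (word_deriv f v g (\<gamma> t) - T v))\<bar>)"
      unfolding sum_subtractf[symmetric] right_diff_distrib by (rule sum_abs)
    also have "\<dots> \<le> (\<Sum>v | length v \<le> k. \<bar>?M v\<bar> * Bv v * t ^ Suc k)"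
    proof (rule sum_mono)
      fix v :: "'m list" assume v: "v \<in> {v. length v \<le> k}"
      have "\<bar>?M v * (t ^ length v * (word_deriv f v g (\<gamma> t) - T v))\<bar> = \<bar>?M v\<bar> * (t ^ length v * \<bar>word_deriv f v g (\<gamma> t) - T v\<bar>)"
        using t by (simp add: abs_mult)
      also have "\<dots> \<le> \<bar>?M v\<bar> * (t ^ length v * (Bv v * t ^ Suc (k - length v)))"
        using Bv[OF t c, of v] t unfolding T_def z by (intro mult_left_mono) auto
      also have "\<dots> = \<bar>?M v\<bar> * Bv v * t ^ Suc k"
      proof -
        have "t ^ Suc k = t ^ length v * t ^ Suc (k - length v)"
          using v by (simp flip: power_add)
        then show ?thesis by (simp only: mult_ac)
      qed
      finally show "\<bar>?M v * (t ^ length v * (word_deriv f v g (\<gamma> t) - T v))\<bar> \<le> \<bar>?M v\<bar> * Bv v * t ^ Suc k" .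
    qed
    finally show ?thesis
      using B0[OF t p'] unfolding expand distrib_right sum_distrib_right by linarith
  qed
  then show ?case by blast
qed

text \<open>Up to order \<open>k\<close> only the empty word and words of length exactly
  \<open>k\<close> can have nonzero coefficients; the former gives g z, the latter the derivative
  along \<open>Z\<close>.\<close>

lemma word_leads_endpoint_component:
  fixes f :: "'m::finite \<Rightarrow> real^'d \<Rightarrow> real^'d"
  assumes f: "\<And>i. smooth (f i)" and g: "bounded_derivs f g" and W: "word_leads f W k Z"
  shows "\<exists>B. \<forall>t z z'. 0 \<le> t \<and> word_path f t W z z' \<longrightarrow>
    \<bar>g z' - g z - t ^ k * lie_deriv Z g z\<bar> \<le> B * t ^ Suc k"
proof -
  note signs = word_leadsD(3)[OF W] and van = word_leadsD(2)[OF W]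
  have "smooth g" using g by (simp add: bounded_derivs_def)
  note sum = word_leadsD(4)[OF W this]
  have "(\<Sum>w | length w \<le> k. mcoeff (mword W) w * (t ^ length w * word_deriv f w g z)) = g z + t ^ k * lie_deriv Z g z" for t z
  proof -
    let ?S = "{w :: 'm list. length w \<le> k}" and ?h = "\<lambda>w. t ^ length w * word_deriv f w g z"
    have "(\<Sum>w\<in>?S. mcoeff (mword W) w * ?h w) = (\<Sum>w\<in>?S. mcoeff 1 w * ?h w) + (\<Sum>w\<in>?S. mcoeff (mword W - 1) w * ?h w)"
      by (simp add: sum.distrib[symmetric] algebra_simps)
    also have "(\<Sum>w\<in>?S. mcoeff 1 w * ?h w) = (\<Sum>w\<in>?S. if w = [] then g z else 0)"
      by (intro sum.cong) (auto simp: mcoeff_one)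
    also have "\<dots> = g z" by (simp add: finite_words)
    also have "(\<Sum>w\<in>?S. mcoeff (mword W - 1) w * ?h w) = (\<Sum>w | length w = k. mcoeff (mword W - 1) w * ?h w)"
    proof (rule sum.mono_neutral_right)
      show "\<forall>w\<in>?S - {w. length w = k}. mcoeff (mword W - 1) w * ?h w = 0"
        using van unfolding vanishes_below_def by (auto simp del: mcoeff_diff)
    qed (auto simp: finite_words)
    also have "\<dots> = t ^ k * (\<Sum>w | length w = k. mcoeff (mword W - 1) w * word_deriv f w g z)"
      unfolding sum_distrib_left by (intro sum.cong refl) (simp del: mcoeff_diff)
    finally show ?thesis unfolding sum .
  qed
  then show ?thesis
    using word_expansion[OF f g signs, of k] by (simp only: diff_diff_eq)
qed

section \<open>Trajectories with bounded controls\<close>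

lemma intvec_floor: "intvec (\<chi> i. of_int \<lfloor>x $ i\<rfloor>)"
  by (simp add: intvec_def)

lemma intvec_simps: "intvec 0" "intvec x \<Longrightarrow> intvec (- x)" "intvec x \<Longrightarrow> intvec y \<Longrightarrow> intvec (x + y)"
  "intvec x \<Longrightarrow> intvec y \<Longrightarrow> intvec (x - y)"
  by (auto simp: intvec_def)

lemma periodic_eq_frac:
  fixes g :: "real^'d \<Rightarrow> 'b"
  assumes "periodic g"
  shows "\<exists>y\<in>cbox 0 1. g x = g y"
proof -
  let ?k = "(\<chi> i. of_int \<lfloor>x $ i\<rfloor>) :: real^'d"
  have "g (x - ?k + ?k) = g (x - ?k)"
    using assms intvec_floor[of x] unfolding periodic_def by blast
  moreover have "x - ?k \<in> cbox 0 1"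
    by (auto simp: mem_box_cart) linarith+
  ultimately show ?thesis by (metis diff_add_cancel)
qed

lemma periodic_bounded:
  fixes g :: "real^'d \<Rightarrow> 'b::real_normed_vector"
  assumes p: "periodic g" and c: "continuous_on UNIV g"
  shows "\<exists>B\<ge>0. \<forall>x. norm (g x) \<le> B"
proof -
  have "compact (g ` cbox 0 1)"
    by (intro compact_continuous_image continuous_on_subset[OF c]) auto
  then obtain B where B: "\<And>y. y \<in> cbox 0 1 \<Longrightarrow> norm (g y) \<le> B"
    using compact_imp_bounded bounded_iff by (metis imageI)
  have "norm (g x) \<le> B" for x
    using periodic_eq_frac[OF p, of x] B by metis
  moreover from this[of 0] have "B \<ge> 0" using norm_ge_zero order_trans by blast
  ultimately show ?thesis by blast
qed

text \<open>The same linear maps are derivatives at both points, so the choice made by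
  \<open>frechet_derivative\<close> agrees even where \<open>g\<close> is not
  differentiable.\<close>

lemma periodic_derivative:
  fixes g :: "real^'d \<Rightarrow> 'b::real_normed_vector"
  assumes p: "periodic g" and k: "intvec k"
  shows "frechet_derivative g (at (x + k)) = frechet_derivative g (at x)"
proof -
  have shift: "(\<lambda>y. g (y + k)) = g" using p k by (auto simp: periodic_def)
  have "(g has_derivative g') (at (x + k)) \<longleftrightarrow> (g has_derivative g') (at x)" for g'
  proof
    assume "(g has_derivative g') (at (x + k))"
    moreover have "((\<lambda>y. y + k) has_derivative (\<lambda>v. v)) (at x)"
      by (auto intro!: derivative_eq_intros)
    ultimately have "((\<lambda>y. g (y + k)) has_derivative (\<lambda>v. g' v)) (at x)"
      using has_derivative_compose by blast
    then show "(g has_derivative g') (at x)" by (simp add: shift)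
  next
    have shift': "(\<lambda>y. g (y - k)) = g"
    proof
      fix y show "g (y - k) = g y" using fun_cong[OF shift, of "y - k"] by simp
    qed
    assume "(g has_derivative g') (at x)"
    then have "(g has_derivative g') (at (x + k - k))" by simp
    moreover have "((\<lambda>y. y - k) has_derivative (\<lambda>v. v)) (at (x + k))"
      by (auto intro!: derivative_eq_intros)
    ultimately have "((\<lambda>y. g (y - k)) has_derivative (\<lambda>v. g' v)) (at (x + k))"
      using has_derivative_compose by blast
    then show "(g has_derivative g') (at (x + k))" by (simp add: shift')
  qed
  then show ?thesis by (simp add: frechet_derivative_def)
qed

lemma periodic_component: "periodic g \<Longrightarrow> periodic (\<lambda>x. g x $ j)"
  by (simp add: periodic_def)

lemma periodic_lie_deriv: "periodic X \<Longrightarrow> periodic g \<Longrightarrow> periodic (lie_deriv X g)"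
proof -
  assume X: "periodic X" and g: "periodic g"
  have "lie_deriv X g (x + k) = lie_deriv X g x" if k: "intvec k" for x k
    using periodic_derivative[OF g k] X k by (simp add: lie_deriv_def periodic_def)
  then show "periodic (lie_deriv X g)" unfolding periodic_def by blast
qed

text \<open>Cutting the integrand off outside {0..t} is the counterpart of freezing a curve outside
  that interval; the clamped limits of integration record this.\<close>

lemma clamped_integral:
  fixes g :: "real \<Rightarrow> 'a::banach"
  assumes t: "0 \<le> t" and g: "g integrable_on {0..t}" and ab: "a \<le> b"
  shows "((\<lambda>s. if s \<in> {0..t} then g s else 0) has_integral
    integral {0..max 0 (min t b)} g - integral {0..max 0 (min t a)} g) {a..b}"
proof -
  let ?a = "max 0 (min t a)" and ?b = "max 0 (min t b)"
  have le: "0 \<le> ?a" "?a \<le> ?b" "?b \<le> t" using ab t by auto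
  have "integral {0..?a} g + integral {?a..?b} g = integral {0..?b} g"
    using le by (intro Henstock_Kurzweil_Integration.integral_combine integrable_on_subinterval[OF g]) auto
  moreover have "(g has_integral integral {?a..?b} g) {?a..?b}"
    using le by (intro integrable_integral integrable_on_subinterval[OF g]) auto
  ultimately have I: "(g has_integral integral {0..?b} g - integral {0..?a} g) {?a..?b}"
    by (metis add_diff_cancel_left')
  show ?thesis
  proof (cases "b < 0 \<or> t < a")
    case True
    then have "\<And>s. s \<in> {a..b} \<Longrightarrow> (if s \<in> {0..t} then g s else 0) = 0" by auto
    moreover have "?a = ?b" using True ab t by auto
    ultimately show ?thesis
      by (simp only: diff_self) (rule has_integral_is_0, auto)
  next
    case False
    then have eq: "{0..t} \<inter> {a..b} = {?a..?b}" using t ab by (auto simp: max_def min_def)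
    show ?thesis unfolding has_integral_restrict_Int eq by (rule I)
  qed
qed

text \<open>Curves and controls live on the whole line, and the equation is stated in integral form
  on every interval. Shifting, gluing and passing to limits then involve neither domains nor
  exceptional sets; outside the times of interest a curve may simply rest.\<close>

definition bounded_traj :: "('m::finite \<Rightarrow> real^'d \<Rightarrow> real^'d) \<Rightarrow> real \<Rightarrow> (real \<Rightarrow> real^'d) \<Rightarrow> (real \<Rightarrow> real^'m) \<Rightarrow> bool" where
  "bounded_traj f R \<gamma> u \<longleftrightarrow> u \<in> borel_measurable borel \<and> (\<forall>s. norm (u s) \<le> R) \<and>
     (\<forall>a b. a \<le> b \<longrightarrow> ((\<lambda>s. Fmap f (\<gamma> s) (u s)) has_integral \<gamma> b - \<gamma> a) {a..b})"

lemma Fmap_zero [simp]: "Fmap f x 0 = 0"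
  by (simp add: Fmap_def)

lemma Fmap_scaleR: "Fmap f x (c *\<^sub>R u) = c *\<^sub>R Fmap f x u"
  by (simp add: Fmap_def scaleR_sum_right)

lemma bounded_traj_const: "R \<ge> 0 \<Longrightarrow> bounded_traj f R (\<lambda>_. z) (\<lambda>_. 0)"
  by (simp add: bounded_traj_def)

lemma bounded_traj_mono: "bounded_traj f R \<gamma> u \<Longrightarrow> R \<le> R' \<Longrightarrow> bounded_traj f R' \<gamma> u"
  unfolding bounded_traj_def by (meson order_trans)

lemma bounded_traj_shift_time:
  assumes "bounded_traj f R \<gamma> u"
  shows "bounded_traj f R (\<lambda>s. \<gamma> (s + \<tau>)) (\<lambda>s. u (s + \<tau>))"
  unfolding bounded_traj_def
proof (intro conjI allI impI)
  have [measurable]: "u \<in> borel_measurable borel" using assms by (simp add: bounded_traj_def)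
  show "(\<lambda>s. u (s + \<tau>)) \<in> borel_measurable borel" by measurable
  show "norm (u (s + \<tau>)) \<le> R" for s using assms by (simp add: bounded_traj_def)
  fix a b :: real assume "a \<le> b"
  then have "((\<lambda>s. Fmap f (\<gamma> s) (u s)) has_integral \<gamma> (b + \<tau>) - \<gamma> (a + \<tau>)) {a + \<tau>..b + \<tau>}"
    using assms by (simp add: bounded_traj_def)
  then show "((\<lambda>s. Fmap f (\<gamma> (s + \<tau>)) (u (s + \<tau>))) has_integral \<gamma> (b + \<tau>) - \<gamma> (a + \<tau>)) {a..b}"
    by (subst (asm) has_integral_shift_real_ivl_iff[where c = \<tau>]) simp
qed

section \<open>Smooth periodic control systems: bounds, gluing, integral curves\<close>

locale control_system =
  fixes f :: "'m::finite \<Rightarrow> real^'d \<Rightarrow> real^'d"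
  assumes smooth_f: "smooth (f i)" and periodic_f: "periodic (f i)"
begin

lemma continuous_f: "continuous_on S (f i)"
  using smooth_imp_continuous[OF smooth_f] continuous_on_subset by blast

lemma continuous_Fmap: "continuous_on UNIV (\<lambda>(x, u). Fmap f x u)"
  unfolding Fmap_def case_prod_unfold
  by (intro continuous_intros continuous_on_compose2[OF continuous_f[of UNIV]]) auto

lemma Fmap_bound: "\<exists>K\<ge>0. \<forall>x u. norm (Fmap f x u) \<le> K * norm u"
proof -
  have "\<forall>i. \<exists>B\<ge>0. \<forall>x. norm (f i x) \<le> B"
    using periodic_bounded[OF periodic_f continuous_f] by blast
  then obtain B where B: "\<And>i. B i \<ge> 0" "\<And>i x. norm (f i x) \<le> B i" by metis
  have "norm (Fmap f x u) \<le> (\<Sum>i\<in>UNIV. B i) * norm u" for x u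
  proof -
    have "norm (Fmap f x u) \<le> (\<Sum>i\<in>UNIV. norm (u $ i *\<^sub>R f i x))"
      unfolding Fmap_def by (rule norm_sum)
    also have "\<dots> \<le> (\<Sum>i\<in>UNIV. B i * norm u)"
    proof (rule sum_mono)
      fix i
      show "norm (u $ i *\<^sub>R f i x) \<le> B i * norm u"
        using mult_mono[OF B(2)[of i x] component_le_norm_cart[of u i]] B(1)
        by (simp add: mult.commute)
    qed
    finally show ?thesis by (simp add: sum_distrib_right)
  qed
  moreover have "(\<Sum>i\<in>UNIV. B i) \<ge> 0" by (simp add: B(1) sum_nonneg)
  ultimately show ?thesis by blast
qed

definition speed :: real where
  "speed = (SOME K. K \<ge> 0 \<and> (\<forall>x u. norm (Fmap f x u) \<le> K * norm u))"

lemma speed: "speed \<ge> 0" "norm (Fmap f x u) \<le> speed * norm u"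
  using someI_ex[OF Fmap_bound[simplified Bex_def]] unfolding speed_def by auto

lemma bounded_traj_lipschitz:
  assumes "bounded_traj f R \<gamma> u"
  shows "norm (\<gamma> b - \<gamma> a) \<le> speed * R * \<bar>b - a\<bar>"
proof -
  have R: "R \<ge> 0" using assms norm_ge_zero order_trans unfolding bounded_traj_def by blast
  have *: "norm (\<gamma> b - \<gamma> a) \<le> speed * R * (b - a)" if "a \<le> b" for a b
  proof -
    have "norm (Fmap f (\<gamma> s) (u s)) \<le> speed * R" for s
      using order_trans[OF speed(2) mult_left_mono[OF _ speed(1)]] assms unfolding bounded_traj_def by blast
    then show ?thesis
      using has_integral_bound[of "speed * R" "\<lambda>s. Fmap f (\<gamma> s) (u s)" "\<gamma> b - \<gamma> a" a b] that assms R speed(1)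
      unfolding bounded_traj_def by (auto simp: content_real)
  qed
  show ?thesis
    using *[of a b] *[of b a] by (cases "a \<le> b") (auto simp: norm_minus_commute)
qed

lemma bounded_traj_continuous:
  assumes "bounded_traj f R \<gamma> u"
  shows "continuous_on S \<gamma>"
proof -
  have R: "R \<ge> 0" using assms norm_ge_zero order_trans unfolding bounded_traj_def by blast
  have "(speed * R)-lipschitz_on UNIV \<gamma>"
    using bounded_traj_lipschitz[OF assms] R speed(1)
    by (intro lipschitz_onI) (auto simp: dist_norm)
  then show ?thesis using lipschitz_on_continuous_on continuous_on_subset by blast
qed

lemma bounded_traj_shift_space:
  assumes "bounded_traj f R \<gamma> u" "intvec k"
  shows "bounded_traj f R (\<lambda>s. \<gamma> s + k) u"
proof -
  have "Fmap f (x + k) v = Fmap f x v" for x v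
    using periodic_f assms(2) by (simp add: Fmap_def periodic_def)
  then show ?thesis using assms by (simp add: bounded_traj_def)
qed

lemma bounded_traj_append:
  assumes 1: "bounded_traj f R \<gamma>1 u1" and 2: "bounded_traj f R \<gamma>2 u2" and eq: "\<gamma>1 S = \<gamma>2 S"
  shows "bounded_traj f R (\<lambda>s. if s \<le> S then \<gamma>1 s else \<gamma>2 s) (\<lambda>s. if s \<le> S then u1 s else u2 s)"
    (is "bounded_traj f R ?\<gamma> ?u")
  unfolding bounded_traj_def
proof (intro conjI allI impI)
  have [measurable]: "u1 \<in> borel_measurable borel" "u2 \<in> borel_measurable borel"
    using 1 2 by (simp_all add: bounded_traj_def)
  show "?u \<in> borel_measurable borel" by measurable
  show "norm (?u s) \<le> R" for s using 1 2 by (simp add: bounded_traj_def)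
  fix a b :: real assume ab: "a \<le> b"
  let ?F = "\<lambda>s. Fmap f (?\<gamma> s) (?u s)"
  have L: "(?F has_integral \<gamma>1 b - \<gamma>1 a) {a..b}" if "a \<le> b" "b \<le> S" for a b
    by (rule has_integral_eq[rotated]) (use 1 that in \<open>auto simp: bounded_traj_def\<close>)
  have R: "(?F has_integral \<gamma>2 b - \<gamma>2 a) {a..b}" if "a \<le> b" "S \<le> a" for a b
    by (rule has_integral_spike_finite[of "{S}" _ _ "\<lambda>s. Fmap f (\<gamma>2 s) (u2 s)"])
       (use 2 that in \<open>auto simp: bounded_traj_def\<close>)
  consider "b \<le> S" | "S \<le> a" | "a \<le> S" "S \<le> b" by linarith
  then show "(?F has_integral ?\<gamma> b - ?\<gamma> a) {a..b}"
  proof cases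
    case 1 then show ?thesis using L[of a b] ab by simp
  next
    case 2 
    then have "?\<gamma> b = \<gamma>2 b" "?\<gamma> a = \<gamma>2 a" using ab eq by (metis antisym order_trans)+
    then show ?thesis using R[of a b] ab 2 by simp
  next
    case 3
    have "(?F has_integral (\<gamma>1 S - \<gamma>1 a) + (\<gamma>2 b - \<gamma>2 S)) {a..b}"
      by (rule has_integral_combine[of a S b]) (use 3 L[of a S] R[of S b] in auto)
    moreover have "?\<gamma> b = \<gamma>2 b" using 3 eq by (auto simp: antisym)
    ultimately show ?thesis using 3 eq by (simp add: algebra_simps)
  qed
qed

lemma f_lipschitz: "\<exists>K>0. \<forall>x y. norm (f i x - f i y) \<le> K * norm (x - y)"
proof -
  let ?D = "\<lambda>x. frechet_derivative (f i) (at x)"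
  have "\<forall>j. \<exists>B\<ge>0. \<forall>x. norm (?D x (axis j 1)) \<le> B"
  proof
    fix j
    have "periodic (\<lambda>x. ?D x (axis j 1))"
      unfolding periodic_def by (simp add: periodic_derivative periodic_f)
    then show "\<exists>B\<ge>0. \<forall>x. norm (?D x (axis j 1)) \<le> B"
      by (intro periodic_bounded smooth_imp_continuous smooth_directional smooth_f)
  qed
  then obtain B where B: "\<And>j. B j \<ge> 0" "\<And>j x. norm (?D x (axis j 1)) \<le> B j" by metis
  \<comment> \<open>The summand 1 makes \<open>K\<close> positive, so that it may be divided
    by.\<close>
  define K where "K = 1 + (\<Sum>j\<in>UNIV. B j)"
  have K: "K > 0" using sum_nonneg[of UNIV B] B(1) by (simp add: K_def add_pos_nonneg)
  have bound: "norm (?D x v) \<le> K * norm v" for x v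
  proof -
    have lin: "linear (?D x)"
      by (simp add: linear_frechet_derivative smooth_imp_differentiable smooth_f)
    have "v = (\<Sum>j\<in>UNIV. (v $ j) *\<^sub>R axis j 1)"
      by (auto simp: vec_eq_iff axis_def if_distrib cong: if_cong)
    then have "?D x v = ?D x (\<Sum>j\<in>UNIV. (v $ j) *\<^sub>R axis j 1)" by metis
    also have "\<dots> = (\<Sum>j\<in>UNIV. (v $ j) *\<^sub>R ?D x (axis j 1))"
      by (simp add: linear_sum[OF lin] linear_scale[OF lin])
    finally have "norm (?D x v) \<le> (\<Sum>j\<in>UNIV. norm ((v $ j) *\<^sub>R ?D x (axis j 1)))"
      by (simp only: norm_sum)
    also have "\<dots> \<le> (\<Sum>j\<in>UNIV. B j * norm v)"
    proof (rule sum_mono)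
      fix j
      show "norm ((v $ j) *\<^sub>R ?D x (axis j 1)) \<le> B j * norm v"
        using mult_mono[OF B(2)[of x j] component_le_norm_cart[of v j]] B(1)
        by (simp add: mult.commute)
    qed
    also have "\<dots> \<le> K * norm v" by (simp add: K_def sum_distrib_right distrib_right)
    finally show ?thesis .
  qed
  have "norm (f i x - f i y) \<le> K * norm (x - y)" for x y
    by (rule differentiable_bound[of UNIV "f i" ?D])
       (auto intro: smooth_has_derivative smooth_f onorm_le bound)
  then show ?thesis using K by blast
qed

text \<open>Picard iteration on bounded continuous functions on the whole line. Clamping the time
  keeps the iterates bounded, and up to t = 1 / (2 K) the map is a contraction with factor 1/2. This
  step length depends on neither the initial point nor \<sigma>, since the Lipschitz constant is
  global.\<close>

lemma integral_curve_exists: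
  "\<exists>t0>0. \<forall>t z \<sigma>. 0 \<le> t \<and> t \<le> t0 \<and> \<bar>\<sigma>\<bar> \<le> 1 \<longrightarrow>
     (\<exists>\<gamma> :: real \<Rightarrow> real^'d. continuous_on UNIV \<gamma> \<and> (\<forall>s. \<gamma> s = z + integral {0..max 0 (min t s)} (\<lambda>r. \<sigma> *\<^sub>R f i (\<gamma> r))))"
proof -
  obtain K where K: "K > 0" "\<And>x y. norm (f i x - f i y) \<le> K * norm (x - y)"
    using f_lipschitz by blast
  obtain M where M: "M \<ge> 0" "\<And>x. norm (f i x) \<le> M"
    using periodic_bounded[OF periodic_f continuous_f] by blast
  have main: "\<exists>\<gamma> :: real \<Rightarrow> real^'d. continuous_on UNIV \<gamma> \<and> (\<forall>s. \<gamma> s = z + integral {0..max 0 (min t s)} (\<lambda>r. \<sigma> *\<^sub>R f i (\<gamma> r)))"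
    if t: "0 \<le> t" "t \<le> 1 / (2 * K)" and \<sigma>: "\<bar>\<sigma>\<bar> \<le> 1" for t \<sigma> z
  proof -
    define c where "c s = max 0 (min t s)" for s
    have c: "0 \<le> c s" "c s \<le> t" for s using t by (auto simp: c_def)
    define P where "P \<phi> s = z + integral {0..c s} (\<lambda>r. \<sigma> *\<^sub>R f i (apply_bcontfun \<phi> r))" for \<phi> :: "real \<Rightarrow>\<^sub>C (real^'d)" and s
    have cont: "continuous_on S (\<lambda>r. \<sigma> *\<^sub>R f i (apply_bcontfun \<phi> r))" for \<phi> :: "real \<Rightarrow>\<^sub>C (real^'d)" and S
      by (intro continuous_on_scaleR continuous_on_const continuous_on_compose2[OF continuous_f[of UNIV] continuous_on_apply_bcontfun]) auto
    have integ: "(\<lambda>r. \<sigma> *\<^sub>R f i (apply_bcontfun \<phi> r)) integrable_on {0..s}" for \<phi> :: "real \<Rightarrow>\<^sub>C (real^'d)" and s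
      by (rule integrable_continuous_real[OF cont])
    have sM: "norm (\<sigma> *\<^sub>R f i x) \<le> M" for x
      using mult_mono[OF \<sigma> M(2)[of x]] by simp
    have P: "P \<phi> \<in> bcontfun" for \<phi>
    proof (rule bcontfun_normI)
      have "continuous_on {0..t} (\<lambda>s. integral {0..s} (\<lambda>r. \<sigma> *\<^sub>R f i (apply_bcontfun \<phi> r)))"
        by (rule indefinite_integral_continuous_1[OF integ])
      moreover have "continuous_on UNIV c" unfolding c_def by (intro continuous_intros)
      ultimately have "continuous_on UNIV (\<lambda>s. integral {0..c s} (\<lambda>r. \<sigma> *\<^sub>R f i (apply_bcontfun \<phi> r)))"
        by (rule continuous_on_compose2) (use c in auto)
      then show "continuous_on UNIV (P \<phi>)"
        unfolding P_def by (intro continuous_on_add continuous_on_const)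
      fix s
      have "norm (integral {0..c s} (\<lambda>r. \<sigma> *\<^sub>R f i (apply_bcontfun \<phi> r))) \<le> M * (c s - 0)"
        by (rule integral_bound) (use c sM cont in auto)
      also have "\<dots> \<le> M * t" using c M by (intro mult_left_mono) auto
      finally show "norm (P \<phi> s) \<le> norm z + M * t"
        unfolding P_def using norm_triangle_mono by blast
    qed
    have "\<exists>!\<phi>. Bcontfun (P \<phi>) = \<phi>"
    proof (rule banach_fix_type[of "1/2"], simp, simp, intro allI dist_bound)
      fix \<phi> \<psi> :: "real \<Rightarrow>\<^sub>C (real^'d)" and s :: real
      have "P \<phi> s - P \<psi> s = integral {0..c s} (\<lambda>r. \<sigma> *\<^sub>R f i (apply_bcontfun \<phi> r) - \<sigma> *\<^sub>R f i (apply_bcontfun \<psi> r))"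
        unfolding P_def by (simp add: Henstock_Kurzweil_Integration.integral_diff integ)
      also have "norm \<dots> \<le> (K * dist \<phi> \<psi>) * (c s - 0)"
      proof (rule integral_bound)
        fix r
        have "norm (\<sigma> *\<^sub>R f i (apply_bcontfun \<phi> r) - \<sigma> *\<^sub>R f i (apply_bcontfun \<psi> r))
          = \<bar>\<sigma>\<bar> * norm (f i (apply_bcontfun \<phi> r) - f i (apply_bcontfun \<psi> r))"
          by (simp flip: scaleR_diff_right)
        also have "\<dots> \<le> 1 * norm (f i (apply_bcontfun \<phi> r) - f i (apply_bcontfun \<psi> r))"
          by (intro mult_right_mono \<sigma>) auto
        also have "\<dots> \<le> K * norm (apply_bcontfun \<phi> r - apply_bcontfun \<psi> r)"
          using K(2) by simp
        also have "\<dots> \<le> K * dist \<phi> \<psi>"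
          using dist_bounded[of \<phi> r \<psi>] K(1) by (simp add: dist_norm)
        finally show "norm (\<sigma> *\<^sub>R f i (apply_bcontfun \<phi> r) - \<sigma> *\<^sub>R f i (apply_bcontfun \<psi> r)) \<le> K * dist \<phi> \<psi>" .
      qed (use c in \<open>auto intro!: continuous_on_diff cont\<close>)
      also have "\<dots> \<le> (K * dist \<phi> \<psi>) * (1 / (2 * K))"
        using c[of s] t K by (intro mult_left_mono) auto
      also have "\<dots> = 1 / 2 * dist \<phi> \<psi>" using K by simp
      finally show "dist (apply_bcontfun (Bcontfun (P \<phi>)) s) (apply_bcontfun (Bcontfun (P \<psi>)) s) \<le> 1 / 2 * dist \<phi> \<psi>"
        by (simp add: Bcontfun_inverse P dist_norm)
    qed
    then obtain \<phi> where "Bcontfun (P \<phi>) = \<phi>" by blast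
    then have "apply_bcontfun \<phi> = P \<phi>" by (metis Bcontfun_inverse P)
    then have eq: "apply_bcontfun \<phi> s = P \<phi> s" for s by (rule fun_cong)
    show ?thesis
    proof (intro exI conjI allI)
      show "continuous_on UNIV (apply_bcontfun \<phi>)" by simp
      show "apply_bcontfun \<phi> s = z + integral {0..max 0 (min t s)} (\<lambda>r. \<sigma> *\<^sub>R f i (apply_bcontfun \<phi> r))" for s
        using eq[of s] unfolding P_def c_def .
    qed
  qed
  show ?thesis
  proof (intro exI[of _ "1 / (2 * K)"] conjI allI impI)
    show "1 / (2 * K) > 0" using K(1) by simp
  qed (elim conjE, rule main)
qed

end

section \<open>Endpoints of words and motion along brackets\<close>

lemma smooth_ident: "smooth (\<lambda>x. x)"
  by (rule smooth_coinduct[where S = "insert (\<lambda>x. x) {\<lambda>x. d | d. True}"])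
     (auto simp: frechet_derivative_const frechet_derivative_ident)

lemma (in control_system) periodic_word_deriv: "periodic g \<Longrightarrow> periodic (word_deriv f w g)"
  by (induction w) (auto intro: periodic_lie_deriv periodic_f)

lemma (in control_system) bounded_derivs_coord: "bounded_derivs f (\<lambda>x. x $ c)"
  unfolding bounded_derivs_def
proof (intro conjI allI impI)
  show sm: "smooth (\<lambda>x :: real^'d. x $ c)" by (rule smooth_component[OF smooth_ident])
  fix w :: "'m list" assume "w \<noteq> []"
  \<comment> \<open>The last letter acts first; it turns the unbounded coordinate into the periodic
    component of f_i, and the remaining letters preserve periodicity.\<close>
  then obtain v i where w: "w = v @ [i]" using rev_exhaust by blast
  have "lie_deriv (f i) (\<lambda>x. x $ c) = (\<lambda>x. f i x $ c)"
    unfolding lie_deriv_def using frechet_derivative_eq[OF bounded_linear_imp_has_derivative[OF bounded_linear_vec_nth]]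
    by metis
  then have eq: "word_deriv f w (\<lambda>x. x $ c) = word_deriv f v (\<lambda>x. f i x $ c)"
    by (simp add: w word_deriv_append)
  have "periodic (word_deriv f w (\<lambda>x. x $ c))" unfolding eq
    by (intro periodic_word_deriv periodic_component periodic_f)
  moreover have "continuous_on UNIV (word_deriv f w (\<lambda>x. x $ c))"
    by (intro smooth_imp_continuous smooth_word_deriv smooth_f sm)
  ultimately have "\<exists>B\<ge>0. \<forall>z. norm (word_deriv f w (\<lambda>x. x $ c) z) \<le> B"
    by (rule periodic_bounded)
  then show "\<exists>B. \<forall>z. \<bar>word_deriv f w (\<lambda>x. x $ c) z\<bar> \<le> B" by auto
qed

lemma (in control_system) word_leads_endpoint:
  assumes W: "word_leads f W k Z"
  shows "\<exists>B\<ge>0. \<forall>t z z'. 0 \<le> t \<and> word_path f t W z z' \<longrightarrow> norm (z' - z - t ^ k *\<^sub>R Z z) \<le> B * t ^ Suc k"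
proof -
  have "\<exists>B. \<forall>t z z'. 0 \<le> t \<and> word_path f t W z z' \<longrightarrow> \<bar>(z' - z - t ^ k *\<^sub>R Z z) $ c\<bar> \<le> B * t ^ Suc k" for c
  proof -
    have "lie_deriv Z (\<lambda>x. x $ c) z = Z z $ c" for z
      unfolding lie_deriv_def using frechet_derivative_eq[OF bounded_linear_imp_has_derivative[OF bounded_linear_vec_nth]]
      by metis
    then show ?thesis
      using word_leads_endpoint_component[OF smooth_f bounded_derivs_coord W, of c] by simp
  qed
  then obtain B where B: "\<And>c t z z'. 0 \<le> t \<Longrightarrow> word_path f t W z z' \<Longrightarrow> \<bar>(z' - z - t ^ k *\<^sub>R Z z) $ c\<bar> \<le> B c * t ^ Suc k"
    by metis
  have "norm (z' - z - t ^ k *\<^sub>R Z z) \<le> (\<Sum>c\<in>UNIV. \<bar>B c\<bar>) * t ^ Suc k" if "0 \<le> t" "word_path f t W z z'" for t z z'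
  proof -
    have "norm (z' - z - t ^ k *\<^sub>R Z z) \<le> (\<Sum>c\<in>UNIV. \<bar>(z' - z - t ^ k *\<^sub>R Z z) $ c\<bar>)"
      by (rule norm_le_l1_cart)
    also have "\<dots> \<le> (\<Sum>c\<in>UNIV. \<bar>B c\<bar> * t ^ Suc k)"
    proof (rule sum_mono)
      fix c
      have "B c * t ^ Suc k \<le> \<bar>B c\<bar> * t ^ Suc k" by (intro mult_right_mono) (use that in auto)
      with B[OF that, of c] show "\<bar>(z' - z - t ^ k *\<^sub>R Z z) $ c\<bar> \<le> \<bar>B c\<bar> * t ^ Suc k" by linarith
    qed
    finally show ?thesis by (simp only: sum_distrib_right)
  qed
  moreover have "(\<Sum>c\<in>UNIV. \<bar>B c\<bar>) \<ge> 0" by (intro sum_nonneg) auto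
  ultimately show ?thesis by blast
qed

lemma Fmap_axis: "Fmap f x (axis i 1) = f i x"
proof -
  have "Fmap f x (axis i 1) = (\<Sum>j\<in>UNIV. if j = i then f i x else 0)"
    unfolding Fmap_def by (intro sum.cong) (auto simp: axis_def)
  then show ?thesis by simp
qed

context control_system
begin

text \<open>On the torus the pieces only have to meet modulo integer vectors, so the second one is
  translated by the mismatch.\<close>

lemma bounded_traj_join:
  assumes 1: "bounded_traj f R \<gamma>1 u1" and 2: "bounded_traj f R \<gamma>2 u2" and eq: "intvec (\<gamma>1 S - \<gamma>2 0)"
  shows "bounded_traj f R (\<lambda>s. if s \<le> S then \<gamma>1 s else \<gamma>2 (s - S) + (\<gamma>1 S - \<gamma>2 0)) (\<lambda>s. if s \<le> S then u1 s else u2 (s - S))"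
proof -
  have "bounded_traj f R (\<lambda>s. \<gamma>2 (s + (- S)) + (\<gamma>1 S - \<gamma>2 0)) (\<lambda>s. u2 (s + (- S)))"
    by (intro bounded_traj_shift_space[OF bounded_traj_shift_time[OF 2]] eq)
  from bounded_traj_append[OF 1 this, of S] show ?thesis by (simp only: add_uminus_conv_diff) simp
qed

lemma traj_join:
  assumes "bounded_traj f R \<gamma>1 u1" "bounded_traj f R \<gamma>2 u2" "\<gamma>1 S = \<gamma>2 0" "0 \<le> S" "0 \<le> T"
  shows "\<exists>\<gamma> u. bounded_traj f R \<gamma> u \<and> \<gamma> 0 = \<gamma>1 0 \<and> \<gamma> (S + T) = \<gamma>2 T"
proof -
  let ?g = "\<lambda>s. if s \<le> S then \<gamma>1 s else \<gamma>2 (s - S) + (\<gamma>1 S - \<gamma>2 0)"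
  have "bounded_traj f R ?g (\<lambda>s. if s \<le> S then u1 s else u2 (s - S))"
    using bounded_traj_join[OF assms(1,2), of S] assms(3) by (simp add: intvec_simps)
  moreover have "?g 0 = \<gamma>1 0" "?g (S + T) = \<gamma>2 T" using assms(3-5) by auto
  ultimately show ?thesis by blast
qed

lemma letter_traj:
  "\<exists>t0>0. \<forall>t z \<sigma>. 0 \<le> t \<and> t \<le> t0 \<and> \<bar>\<sigma>\<bar> \<le> 1 \<longrightarrow>
     (\<exists>\<gamma> u. bounded_traj f 1 \<gamma> u \<and> \<gamma> 0 = z \<and>
       (\<forall>s\<in>{0..t}. (\<gamma> has_vector_derivative \<sigma> *\<^sub>R f i (\<gamma> s)) (at s within {0..t})))"
proof -
  obtain t0 where t0: "t0 > 0" and ex: "\<And>t z \<sigma>. 0 \<le> t \<Longrightarrow> t \<le> t0 \<Longrightarrow> \<bar>\<sigma>\<bar> \<le> 1 \<Longrightarrow>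
     \<exists>\<gamma> :: real \<Rightarrow> real^'d. continuous_on UNIV \<gamma> \<and> (\<forall>s. \<gamma> s = z + integral {0..max 0 (min t s)} (\<lambda>r. \<sigma> *\<^sub>R f i (\<gamma> r)))"
    using integral_curve_exists[of i] by metis
  have "\<exists>\<gamma> u. bounded_traj f 1 \<gamma> u \<and> \<gamma> 0 = z \<and>
       (\<forall>s\<in>{0..t}. (\<gamma> has_vector_derivative \<sigma> *\<^sub>R f i (\<gamma> s)) (at s within {0..t}))"
    if t: "0 \<le> t" "t \<le> t0" and \<sigma>: "\<bar>\<sigma>\<bar> \<le> 1" for t z \<sigma>
  proof -
    obtain \<gamma> where c: "continuous_on UNIV \<gamma>" and g: "\<And>s. \<gamma> s = z + integral {0..max 0 (min t s)} (\<lambda>r. \<sigma> *\<^sub>R f i (\<gamma> r))"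
      using ex[OF t \<sigma>] by metis
    let ?h = "\<lambda>r. \<sigma> *\<^sub>R f i (\<gamma> r)"
    have ch: "continuous_on S ?h" for S
      by (intro continuous_on_scaleR continuous_on_const continuous_on_compose2[OF continuous_f[of UNIV] continuous_on_subset[OF c]]) auto
    define u :: "real \<Rightarrow> real^'m" where "u s = (if s \<in> {0..t} then \<sigma> *\<^sub>R axis i 1 else 0)" for s
    have "bounded_traj f 1 \<gamma> u"
      unfolding bounded_traj_def
    proof (intro conjI allI impI)
      show "u \<in> borel_measurable borel" unfolding u_def by measurable
      show "norm (u s) \<le> 1" for s using \<sigma> by (auto simp: u_def)
      fix a b :: real assume ab: "a \<le> b"
      have "(\<lambda>s. Fmap f (\<gamma> s) (u s)) = (\<lambda>s. if s \<in> {0..t} then ?h s else 0)"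
        by (auto simp: u_def Fmap_scaleR Fmap_axis)
      moreover have "integral {0..max 0 (min t b)} ?h - integral {0..max 0 (min t a)} ?h = \<gamma> b - \<gamma> a"
        unfolding g[of a] g[of b] by simp
      ultimately show "((\<lambda>s. Fmap f (\<gamma> s) (u s)) has_integral \<gamma> b - \<gamma> a) {a..b}"
        using clamped_integral[OF t(1) integrable_continuous_real[OF ch] ab] by simp
    qed
    moreover have "\<gamma> 0 = z" using g[of 0] t(1) by simp
    moreover have "(\<gamma> has_vector_derivative ?h s) (at s within {0..t})" if s: "s \<in> {0..t}" for s
    proof -
      have "((\<lambda>s. z + integral {0..s} ?h) has_vector_derivative 0 + ?h s) (at s within {0..t})"
        by (intro has_vector_derivative_add has_vector_derivative_const integral_has_vector_derivative ch s)
      then have D: "((\<lambda>s. z + integral {0..s} ?h) has_vector_derivative ?h s) (at s within {0..t})"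
        by simp
      have E: "\<gamma> r = z + integral {0..r} ?h" if "r \<in> {0..t}" for r
        using g[of r] that by (auto simp: max_def min_def)
      show ?thesis
        by (rule has_vector_derivative_transform[OF s E D])
    qed
    ultimately show ?thesis by blast
  qed
  then show ?thesis using t0 by blast
qed

text \<open>All letters share one time bound because there are finitely many fields. Each letter
  takes time \<open>t\<close>, so the endpoint is reached at t * length W.\<close>

lemma word_traj:
  "\<exists>t0>0. \<forall>W t z. 0 \<le> t \<and> t \<le> t0 \<and> (\<forall>a\<in>set W. \<bar>fst a\<bar> \<le> 1) \<longrightarrow>
     (\<exists>\<gamma> u. bounded_traj f 1 \<gamma> u \<and> \<gamma> 0 = z \<and> word_path f t W z (\<gamma> (t * length W)))"
proof -
  have "\<forall>i. \<exists>t0>0. \<forall>t z \<sigma>. 0 \<le> t \<and> t \<le> t0 \<and> \<bar>\<sigma>\<bar> \<le> 1 \<longrightarrow>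
     (\<exists>\<gamma> u. bounded_traj f 1 \<gamma> u \<and> \<gamma> 0 = z \<and>
       (\<forall>s\<in>{0..t}. (\<gamma> has_vector_derivative \<sigma> *\<^sub>R f i (\<gamma> s)) (at s within {0..t})))"
    using letter_traj by blast
  then obtain T where T: "\<And>i. T i > 0" and step: "\<And>i t z \<sigma>. 0 \<le> t \<Longrightarrow> t \<le> T i \<Longrightarrow> \<bar>\<sigma>\<bar> \<le> 1 \<Longrightarrow>
     (\<exists>\<gamma> u. bounded_traj f 1 \<gamma> u \<and> \<gamma> 0 = z \<and>
       (\<forall>s\<in>{0..t}. (\<gamma> has_vector_derivative \<sigma> *\<^sub>R f i (\<gamma> s)) (at s within {0..t})))"
    by metis
  define t0 where "t0 = Min (range T)"
  have t0: "t0 > 0" "t0 \<le> T i" for i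
    using T by (auto simp: t0_def)
  have "\<exists>\<gamma> u. bounded_traj f 1 \<gamma> u \<and> \<gamma> 0 = z \<and> word_path f t W z (\<gamma> (t * length W))"
    if t: "0 \<le> t" "t \<le> t0" and W: "\<forall>a\<in>set W. \<bar>fst a\<bar> \<le> 1" for W t z
    using W
  proof (induction W arbitrary: z)
    case Nil
    show ?case by (intro exI[of _ "\<lambda>_. z"] exI[of _ "\<lambda>_. 0"]) (simp add: bounded_traj_const)
  next
    case (Cons a W)
    obtain \<gamma>1 u1 where 1: "bounded_traj f 1 \<gamma>1 u1" "\<gamma>1 0 = z"
       "\<forall>s\<in>{0..t}. (\<gamma>1 has_vector_derivative fst a *\<^sub>R f (snd a) (\<gamma>1 s)) (at s within {0..t})"
      using step[of t "snd a" "fst a" z] t t0(2)[of "snd a"] Cons.prems by (auto intro: order_trans)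
    obtain \<gamma>2 u2 where 2: "bounded_traj f 1 \<gamma>2 u2" "\<gamma>2 0 = \<gamma>1 t" "word_path f t W (\<gamma>1 t) (\<gamma>2 (t * length W))"
      using Cons.IH[of "\<gamma>1 t"] Cons.prems by auto
    obtain \<gamma> u where "bounded_traj f 1 \<gamma> u" "\<gamma> 0 = \<gamma>1 0" "\<gamma> (t + t * length W) = \<gamma>2 (t * length W)"
      using traj_join[OF 1(1) 2(1), of t "t * length W"] 2(2) t by auto
    moreover have "t + t * length W = t * length (a # W)" by (simp add: algebra_simps)
    moreover have "word_path f t (a # W) z (\<gamma>2 (t * length W))"
      using 1(2,3) 2(3) by auto
    ultimately show ?case using 1(2) by (intro exI[of _ \<gamma>] exI[of _ u]) simp
  qed
  then show ?thesis using t0(1) by blast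
qed

text \<open>A motion along \<open>Z\<close> by the amount \<open>c\<close> takes time of order \<open>\<bar>c\<bar> powr p\<close>, where \<open>1 / p\<close>
  is the length of the bracket; \<open>\<epsilon>\<close> is the relative error.\<close>

lemma lie_gen_move:
  assumes Z: "Z \<in> lie_gen f" and e: "\<epsilon> > 0"
  shows "\<exists>\<delta>>0. \<exists>N\<ge>0. \<exists>p>0. \<forall>z c. \<bar>c\<bar> \<le> \<delta> \<longrightarrow> (\<exists>\<gamma> u \<tau>. bounded_traj f 1 \<gamma> u \<and> \<gamma> 0 = z \<and>
     0 \<le> \<tau> \<and> \<tau> \<le> N * \<bar>c\<bar> powr p \<and> norm (\<gamma> \<tau> - z - c *\<^sub>R Z z) \<le> \<epsilon> * \<bar>c\<bar>)"
proof -
  obtain W k where W: "word_leads f W k Z" using lie_gen_word_leads[OF Z smooth_f] by blast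
  note W' = word_leads_winv[OF W]
  have k: "k \<ge> 1" by (rule word_leadsD(1)[OF W])
  obtain B1 where B1: "B1 \<ge> 0" "\<And>t z z'. 0 \<le> t \<Longrightarrow> word_path f t W z z' \<Longrightarrow> norm (z' - z - t ^ k *\<^sub>R Z z) \<le> B1 * t ^ Suc k"
    using word_leads_endpoint[OF W] by blast
  obtain B2 where B2: "B2 \<ge> 0" "\<And>t z z'. 0 \<le> t \<Longrightarrow> word_path f t (winv W) z z' \<Longrightarrow> norm (z' - z - t ^ k *\<^sub>R (- Z z)) \<le> B2 * t ^ Suc k"
    using word_leads_endpoint[OF W'] by blast
  obtain t0 where t0: "t0 > 0" and ex: "\<And>W t z. 0 \<le> t \<Longrightarrow> t \<le> t0 \<Longrightarrow> (\<forall>a\<in>set W. \<bar>fst a\<bar> \<le> 1) \<Longrightarrow>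
     (\<exists>\<gamma> u. bounded_traj f 1 \<gamma> u \<and> \<gamma> 0 = z \<and> word_path f t W z (\<gamma> (t * length W)))"
    using word_traj by metis
  \<comment> \<open>Relative to t^k the remainder is at most B1 t or B2 t; up to \<open>t1\<close>
    both are at most \<epsilon>.\<close>
  define t1 where "t1 = min t0 (\<epsilon> / (B1 + B2 + 1))"
  have t1: "t1 > 0" "t1 \<le> t0" using t0 e B1 B2 by (auto simp: t1_def)
  have err: "B1 * t \<le> \<epsilon>" "B2 * t \<le> \<epsilon>" if "0 \<le> t" "t \<le> t1" for t
  proof -
    have "(B1 + B2 + 1) * t \<le> (B1 + B2 + 1) * (\<epsilon> / (B1 + B2 + 1))"
      using that B1 B2 by (intro mult_left_mono) (auto simp: t1_def)
    also have "\<dots> = \<epsilon>" using B1 B2 by simp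
    finally have "B1 * t + B2 * t + t \<le> \<epsilon>" by (simp add: distrib_right)
    moreover have "0 \<le> B1 * t" "0 \<le> B2 * t" using that B1 B2 by auto
    ultimately show "B1 * t \<le> \<epsilon>" "B2 * t \<le> \<epsilon>" using that by linarith+
  qed
  define N where "N = real (length W) + real (length (winv W))"
  have "\<exists>\<gamma> u \<tau>. bounded_traj f 1 \<gamma> u \<and> \<gamma> 0 = z \<and>
     0 \<le> \<tau> \<and> \<tau> \<le> N * \<bar>c\<bar> powr (1 / k) \<and> norm (\<gamma> \<tau> - z - c *\<^sub>R Z z) \<le> \<epsilon> * \<bar>c\<bar>"
    if c: "\<bar>c\<bar> \<le> t1 ^ k" for z c
  proof -
    \<comment> \<open>Chosen so that t^k = |c|, since a word of leading order k moves by
      t^k.\<close>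
    define t where "t = \<bar>c\<bar> powr (1 / k)"
    have t: "0 \<le> t" by (simp add: t_def)
    have tk: "t ^ k = \<bar>c\<bar>"
      using k by (cases "c = 0") (auto simp: t_def powr_realpow[symmetric] powr_powr)
    have "t \<le> t1" using c t1 t k unfolding tk[symmetric] by (subst (asm) power_mono_iff) auto
    \<comment> \<open>Powers of \<open>t\<close> are nonnegative, so negative amounts use the
      inverse word, which leads along -Z.\<close>
    define V where "V = (if c \<ge> 0 then W else winv W)"
    have V: "\<forall>a\<in>set V. \<bar>fst a\<bar> \<le> 1" using word_leadsD(3)[OF W] word_leadsD(3)[OF W'] by (simp add: V_def)
    obtain \<gamma> u where g: "bounded_traj f 1 \<gamma> u" "\<gamma> 0 = z" "word_path f t V z (\<gamma> (t * length V))"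
      using ex[OF t _ V, of z] \<open>t \<le> t1\<close> t1 by auto
    have "norm (\<gamma> (t * length V) - z - c *\<^sub>R Z z) \<le> \<epsilon> * \<bar>c\<bar>"
    proof (cases "c \<ge> 0")
      case True
      have "norm (\<gamma> (t * length V) - z - c *\<^sub>R Z z) \<le> B1 * t ^ Suc k"
        using B1(2)[OF t, of z "\<gamma> (t * length V)"] g(3) True tk by (simp add: V_def)
      also have "\<dots> = (B1 * t) * \<bar>c\<bar>" by (simp add: tk)
      also have "\<dots> \<le> \<epsilon> * \<bar>c\<bar>" by (intro mult_right_mono err t \<open>t \<le> t1\<close>) auto
      finally show ?thesis .
    next
      case False
      have "norm (\<gamma> (t * length V) - z - c *\<^sub>R Z z) \<le> B2 * t ^ Suc k"
        using B2(2)[OF t, of z "\<gamma> (t * length V)"] g(3) False tk by (simp add: V_def)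
      also have "\<dots> = (B2 * t) * \<bar>c\<bar>" by (simp add: tk)
      also have "\<dots> \<le> \<epsilon> * \<bar>c\<bar>" by (intro mult_right_mono err t \<open>t \<le> t1\<close>) auto
      finally show ?thesis .
    qed
    moreover have "t * length V \<le> N * t"
      using t by (auto simp: N_def V_def algebra_simps)
    ultimately show ?thesis using g t unfolding t_def[symmetric] by (intro exI[of _ \<gamma>] exI[of _ u] exI[of _ "t * length V"]) auto
  qed
  moreover have "t1 ^ k > 0" "N \<ge> 0" "1 / real k > 0" using t1 k by (auto simp: N_def)
  ultimately show ?thesis by blast
qed

end

section \<open>Absolutely continuous functions\<close>

lemma tagged_division_sum_abs_cont:
  fixes f :: "real \<Rightarrow> 'a::real_normed_vector"
  assumes p: "p tagged_division_of {a..b}" and Q: "Q \<subseteq> p"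
    and ac: "\<And>(n::nat) (s::nat \<Rightarrow> real) t. (\<forall>k<n. a \<le> s k \<and> s k \<le> t k \<and> t k \<le> b) \<Longrightarrow>
       (\<forall>k<n. \<forall>j<n. k \<noteq> j \<longrightarrow> t k \<le> s j \<or> t j \<le> s k) \<Longrightarrow>
       (\<Sum>k<n. t k - s k) < \<delta> \<Longrightarrow> (\<Sum>k<n. norm (f (t k) - f (s k))) < \<epsilon>"
    and small: "(\<Sum>(x, K)\<in>Q. measure lborel K) < \<delta>"
  shows "(\<Sum>(x, K)\<in>Q. norm (f (Sup K) - f (Inf K))) < \<epsilon>"
proof -
  \<comment> \<open>Degenerate intervals are dropped: one of them may lie inside another interval of
    the division, which the ordering condition of absolute continuity forbids, but it contributes
    nothing to either sum.\<close>
  define Q' where "Q' = {(x, K) \<in> Q. Inf K < Sup K}"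
  have finp: "finite p" using p by auto
  then have fin: "finite Q" "finite Q'" using Q finite_subset by (auto simp: Q'_def intro: finite_subset)
  have iv: "\<exists>c d. K = {c..d} \<and> c \<le> d \<and> a \<le> c \<and> d \<le> b \<and> Inf K = c \<and> Sup K = d" if "(x, K) \<in> p" for x K
  proof -
    obtain c d where K: "K = cbox c d" using tagged_division_ofD(4)[OF p \<open>(x, K) \<in> p\<close>] by blast
    moreover have "x \<in> K" "K \<subseteq> {a..b}" using tagged_division_ofD(2,3)[OF p \<open>(x, K) \<in> p\<close>] by auto
    ultimately show ?thesis by (intro exI[of _ c] exI[of _ d]) auto
  qed
  define n where "n = card Q'"
  obtain h where h: "bij_betw h {..<n} Q'"
    using ex_bij_betw_nat_finite[OF fin(2)] by (auto simp: atLeast0LessThan n_def)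
  define s where "s k = Inf (snd (h k))" for k
  define t where "t k = Sup (snd (h k))" for k
  have hin: "h k \<in> Q'" if "k < n" for k using h that by (auto simp: bij_betw_def)
  have hp: "(fst (h k), snd (h k)) \<in> p" "s k < t k" if "k < n" for k
    using hin[OF that] Q by (auto simp: Q'_def s_def t_def split: prod.splits)
  have K: "snd (h k) = {s k..t k}" "a \<le> s k" "t k \<le> b" if "k < n" for k
    using iv[OF hp(1)[OF that]] by (auto simp: s_def t_def)
  have "t k \<le> s j \<or> t j \<le> s k" if "k < n" "j < n" "k \<noteq> j" for k j
  proof (rule ccontr)
    assume "\<not> ?thesis"
    then have less: "s j < t k" "s k < t j" by auto
    have "h k \<noteq> h j" using h that by (auto simp: bij_betw_def inj_on_def)
    then have "interior (snd (h k)) \<inter> interior (snd (h j)) = {}"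
      using tagged_division_ofD(5)[OF p hp(1)[OF that(1)] hp(1)[OF that(2)]] by simp
    then have "{s k<..<t k} \<inter> {s j<..<t j} = {}"
      using K(1)[OF that(1)] K(1)[OF that(2)] by (simp add: interior_cbox[where 'a=real, simplified])
    moreover have "(max (s k) (s j) + min (t k) (t j)) / 2 \<in> {s k<..<t k} \<inter> {s j<..<t j}"
      using less hp(2)[OF that(1)] hp(2)[OF that(2)] by (auto simp: max_def min_def)
    ultimately show False by blast
  qed
  moreover have "(\<Sum>k<n. t k - s k) < \<delta>"
  proof -
    have "(\<Sum>k<n. t k - s k) = (\<Sum>k<n. measure lborel (snd (h k)))"
      using K(1) hp(2) by (intro sum.cong) (auto simp: content_real less_imp_le)
    also have "\<dots> = (\<Sum>xK\<in>Q'. measure lborel (snd xK))"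
      using sum.reindex_bij_betw[OF h, of "\<lambda>xK. measure lborel (snd xK)"] by simp
    also have "\<dots> \<le> (\<Sum>xK\<in>Q. measure lborel (snd xK))"
      using fin by (intro sum_mono2) (auto simp: Q'_def)
    finally show ?thesis using small by (simp add: case_prod_unfold)
  qed
  ultimately have "(\<Sum>k<n. norm (f (t k) - f (s k))) < \<epsilon>"
    using K(2,3) hp(2) by (intro ac) (auto intro: less_imp_le)
  also have "(\<Sum>k<n. norm (f (t k) - f (s k))) = (\<Sum>xK\<in>Q'. norm (f (Sup (snd xK)) - f (Inf (snd xK))))"
    using sum.reindex_bij_betw[OF h, of "\<lambda>xK. norm (f (Sup (snd xK)) - f (Inf (snd xK)))"] by (simp add: s_def t_def)
  also have "\<dots> = (\<Sum>xK\<in>Q. norm (f (Sup (snd xK)) - f (Inf (snd xK))))"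
  proof (rule sum.mono_neutral_left)
    show "\<forall>xK\<in>Q - Q'. norm (f (Sup (snd xK)) - f (Inf (snd xK))) = 0"
    proof
      fix xK assume xK: "xK \<in> Q - Q'"
      then obtain x K where e: "xK = (x, K)" "(x, K) \<in> p" using Q by (cases xK) auto
      then have "Inf K = Sup K" using iv[OF e(2)] xK by (auto simp: Q'_def)
      then show "norm (f (Sup (snd xK)) - f (Inf (snd xK))) = 0" by (simp add: e)
    qed
  qed (use fin in \<open>auto simp: Q'_def\<close>)
  finally show ?thesis by (simp add: case_prod_unfold)
qed

text \<open>The exceptional set is controlled by the gauge witnessing that its indicator has
  Henstock--Kurzweil integral \<open>0\<close>, combined with absolute continuity.\<close>

theorem fundamental_theorem_of_calculus_abs_cont:
  fixes f :: "real \<Rightarrow> 'a::banach"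
  assumes ab: "a \<le> b" and ac: "abs_cont_on f a b" and N: "negligible N"
    and deriv: "\<And>t. t \<in> {a..b} - N \<Longrightarrow> (f has_vector_derivative g t) (at t within {a..b})"
  shows "(g has_integral f b - f a) {a..b}"
proof -
  \<comment> \<open>With the value 0 on \<open>N\<close>, an interval tagged in \<open>N\<close>
    contributes just an increment of \<open>f\<close>, and absolute continuity makes the total of
    these small.\<close>
  define g' where "g' t = (if t \<in> N then 0 else g t)" for t
  have "(g' has_integral f b - f a) {a..b}"
    unfolding has_integral_real
  proof (intro allI impI)
    fix e :: real assume e: "e > 0"
    define l where "l = b - a + 1"
    have l: "l > 0" using ab by (simp add: l_def)
    define e1 where "e1 = e / 2 / l"
    have e1: "e1 > 0" using e l by (simp add: e1_def)
    obtain \<delta> where \<delta>: "\<delta> > 0" and small: "\<And>(n::nat) (s::nat \<Rightarrow> real) t. (\<forall>k<n. a \<le> s k \<and> s k \<le> t k \<and> t k \<le> b) \<Longrightarrow>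
       (\<forall>k<n. \<forall>j<n. k \<noteq> j \<longrightarrow> t k \<le> s j \<or> t j \<le> s k) \<Longrightarrow>
       (\<Sum>k<n. t k - s k) < \<delta> \<Longrightarrow> (\<Sum>k<n. norm (f (t k) - f (s k))) < e / 2"
      using ac[unfolded abs_cont_on_def, rule_format, of "e / 2"] e by auto
    have "((indicator N :: real \<Rightarrow> real) has_integral 0) {a..b}"
      using N unfolding negligible_def by (metis box_real(2))
    then obtain G where G: "gauge G" "\<And>p. p tagged_division_of {a..b} \<Longrightarrow> G fine p \<Longrightarrow>
        norm ((\<Sum>(x, K)\<in>p. measure lborel K *\<^sub>R (indicator N x :: real)) - 0) < \<delta>"
      unfolding has_integral_real using \<delta> by meson
    have "\<forall>x. \<exists>d>0. x \<in> {a..b} - N \<longrightarrow>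
       (\<forall>y\<in>{a..b}. norm (y - x) < d \<longrightarrow> norm (f y - f x - (y - x) *\<^sub>R g x) \<le> e1 * norm (y - x))"
      using deriv[unfolded has_vector_derivative_def has_derivative_within_alt] e1 by (meson zero_less_one)
    then obtain d where d: "\<And>x. d x > 0" "\<And>x y. x \<in> {a..b} - N \<Longrightarrow> y \<in> {a..b} \<Longrightarrow> norm (y - x) < d x \<Longrightarrow>
       norm (f y - f x - (y - x) *\<^sub>R g x) \<le> e1 * norm (y - x)"
      by metis
    show "\<exists>\<gamma>. gauge \<gamma> \<and> (\<forall>p. p tagged_division_of {a..b} \<and> \<gamma> fine p \<longrightarrow>
        norm ((\<Sum>(x, K)\<in>p. measure lborel K *\<^sub>R g' x) - (f b - f a)) < e)"
    proof (intro exI conjI allI impI)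
      show "gauge (\<lambda>x. G x \<inter> ball x (d x))"
        using G(1) gauge_ball_dependent[of d] d(1) by (intro gauge_Int) auto
      fix p assume "p tagged_division_of {a..b} \<and> (\<lambda>x. G x \<inter> ball x (d x)) fine p"
      then have p: "p tagged_division_of {a..b}" and fine: "G fine p" "(\<lambda>x. ball x (d x)) fine p"
        by (auto simp: fine_Int)
      define Q where "Q = {(x, K) \<in> p. x \<in> N}"
      have fin: "finite p" "Q \<subseteq> p" "finite Q" using p finite_subset[of Q p] by (auto simp: Q_def)
      have "(\<Sum>(x, K)\<in>Q. measure lborel K) = (\<Sum>(x, K)\<in>p. measure lborel K *\<^sub>R (indicator N x :: real))"
        using fin by (intro sum.mono_neutral_cong_left) (auto simp: Q_def indicator_def split: if_splits)
      also have "\<dots> < \<delta>" using G(2)[OF p fine(1)] by (simp add: abs_less_iff)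
      finally have Qsum: "(\<Sum>(x, K)\<in>Q. measure lborel K) < \<delta>" .
      have Qs: "(\<Sum>(x, K)\<in>Q. norm (f (Sup K) - f (Inf K))) < e / 2"
        by (rule tagged_division_sum_abs_cont[OF p fin(2) _ Qsum], rule small)
      have good: "norm (measure lborel K *\<^sub>R g' x - (f (Sup K) - f (Inf K))) \<le> e1 * measure lborel K" if "(x, K) \<in> p - Q" for x K
      proof -
        have xK: "(x, K) \<in> p" "x \<notin> N" using that by (auto simp: Q_def)
        obtain c c' where K: "K = cbox c c'" using tagged_division_ofD(4)[OF p xK(1)] by blast
        have x: "x \<in> K" "K \<subseteq> {a..b}" using tagged_division_ofD(2,3)[OF p xK(1)] by auto
        have cc: "c \<le> x" "x \<le> c'" "c \<in> {a..b}" "c' \<in> {a..b}" "x \<in> {a..b} - N" using x xK by (auto simp: K)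
        have "K \<subseteq> ball x (d x)" using fine(2) xK(1) by (auto simp: fine_def)
        moreover have "c \<in> K" "c' \<in> K" using cc by (auto simp: K)
        ultimately have "c \<in> ball x (d x)" "c' \<in> ball x (d x)" by blast+
        then have "norm (c - x) < d x" "norm (c' - x) < d x"
          by (simp_all only: mem_ball dist_norm norm_minus_commute)
        then have "norm (f c - f x - (c - x) *\<^sub>R g x) \<le> e1 * (x - c)" "norm (f c' - f x - (c' - x) *\<^sub>R g x) \<le> e1 * (c' - x)"
          using d(2)[OF cc(5) cc(3)] d(2)[OF cc(5) cc(4)] cc by auto
        moreover have "(c' - c) *\<^sub>R g x - (f c' - f c) = (f c - f x - (c - x) *\<^sub>R g x) - (f c' - f x - (c' - x) *\<^sub>R g x)"
          by (simp add: algebra_simps)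
        ultimately have "norm ((c' - c) *\<^sub>R g x - (f c' - f c)) \<le> e1 * (x - c) + e1 * (c' - x)"
          by (simp only:) (rule order_trans[OF norm_triangle_ineq4 add_mono])
        then show ?thesis using cc xK by (simp add: K g'_def content_real algebra_simps)
      qed
      have bad: "norm (measure lborel K *\<^sub>R g' x - (f (Sup K) - f (Inf K))) \<le> norm (f (Sup K) - f (Inf K))" if "(x, K) \<in> Q" for x K
        using that by (auto simp: Q_def g'_def norm_minus_commute)
      have "(\<Sum>(x, K)\<in>p. measure lborel K *\<^sub>R g' x) - (f b - f a) = (\<Sum>(x, K)\<in>p. measure lborel K *\<^sub>R g' x - (f (Sup K) - f (Inf K)))"
        using additive_tagged_division_1[OF ab p, of f] by (simp add: case_prod_unfold sum_subtractf)
      also have "norm \<dots> \<le> (\<Sum>(x, K)\<in>p. norm (measure lborel K *\<^sub>R g' x - (f (Sup K) - f (Inf K))))"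
        by (rule order_trans[OF norm_sum]) (simp add: case_prod_unfold)
      also have "\<dots> = (\<Sum>(x, K)\<in>p - Q. norm (measure lborel K *\<^sub>R g' x - (f (Sup K) - f (Inf K)))) + (\<Sum>(x, K)\<in>Q. norm (measure lborel K *\<^sub>R g' x - (f (Sup K) - f (Inf K))))"
        by (rule sum.subset_diff[OF fin(2,1)])
      also have "(\<Sum>(x, K)\<in>p - Q. norm (measure lborel K *\<^sub>R g' x - (f (Sup K) - f (Inf K)))) \<le> (\<Sum>(x, K)\<in>p - Q. e1 * measure lborel K)"
        using good by (intro sum_mono) auto
      also have "(\<Sum>(x, K)\<in>p - Q. e1 * measure lborel K) \<le> (\<Sum>(x, K)\<in>p. e1 * measure lborel K)"
        using fin e1 by (intro sum_mono2) auto
      also have "\<dots> = e1 * (b - a)"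
        using additive_content_tagged_division[of p a b] p ab by (simp add: sum_distrib_left[symmetric] case_prod_unfold content_real)
      also have "(\<Sum>(x, K)\<in>Q. norm (measure lborel K *\<^sub>R g' x - (f (Sup K) - f (Inf K)))) \<le> (\<Sum>(x, K)\<in>Q. norm (f (Sup K) - f (Inf K)))"
        using bad by (intro sum_mono) auto
      also have "\<dots> < e / 2" by (rule Qs)
      also have "e1 * (b - a) + e / 2 \<le> e1 * l + e / 2" using e1 by (simp add: l_def)
      also have "e1 * l + e / 2 = e" using l by (simp add: e1_def)
      finally show "norm ((\<Sum>(x, K)\<in>p. measure lborel K *\<^sub>R g' x) - (f b - f a)) < e" by simp
    qed
  qed
  then show ?thesis
    by (rule has_integral_spike[OF N, rotated]) (simp add: g'_def)
qed

lemma abs_cont_on_subinterval: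
  assumes ac: "abs_cont_on f a b" and c: "a \<le> c" and d: "d \<le> b"
  shows "abs_cont_on f c d"
  unfolding abs_cont_on_def
proof (intro allI impI)
  fix e :: real assume "e > 0"
  then obtain \<delta> where \<delta>: "\<delta> > 0" and main: "\<And>(n::nat) (s::nat \<Rightarrow> real) t. (\<forall>k<n. a \<le> s k \<and> s k \<le> t k \<and> t k \<le> b) \<Longrightarrow>
       (\<forall>k<n. \<forall>j<n. k \<noteq> j \<longrightarrow> t k \<le> s j \<or> t j \<le> s k) \<Longrightarrow>
       (\<Sum>k<n. t k - s k) < \<delta> \<Longrightarrow> (\<Sum>k<n. norm (f (t k) - f (s k))) < e"
    using ac[unfolded abs_cont_on_def, rule_format, of e] by auto
  show "\<exists>\<delta>>0. \<forall>(n::nat) (s::nat \<Rightarrow> real) t.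
       (\<forall>k<n. c \<le> s k \<and> s k \<le> t k \<and> t k \<le> d) \<and>
       (\<forall>k<n. \<forall>j<n. k \<noteq> j \<longrightarrow> t k \<le> s j \<or> t j \<le> s k) \<and>
       (\<Sum>k<n. t k - s k) < \<delta> \<longrightarrow>
       (\<Sum>k<n. norm (f (t k) - f (s k))) < e"
  proof (intro exI conjI allI impI)
    show "\<delta> > 0" by (rule \<delta>)
    fix n and s t :: "nat \<Rightarrow> real"
    assume *: "(\<forall>k<n. c \<le> s k \<and> s k \<le> t k \<and> t k \<le> d) \<and>
       (\<forall>k<n. \<forall>j<n. k \<noteq> j \<longrightarrow> t k \<le> s j \<or> t j \<le> s k) \<and>
       (\<Sum>k<n. t k - s k) < \<delta>"
    then have "\<forall>k<n. a \<le> s k \<and> s k \<le> t k \<and> t k \<le> b" using c d by force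
    then show "(\<Sum>k<n. norm (f (t k) - f (s k))) < e" by (rule main) (use * in auto)
  qed
qed

lemma lipschitz_imp_abs_cont_on:
  assumes C: "\<And>s t. norm (f t - f s) \<le> C * \<bar>t - s\<bar>"
  shows "abs_cont_on f a b"
  unfolding abs_cont_on_def
proof (intro allI impI)
  fix e :: real assume e: "e > 0"
  show "\<exists>\<delta>>0. \<forall>(n::nat) (s::nat \<Rightarrow> real) t.
       (\<forall>k<n. a \<le> s k \<and> s k \<le> t k \<and> t k \<le> b) \<and>
       (\<forall>k<n. \<forall>j<n. k \<noteq> j \<longrightarrow> t k \<le> s j \<or> t j \<le> s k) \<and>
       (\<Sum>k<n. t k - s k) < \<delta> \<longrightarrow>
       (\<Sum>k<n. norm (f (t k) - f (s k))) < e"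
  proof (intro exI conjI allI impI)
    show "e / (\<bar>C\<bar> + 1) > 0" using e by simp
    fix n and s t :: "nat \<Rightarrow> real"
    assume *: "(\<forall>k<n. a \<le> s k \<and> s k \<le> t k \<and> t k \<le> b) \<and>
       (\<forall>k<n. \<forall>j<n. k \<noteq> j \<longrightarrow> t k \<le> s j \<or> t j \<le> s k) \<and>
       (\<Sum>k<n. t k - s k) < e / (\<bar>C\<bar> + 1)"
    have "(\<Sum>k<n. norm (f (t k) - f (s k))) \<le> (\<Sum>k<n. (\<bar>C\<bar> + 1) * (t k - s k))"
    proof (rule sum_mono)
      fix k assume "k \<in> {..<n}"
      then have st: "s k \<le> t k" using * by simp
      have "C * \<bar>t k - s k\<bar> \<le> (\<bar>C\<bar> + 1) * \<bar>t k - s k\<bar>" by (intro mult_right_mono) auto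
      then show "norm (f (t k) - f (s k)) \<le> (\<bar>C\<bar> + 1) * (t k - s k)"
        using C[of "t k" "s k"] st by simp
    qed
    also have "\<dots> = (\<bar>C\<bar> + 1) * (\<Sum>k<n. t k - s k)" by (simp add: sum_distrib_left)
    also have "\<dots> < (\<bar>C\<bar> + 1) * (e / (\<bar>C\<bar> + 1))" using * by (intro mult_strict_left_mono) auto
    also have "\<dots> = e" by simp
    finally show "(\<Sum>k<n. norm (f (t k) - f (s k))) < e" .
  qed
qed

section \<open>Lebesgue differentiation on the line\<close>

lemma lebesgue_right_derivative:
  fixes g :: "real \<Rightarrow> 'b::euclidean_space"
  assumes int: "\<And>a b. a \<le> b \<Longrightarrow> (g has_integral G b - G a) {a..b}"
  shows "\<exists>N. negligible N \<and> (\<forall>x e. x \<notin> N \<and> 0 < e \<longrightarrow>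
     (\<exists>d>0. \<forall>h. 0 < h \<and> h < d \<longrightarrow> norm (G (x + h) - G x - h *\<^sub>R g x) \<le> e * h))"
proof -
  have "g integrable_on cbox a b" for a b
  proof (cases "a \<le> b")
    case True then show ?thesis using int[OF True] by (auto simp: integrable_on_def)
  qed (auto simp: cbox_interval)
  then obtain N where N: "negligible N"
    "\<And>x e. \<lbrakk>x \<notin> N; 0 < e\<rbrakk> \<Longrightarrow> \<exists>d>0. \<forall>h. 0 < h \<and> h < d \<longrightarrow>
        norm (integral (cbox x (x + h *\<^sub>R One)) g /\<^sub>R h ^ DIM(real) - g x) < e"
    using integrable_ccontinuous_explicit[of g] by blast
  have "\<exists>d>0. \<forall>h. 0 < h \<and> h < d \<longrightarrow> norm (G (x + h) - G x - h *\<^sub>R g x) \<le> e * h" if xe: "x \<notin> N" "0 < e" for x e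
  proof -
    obtain d where d: "d > 0" "\<And>h. 0 < h \<Longrightarrow> h < d \<Longrightarrow> norm (integral {x..x + h} g /\<^sub>R h - g x) < e"
      using N(2)[OF xe] by auto
    have "norm (G (x + h) - G x - h *\<^sub>R g x) \<le> e * h" if h: "0 < h" "h < d" for h
    proof -
      have "integral {x..x + h} g = G (x + h) - G x" using int[of x "x + h"] h by (simp add: integral_unique)
      then have "G (x + h) - G x - h *\<^sub>R g x = h *\<^sub>R (integral {x..x + h} g /\<^sub>R h - g x)"
        using h by (simp add: algebra_simps)
      then have "norm (G (x + h) - G x - h *\<^sub>R g x) = h * norm (integral {x..x + h} g /\<^sub>R h - g x)"
        using h by simp
      also have "\<dots> \<le> h * e" using d(2)[OF h] h by (intro mult_left_mono) auto
      finally show ?thesis by (simp add: mult.commute)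
    qed
    then show ?thesis using d(1) by blast
  qed
  then show ?thesis using N(1) by blast
qed

text \<open>Left difference quotients are right difference quotients of the reflected function s
  \<mapsto> g(-s), whose exceptional set is reflected back.\<close>

lemma lebesgue_differentiation:
  fixes g :: "real \<Rightarrow> 'b::euclidean_space"
  assumes int: "\<And>a b. a \<le> b \<Longrightarrow> (g has_integral G b - G a) {a..b}"
  shows "\<exists>N. negligible N \<and> (\<forall>x. x \<notin> N \<longrightarrow> (G has_vector_derivative g x) (at x))"
proof -
  obtain N1 where N1: "negligible N1" "\<And>x e. x \<notin> N1 \<Longrightarrow> 0 < e \<Longrightarrow>
     \<exists>d>0. \<forall>h. 0 < h \<and> h < d \<longrightarrow> norm (G (x + h) - G x - h *\<^sub>R g x) \<le> e * h"
    using lebesgue_right_derivative[OF int] by metis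
  have "((\<lambda>s. g (- s)) has_integral (- G (- b)) - (- G (- a))) {a..b}" if "a \<le> b" for a b
    using int[of "- b" "- a"] that has_integral_reflect_real[of g "G (- a) - G (- b)" "- a" "- b"] by simp
  then obtain N2 where N2: "negligible N2" "\<And>x e. x \<notin> N2 \<Longrightarrow> 0 < e \<Longrightarrow>
     \<exists>d>0. \<forall>h. 0 < h \<and> h < d \<longrightarrow> norm (- G (- (x + h)) - (- G (- x)) - h *\<^sub>R g (- x)) \<le> e * h"
    using lebesgue_right_derivative[of "\<lambda>s. g (- s)" "\<lambda>s. - G (- s)"] by metis
  have "negligible (uminus ` N2)"
    using N2(1) by (intro negligible_differentiable_image_negligible) (auto intro!: derivative_intros)
  then have "negligible (N1 \<union> uminus ` N2)" using N1(1) by simp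
  moreover have "(G has_vector_derivative g x) (at x)" if "x \<notin> N1 \<union> uminus ` N2" for x
    unfolding has_vector_derivative_def has_derivative_at_alt
  proof (intro conjI allI impI)
    show "bounded_linear (\<lambda>h. h *\<^sub>R g x)" by (rule bounded_linear_scaleR_left)
    fix e :: real assume e: "e > 0"
    have x: "x \<notin> N1" "- x \<notin> N2" using that by force+
    obtain d1 where d1: "d1 > 0" "\<And>h. 0 < h \<Longrightarrow> h < d1 \<Longrightarrow> norm (G (x + h) - G x - h *\<^sub>R g x) \<le> e * h"
      using N1(2)[OF x(1) e] by blast
    obtain d2 where d2: "d2 > 0" "\<And>h. 0 < h \<Longrightarrow> h < d2 \<Longrightarrow> norm (- G (- (- x + h)) - (- G (- (- x))) - h *\<^sub>R g (- (- x))) \<le> e * h"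
      using N2(2)[OF x(2) e] by blast
    show "\<exists>d>0. \<forall>y. norm (y - x) < d \<longrightarrow> norm (G y - G x - (y - x) *\<^sub>R g x) \<le> e * norm (y - x)"
    proof (intro exI[of _ "min d1 d2"] conjI allI impI)
      show "0 < min d1 d2" using d1 d2 by simp
      fix y assume y: "norm (y - x) < min d1 d2"
      consider "y = x" | "y > x" | "y < x" by linarith
      then show "norm (G y - G x - (y - x) *\<^sub>R g x) \<le> e * norm (y - x)"
      proof cases
        case 2
        then show ?thesis using d1(2)[of "y - x"] y by simp
      next
        case 3
        have "- G y - - G x - (x - y) *\<^sub>R g x = G x - G y - (x - y) *\<^sub>R g x" by simp
        also have "\<dots> = - (G y - G x - (y - x) *\<^sub>R g x)" by (simp add: algebra_simps)
        finally have "norm (- G y - - G x - (x - y) *\<^sub>R g x) = norm (G y - G x - (y - x) *\<^sub>R g x)"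
          by (metis norm_minus_cancel)
        moreover have "norm (- G y - - G x - (x - y) *\<^sub>R g x) \<le> e * (x - y)"
          using d2(2)[of "x - y"] y 3 by simp
        ultimately show ?thesis using 3 by simp
      qed simp
    qed
  qed
  ultimately show ?thesis by blast
qed

section \<open>Weak convergence and change of time\<close>

text \<open>All \<open>d n\<close> are bounded by \<open>R\<close>, so replacing \<phi> by s k
  changes the integrals by at most R times the L1 distance, uniformly in n. This serves both for
  countable unions of sets and for limits of integrable functions.\<close>

lemma weak_null_L1_closure:
  fixes d :: "nat \<Rightarrow> 'a \<Rightarrow> real"
  assumes d [measurable]: "\<And>n. d n \<in> borel_measurable M" and R: "\<And>n x. \<bar>d n x\<bar> \<le> R"
    and \<phi>: "integrable M \<phi>" and s: "\<And>k. integrable M (s k)"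
    and lim: "(\<lambda>k. \<integral>x. \<bar>\<phi> x - s k x\<bar> \<partial>M) \<longlonglongrightarrow> 0"
    and null: "\<And>k. (\<lambda>n. \<integral>x. s k x * d n x \<partial>M) \<longlonglongrightarrow> 0"
  shows "(\<lambda>n. \<integral>x. \<phi> x * d n x \<partial>M) \<longlonglongrightarrow> 0"
proof (rule LIMSEQ_I)
  have R0: "R \<ge> 0" using R abs_ge_zero order_trans by blast
  have int: "integrable M (\<lambda>x. h x * d n x)" if "integrable M h" for h n
  proof (rule Bochner_Integration.integrable_bound[of _ "\<lambda>x. R * h x"])
    have [measurable]: "h \<in> borel_measurable M" using that by simp
    show "(\<lambda>x. h x * d n x) \<in> borel_measurable M" by measurable
    show "AE x in M. norm (h x * d n x) \<le> norm (R * h x)"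
    proof (rule AE_I2)
      fix x
      have "\<bar>h x\<bar> * \<bar>d n x\<bar> \<le> \<bar>h x\<bar> * R" by (intro mult_left_mono R) auto
      then show "norm (h x * d n x) \<le> norm (R * h x)" using R0 by (simp add: abs_mult mult.commute)
    qed
  qed (use that in auto)
  fix e :: real assume e: "e > 0"
  then have "e / 2 / (R + 1) > 0" using R0 by simp
  from LIMSEQ_D[OF lim this] obtain k where "norm ((\<integral>x. \<bar>\<phi> x - s k x\<bar> \<partial>M) - 0) < e / 2 / (R + 1)"
    by blast
  then have k: "(\<integral>x. \<bar>\<phi> x - s k x\<bar> \<partial>M) < e / 2 / (R + 1)" by (simp add: abs_less_iff)
  have "e / 2 > 0" using e by simp
  from LIMSEQ_D[OF null this] obtain n0 where n0: "\<And>n. n \<ge> n0 \<Longrightarrow> \<bar>\<integral>x. s k x * d n x \<partial>M\<bar> < e / 2" by auto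
  show "\<exists>n0. \<forall>n\<ge>n0. norm ((\<integral>x. \<phi> x * d n x \<partial>M) - 0) < e"
  proof (intro exI[of _ n0] allI impI)
    fix n assume n: "n \<ge> n0"
    have "(\<integral>x. \<phi> x * d n x \<partial>M) = (\<integral>x. s k x * d n x \<partial>M) + (\<integral>x. (\<phi> x - s k x) * d n x \<partial>M)"
      using int[OF s[of k]] int[OF \<phi>] by (simp add: left_diff_distrib)
    moreover have "\<bar>\<integral>x. (\<phi> x - s k x) * d n x \<partial>M\<bar> \<le> (\<integral>x. \<bar>\<phi> x - s k x\<bar> * R \<partial>M)"
    proof -
      have "\<bar>\<integral>x. (\<phi> x - s k x) * d n x \<partial>M\<bar> \<le> (\<integral>x. \<bar>(\<phi> x - s k x) * d n x\<bar> \<partial>M)"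
        by (rule integral_abs_bound)
      also have "\<dots> \<le> (\<integral>x. \<bar>\<phi> x - s k x\<bar> * R \<partial>M)"
      proof (rule integral_mono)
        show "integrable M (\<lambda>x. \<bar>(\<phi> x - s k x) * d n x\<bar>)"
          using \<phi> s by (intro integrable_abs int) auto
        show "\<bar>(\<phi> x - s k x) * d n x\<bar> \<le> \<bar>\<phi> x - s k x\<bar> * R" for x
          unfolding abs_mult by (intro mult_left_mono R) auto
      qed (use \<phi> s in auto)
      finally show ?thesis .
    qed
    moreover have "(\<integral>x. \<bar>\<phi> x - s k x\<bar> * R \<partial>M) < e / 2"
    proof -
      have "(\<integral>x. \<bar>\<phi> x - s k x\<bar> * R \<partial>M) \<le> (\<integral>x. \<bar>\<phi> x - s k x\<bar> \<partial>M) * (R + 1)"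
        by (simp add: mult_left_mono integral_nonneg)
      also have "\<dots> < (e / 2 / (R + 1)) * (R + 1)" using k R0 by (intro mult_strict_right_mono) auto
      also have "\<dots> = e / 2" by (rule nonzero_eq_divide_eq[THEN iffD1, OF _ refl]) (use R0 in simp)
      finally show ?thesis .
    qed
    ultimately show "norm ((\<integral>x. \<phi> x * d n x \<partial>M) - 0) < e" using n0[OF n] by simp
  qed
qed

text \<open>Half-lines form a generating family stable under intersection, so Dynkin's lemma carries
  the hypothesis to all Borel sets; the total mass provides the step to complements. Integrable test
  functions follow by linearity and L1 approximation.\<close>

lemma weak_null:
  fixes d :: "nat \<Rightarrow> real \<Rightarrow> real"
  assumes "finite_measure M" and sets: "sets M = sets borel"
    and d: "\<And>n. d n \<in> borel_measurable borel" and R: "\<And>n x. \<bar>d n x\<bar> \<le> R"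
    and init: "\<And>c. (\<lambda>n. \<integral>x. indicator {..c} x * d n x \<partial>M) \<longlonglongrightarrow> 0"
    and total: "(\<lambda>n. \<integral>x. d n x \<partial>M) \<longlonglongrightarrow> 0"
    and \<phi>: "integrable M \<phi>"
  shows "(\<lambda>n. \<integral>x. \<phi> x * d n x \<partial>M) \<longlonglongrightarrow> 0"
proof -
  interpret finite_measure M by fact
  have dM [measurable]: "d n \<in> borel_measurable M" for n using d sets measurable_cong_sets by blast
  have sp: "space M = UNIV" using sets_eq_imp_space_eq[OF sets] by simp
  have ind: "integrable M (indicator A :: real \<Rightarrow> real)" if "A \<in> sets borel" for A
    using that sets by (intro integrable_real_indicator) (auto simp: emeasure_eq_measure)
  have dint: "integrable M (\<lambda>x. indicator A x * d n x)" if "A \<in> sets borel" for A n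
  proof (rule integrable_const_bound[where B = R])
    show "AE x in M. norm (indicator A x * d n x) \<le> R"
      using R order_trans[OF abs_ge_zero R] by (auto simp: indicator_def)
    show "(\<lambda>x. indicator A x * d n x) \<in> borel_measurable M"
      using that sets by measurable
  qed
  have base: "(\<lambda>n. \<integral>x. indicator A x * d n x \<partial>M) \<longlonglongrightarrow> 0" if A: "A \<in> sets borel" for A
  proof -
    have subset_Pow_UNIV: "E \<subseteq> Pow UNIV" for E :: "real set set" by simp
    have stable: "Int_stable (range (\<lambda>c::real. {..c}))"
    proof (rule Int_stableI)
      fix a b assume "a \<in> range (\<lambda>c::real. {..c})" "b \<in> range (\<lambda>c::real. {..c})"
      then obtain c c' :: real where "a = {..c}" "b = {..c'}" by auto
      then have "a \<inter> b = {..min c c'}" by auto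
      then show "a \<inter> b \<in> range (\<lambda>c::real. {..c})" by blast
    qed
    have "A \<in> sigma_sets UNIV (range (\<lambda>c::real. {..c}))"
      using A unfolding borel_eq_atMost by simp
    with stable subset_Pow_UNIV[of "range (\<lambda>c::real. {..c})"] show ?thesis
    proof (induction rule: sigma_sets_induct_disjoint)
      case (basic A) then show ?case using init by auto
    next
      case empty then show ?case by simp
    next
      case (compl A)
      then have [measurable]: "A \<in> sets borel" unfolding borel_eq_atMost by simp
      have "(\<integral>x. indicator (UNIV - A) x * d n x \<partial>M) = (\<integral>x. d n x \<partial>M) - (\<integral>x. indicator A x * d n x \<partial>M)" for n
      proof -
        have "(\<integral>x. indicator (UNIV - A) x * d n x \<partial>M) = (\<integral>x. indicator UNIV x * d n x - indicator A x * d n x \<partial>M)"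
          by (intro Bochner_Integration.integral_cong) (auto simp: indicator_def)
        then show ?thesis using dint[of UNIV n] dint[of A n] by simp
      qed
      then show ?case using tendsto_diff[OF total compl.IH] by simp
    next
      case (union A)
      then have A: "A i \<in> sets borel" for i unfolding borel_eq_atMost by auto
      have fin: "indicator (\<Union>i<k. A i) x = (\<Sum>i<k. indicator (A i) x :: real)" for k x
        using union.hyps(1) by (intro indicator_UN_disjoint) (auto simp: disjoint_family_on_def)
      show ?case
      proof (rule weak_null_L1_closure[where s = "\<lambda>k. indicator (\<Union>i<k. A i)", OF dM R])
        show "integrable M (indicator (\<Union> (range A)) :: real \<Rightarrow> real)" "integrable M (indicator (\<Union>i<k. A i) :: real \<Rightarrow> real)" for k
          using A by (auto intro!: ind)
        show "(\<lambda>n. \<integral>x. indicator (\<Union>i<k. A i) x * d n x \<partial>M) \<longlonglongrightarrow> 0" for k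
        proof -
          have "(\<integral>x. indicator (\<Union>i<k. A i) x * d n x \<partial>M) = (\<Sum>i<k. \<integral>x. indicator (A i) x * d n x \<partial>M)" for n
            unfolding fin sum_distrib_right using dint[OF A] by (intro Bochner_Integration.integral_sum) auto
          then show ?thesis using tendsto_sum[of "{..<k}", OF union.IH] by simp
        qed
        have "(\<lambda>k. \<integral>x. \<bar>indicator (\<Union> (range A)) x - indicator (\<Union>i<k. A i) x\<bar> \<partial>M) \<longlonglongrightarrow> (\<integral>x. (0::real) \<partial>M)"
        proof (rule integral_dominated_convergence[where w = "\<lambda>_. 1"])
          show "AE x in M. (\<lambda>k. \<bar>indicator (\<Union> (range A)) x - indicator (\<Union>i<k. A i) x\<bar> :: real) \<longlonglongrightarrow> 0"
          proof (rule AE_I2)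
            fix x
            show "(\<lambda>k. \<bar>indicator (\<Union> (range A)) x - indicator (\<Union>i<k. A i) x\<bar> :: real) \<longlonglongrightarrow> 0"
            proof (cases "x \<in> \<Union> (range A)")
              case True
              then obtain i where i: "x \<in> A i" by auto
              have "eventually (\<lambda>k. \<bar>indicator (\<Union> (range A)) x - indicator (\<Union>i<k. A i) x\<bar> = (0::real)) sequentially"
                using eventually_gt_at_top[of i] by eventually_elim (use i in \<open>auto simp: indicator_def\<close>)
              then show ?thesis by (simp add: tendsto_eventually)
            qed (auto simp: indicator_def)
          qed
        qed (use A sets in \<open>auto simp: indicator_def intro!: borel_measurable_abs borel_measurable_diff borel_measurable_indicator\<close>)
        then show "(\<lambda>k. \<integral>x. \<bar>indicator (\<Union> (range A)) x - indicator (\<Union>i<k. A i) x :: real\<bar> \<partial>M) \<longlonglongrightarrow> 0" by simp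
      qed
    qed
  qed
  show ?thesis
    using \<phi>
  proof (induction rule: integrable_induct)
    case (base A c)
    then have "A \<in> sets borel" using sets by simp
    from tendsto_mult_right[OF \<open>\<And>A. A \<in> sets borel \<Longrightarrow> (\<lambda>n. \<integral>x. indicator A x * d n x \<partial>M) \<longlonglongrightarrow> 0\<close>[OF this], of c]
    show ?case by (simp add: mult_ac)
  next
    case (add f g)
    have "integrable M (\<lambda>x. f x * d n x)" "integrable M (\<lambda>x. g x * d n x)" for n
    proof -
      have *: "integrable M (\<lambda>x. h x * d n x)" if h: "integrable M h" for h :: "real \<Rightarrow> real"
      proof (rule Bochner_Integration.integrable_bound[of _ "\<lambda>x. R * h x"])
        show "(\<lambda>x. h x * d n x) \<in> borel_measurable M" using h by measurable
        show "AE x in M. norm (h x * d n x) \<le> norm (R * h x)"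
        proof (rule AE_I2)
          fix x
          have "\<bar>h x\<bar> * \<bar>d n x\<bar> \<le> \<bar>h x\<bar> * \<bar>R\<bar>" using R[of n x] by (intro mult_left_mono) auto
          then show "norm (h x * d n x) \<le> norm (R * h x)" by (simp add: abs_mult mult.commute)
        qed
      qed (use h in auto)
      show "integrable M (\<lambda>x. f x * d n x)" "integrable M (\<lambda>x. g x * d n x)" using * add.hyps by auto
    qed
    then show ?case using tendsto_add[OF add.IH] by (simp add: distrib_right)
  next
    case (lim f s)
    show ?case
    proof (rule weak_null_L1_closure[where s = s, OF dM R])
      have "(\<lambda>k. \<integral>x. \<bar>f x - s k x\<bar> \<partial>M) \<longlonglongrightarrow> (\<integral>x. (0::real) \<partial>M)"
      proof (rule integral_dominated_convergence[where w = "\<lambda>x. 3 * \<bar>f x\<bar>"])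
        show "AE x in M. (\<lambda>k. \<bar>f x - s k x\<bar>) \<longlonglongrightarrow> 0"
          using lim.hyps(2) sp by (intro AE_I2 tendsto_rabs_zero) (auto intro!: tendsto_eq_intros)
        show "AE x in M. norm \<bar>f x - s k x\<bar> \<le> 3 * \<bar>f x\<bar>" for k
        proof (rule AE_I2)
          fix x assume "x \<in> space M"
          then have "\<bar>s k x\<bar> \<le> 2 * \<bar>f x\<bar>" using lim.hyps(3) by simp
          then show "norm \<bar>f x - s k x\<bar> \<le> 3 * \<bar>f x\<bar>" by simp
        qed
      qed (use lim.hyps in \<open>auto intro!: borel_measurable_abs borel_measurable_diff\<close>)
      then show "(\<lambda>k. \<integral>x. \<bar>f x - s k x\<bar> \<partial>M) \<longlonglongrightarrow> 0" by simp
    qed (use lim in auto)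
  qed
qed

section \<open>Change of time\<close>

lemma distr_inverse_density:
  fixes \<theta> \<beta> w :: "real \<Rightarrow> real"
  assumes inv: "\<And>s t. \<beta> s \<le> t \<longleftrightarrow> s \<le> \<theta> t" "\<And>s t. t \<le> \<beta> s \<longleftrightarrow> \<theta> t \<le> s"
    and w: "w \<in> borel_measurable borel" "\<And>t. 0 \<le> w t"
    and int: "\<And>p q. p \<le> q \<Longrightarrow> (w has_integral \<theta> q - \<theta> p) {p..q}"
  shows "\<beta> \<in> borel_measurable borel" "distr lborel borel \<beta> = density lborel (\<lambda>t. ennreal (w t))"
proof -
  have mono: "mono \<beta>"
    by (rule monoI) (meson inv order_refl order_trans)
  then show [measurable]: "\<beta> \<in> borel_measurable borel" by (rule borel_measurable_mono)
  have th: "\<theta> p \<le> \<theta> q" if "p \<le> q" for p q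
    using has_integral_nonneg[OF int[OF that]] w(2) by simp
  note [measurable] = w(1)
  \<comment> \<open>The preimage of {p..q} under \<beta> is {\<theta> p..\<theta> q}, whose length
    is the integral of \<open>w\<close> over {p..q}; closed intervals generate the Borel sets, so
    the two measures agree.\<close>
  show "distr lborel borel \<beta> = density lborel (\<lambda>t. ennreal (w t))"
  proof (rule measure_eqI_generator_eq[where E = "range (\<lambda>(a, b). {a..b} :: real set)" and \<Omega> = UNIV and A = "\<lambda>i::nat. {- real i..real i}"])
    show "Int_stable (range (\<lambda>(a, b). {a..b} :: real set))"
      by (auto simp: Int_stable_def)
    show "sets (distr lborel borel \<beta>) = sigma_sets UNIV (range (\<lambda>(a, b). {a..b} :: real set))"
      "sets (density lborel (\<lambda>t. ennreal (w t))) = sigma_sets UNIV (range (\<lambda>(a, b). {a..b} :: real set))"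
      by (simp_all, (subst borel_eq_atLeastAtMost, simp add: sets_measure_of)+)
    have eq: "emeasure (distr lborel borel \<beta>) {p..q} = (if p \<le> q then ennreal (\<theta> q - \<theta> p) else 0)" for p q
    proof -
      have "\<beta> -` {p..q} = {\<theta> p..\<theta> q}" using inv by auto
      then have "emeasure (distr lborel borel \<beta>) {p..q} = emeasure lborel {\<theta> p..\<theta> q}"
        by (simp add: emeasure_distr)
      then show ?thesis using th[of p q] by (metis atLeastatMost_empty_iff emeasure_distr emeasure_empty emeasure_lborel_Icc vimage_empty \<open>\<beta> -` {p..q} = {\<theta> p..\<theta> q}\<close>)
    qed
    show "emeasure (distr lborel borel \<beta>) X = emeasure (density lborel (\<lambda>t. ennreal (w t))) X"
      if memX: "X \<in> range (\<lambda>(a, b). {a..b} :: real set)" for X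
    proof -
      obtain p q where X: "X = {p..q}" using memX by auto
      have "emeasure (density lborel (\<lambda>t. ennreal (w t))) {p..q} = (\<integral>\<^sup>+t. ennreal (w t) * indicator {p..q} t \<partial>lborel)"
        by (simp add: emeasure_density)
      also have "\<dots> = (if p \<le> q then ennreal (\<theta> q - \<theta> p) else 0)"
        using nn_integral_has_integral_lebesgue'[OF _ int[of p q]] w(2) by auto
      finally show ?thesis using eq by (simp add: X)
    qed
    show "emeasure (distr lborel borel \<beta>) {- real i..real i} \<noteq> \<infinity>" for i unfolding eq by auto
    show "(\<Union>i. {- real i..real i}) = UNIV"
    proof -
      have "x \<in> {- real (nat \<lceil>\<bar>x\<bar>\<rceil>)..real (nat \<lceil>\<bar>x\<bar>\<rceil>)}" for x :: real
        using real_nat_ceiling_ge[of "\<bar>x\<bar>"] unfolding abs_le_iff atLeastAtMost_iff by linarith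
      then show ?thesis by blast
    qed
  qed auto
qed

text \<open>Substitution s = \<theta> t with a merely measurable density: the pushforward of
  Lebesgue measure under the inverse \<beta> has density \<open>w\<close>. This generality is wanted
  because the time change will be built from a measurable control.\<close>

lemma has_integral_time_change:
  fixes \<theta> \<beta> w :: "real \<Rightarrow> real" and g :: "real \<Rightarrow> 'b::euclidean_space"
  assumes inv: "\<And>s t. \<beta> s \<le> t \<longleftrightarrow> s \<le> \<theta> t" "\<And>s t. t \<le> \<beta> s \<longleftrightarrow> \<theta> t \<le> s"
    and w: "w \<in> borel_measurable borel" "\<And>t. 0 \<le> w t"
    and int: "\<And>p q. p \<le> q \<Longrightarrow> (w has_integral \<theta> q - \<theta> p) {p..q}"
    and g: "g \<in> borel_measurable borel" and wg: "set_integrable lborel {p..q} (\<lambda>t. w t *\<^sub>R g t)"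
  shows "((\<lambda>s. g (\<beta> s)) has_integral integral {p..q} (\<lambda>t. w t *\<^sub>R g t)) {\<theta> p..\<theta> q}"
proof -
  note [measurable] = w(1) g distr_inverse_density(1)[OF inv w int]
  have dens: "distr lborel borel \<beta> = density lborel (\<lambda>t. ennreal (w t))"
    by (rule distr_inverse_density(2)[OF inv w int])
  let ?h = "\<lambda>t. indicat_real {p..q} t *\<^sub>R g t"
  have eq: "w t *\<^sub>R ?h t = indicat_real {p..q} t *\<^sub>R (w t *\<^sub>R g t)" for t by simp
  have wh: "integrable lborel (\<lambda>t. w t *\<^sub>R ?h t)"
    using wg unfolding set_integrable_def eq .
  have 1: "integrable (density lborel (\<lambda>t. ennreal (w t))) ?h"
  proof (subst integrable_density)
    show "AE t in lborel. 0 \<le> w t" using w(2) by simp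
  qed (use wh in measurable)
  have "integrable (distr lborel borel \<beta>) ?h"
    using 1 unfolding dens .
  then have "integrable lborel (\<lambda>s. ?h (\<beta> s))"
    by (rule integrable_distr[rotated]) simp
  from has_integral_integral_lborel[OF this]
  have "((\<lambda>s. ?h (\<beta> s)) has_integral (\<integral>s. ?h (\<beta> s) \<partial>lborel)) UNIV" .
  also have "(\<integral>s. ?h (\<beta> s) \<partial>lborel) = integral\<^sup>L (distr lborel borel \<beta>) ?h"
    by (subst integral_distr) auto
  also have "\<dots> = (\<integral>t. w t *\<^sub>R ?h t \<partial>lborel)"
    unfolding dens using w(2) by (subst integral_density) auto
  also have "\<dots> = integral {p..q} (\<lambda>t. w t *\<^sub>R g t)"
    unfolding eq using set_borel_integral_eq_integral(2)[OF wg] unfolding set_lebesgue_integral_def .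
  also have "(\<lambda>s. ?h (\<beta> s)) = (\<lambda>s. if s \<in> {\<theta> p..\<theta> q} then g (\<beta> s) else 0)"
    using inv by (auto simp: indicator_def)
  finally show ?thesis by (simp only: has_integral_restrict_UNIV)
qed

lemma increasing_homeomorphism_inverse:
  fixes \<theta> :: "real \<Rightarrow> real"
  assumes c: "c > 0" and slope: "\<And>p q. p \<le> q \<Longrightarrow> c * (q - p) \<le> \<theta> q - \<theta> p" and cont: "continuous_on UNIV \<theta>"
  obtains \<beta> where "\<And>s t. \<beta> s \<le> t \<longleftrightarrow> s \<le> \<theta> t" "\<And>s t. t \<le> \<beta> s \<longleftrightarrow> \<theta> t \<le> s" "\<And>s. \<theta> (\<beta> s) = s" "\<And>t. \<beta> (\<theta> t) = t"
proof -
  have less: "\<theta> p < \<theta> q \<longleftrightarrow> p < q" for p q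
  proof -
    have "\<theta> p < \<theta> q" if "p < q" for p q
      using slope[of p q] that mult_pos_pos[OF c, of "q - p"] by simp
    then show ?thesis by (metis less_asym linorder_less_linear)
  qed
  have "\<exists>t. \<theta> t = s" for s
  proof -
    \<comment> \<open>Over the distance \<open>r\<close> the slope bound moves \<theta> by at least
      |s| + |\<theta> 0|, so s lies between the values at -r and r.\<close>
    define r where "r = (\<bar>s\<bar> + \<bar>\<theta> 0\<bar>) / c"
    have r: "r \<ge> 0" "c * r = \<bar>s\<bar> + \<bar>\<theta> 0\<bar>" using c by (auto simp: r_def)
    have "\<theta> (- r) \<le> s" "s \<le> \<theta> r" using slope[of "- r" 0] slope[of 0 r] r by auto
    then have "\<exists>t. - r \<le> t \<and> t \<le> r \<and> \<theta> t = s"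
      using r by (intro IVT') (auto intro: continuous_on_subset[OF cont])
    then show ?thesis by blast
  qed
  then obtain \<beta> where b: "\<And>s. \<theta> (\<beta> s) = s" by metis
  show thesis
  proof (rule that[of \<beta>])
    show "\<beta> s \<le> t \<longleftrightarrow> s \<le> \<theta> t" for s t using less[of t "\<beta> s"] b[of s] by (metis not_le)
    show "t \<le> \<beta> s \<longleftrightarrow> \<theta> t \<le> s" for s t using less[of "\<beta> s" t] b[of s] by (metis not_le)
    show "\<theta> (\<beta> s) = s" for s by (rule b)
    show "\<beta> (\<theta> t) = t" for t using less b by (metis less_irrefl linorder_less_linear)
  qed
qed

text \<open>Rademacher's theorem in one variable through Radon-Nikodym. Adding a linear term makes
  \<open>G\<close> an increasing bi-Lipschitz bijection \<theta>; the measure A \<mapsto>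
  |\<theta>(A)| is absolutely continuous because Lipschitz maps preserve null sets, and its density
  minus the added slope is the density of \<open>G\<close>.\<close>

lemma lipschitz_real_density:
  fixes G :: "real \<Rightarrow> real"
  assumes lip: "\<And>a b. \<bar>G b - G a\<bar> \<le> R * \<bar>b - a\<bar>"
  shows "\<exists>v\<in>borel_measurable borel. \<forall>a b. a \<le> b \<longrightarrow> (v has_integral G b - G a) {a..b}"
proof -
  have R: "R \<ge> 0" using lip[of 1 0] by simp
  \<comment> \<open>The slope R + 1 dominates the variation of \<open>G\<close> with 1 to spare, so
    \<theta> is expanding and hence invertible.\<close>
  define \<theta> where "\<theta> t = G t + (R + 1) * t" for t
  have slope: "1 * (q - p) \<le> \<theta> q - \<theta> p" "\<theta> q - \<theta> p \<le> (2 * R + 1) * (q - p)" if "p \<le> q" for p q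
    using lip[of q p] that unfolding \<theta>_def by (auto simp: algebra_simps abs_le_iff)
  have lipth: "\<bar>\<theta> q - \<theta> p\<bar> \<le> (2 * R + 1) * \<bar>q - p\<bar>" for p q
  proof (cases "p \<le> q")
    case True
    then show ?thesis using slope[OF True] by simp
  next
    case False
    then show ?thesis using slope[of q p] by simp
  qed
  have cont: "continuous_on UNIV \<theta>"
    using lipth R by (intro lipschitz_on_continuous_on[of "2 * R + 1"] lipschitz_onI) (auto simp: dist_real_def abs_minus_commute)
  obtain \<beta> where b: "\<And>s t. \<beta> s \<le> t \<longleftrightarrow> s \<le> \<theta> t" "\<And>s t. t \<le> \<beta> s \<longleftrightarrow> \<theta> t \<le> s" "\<And>s. \<theta> (\<beta> s) = s" "\<And>t. \<beta> (\<theta> t) = t"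
    using increasing_homeomorphism_inverse[of 1 \<theta>] slope(1) cont by auto
  have "mono \<beta>" by (rule monoI) (meson b(1,2) order_refl order_trans)
  then have [measurable]: "\<beta> \<in> borel_measurable borel" by (rule borel_measurable_mono)
  define N where "N = distr lborel borel \<beta>"
  have "absolutely_continuous lborel N"
    unfolding absolutely_continuous_def
  proof
    fix A assume A: "A \<in> null_sets (lborel :: real measure)"
    then have [measurable]: "A \<in> sets borel" by auto
    have "negligible A" using A by (simp add: negligible_iff_null_sets null_sets_completionI)
    then have "negligible (\<theta> ` A)"
      using lipth by (intro negligible_locally_Lipschitz_image) (auto intro!: exI[of _ UNIV] exI[of _ "2 * R + 1"])
    moreover have img: "\<theta> ` A = \<beta> -` A" 
    proof (intro equalityI subsetI)
      fix s assume "s \<in> \<beta> -` A"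
      then show "s \<in> \<theta> ` A" using b(3)[of s] by (intro image_eqI[of s \<theta> "\<beta> s"]) auto
    qed (use b(4) in auto)
    moreover have "\<beta> -` A \<in> sets borel" using measurable_sets[of \<beta> borel borel A] by simp
    ultimately have "emeasure lborel (\<beta> -` A) = 0"
      by (simp add: negligible_iff_null_sets null_sets_def)
    then show "A \<in> null_sets N" by (simp add: null_sets_def N_def emeasure_distr)
  qed
  then obtain w where w [measurable]: "w \<in> borel_measurable borel" and N: "density lborel w = N"
    using sigma_finite_measure.Radon_Nikodym[OF sigma_finite_lborel, of N] by (auto simp: N_def)
  have emN: "(\<integral>\<^sup>+t. w t * indicator {p..q} t \<partial>lborel) = ennreal (\<theta> q - \<theta> p)" if "p \<le> q" for p q
  proof -
    have "(\<integral>\<^sup>+t. w t * indicator {p..q} t \<partial>lborel) = emeasure N {p..q}"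
      unfolding N[symmetric] by (simp add: emeasure_density)
    also have "\<dots> = emeasure lborel (\<beta> -` {p..q})" by (simp add: N_def emeasure_distr)
    also have "\<beta> -` {p..q} = {\<theta> p..\<theta> q}" using b(1,2) by auto
    finally show ?thesis using slope(1)[OF that] that by simp
  qed
  have int: "((\<lambda>t. enn2real (w t)) has_integral \<theta> q - \<theta> p) {p..q}" if pq: "p \<le> q" for p q
  proof -
    have "AE t in lborel. w t * indicator {p..q} t \<noteq> \<infinity>"
      using emN[OF pq] by (intro nn_integral_PInf_AE) auto
    then have "(\<integral>\<^sup>+t. ennreal (enn2real (w t) * indicator {p..q} t) \<partial>lborel) = (\<integral>\<^sup>+t. w t * indicator {p..q} t \<partial>lborel)"
      by (intro nn_integral_cong_AE) (auto elim!: eventually_mono simp: indicator_def less_top split: if_splits)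
    then have "((\<lambda>t. enn2real (w t) * indicator {p..q} t) has_integral \<theta> q - \<theta> p) UNIV"
      using emN[OF pq] slope(1)[OF pq] pq by (intro nn_integral_has_integral) auto
    also have "(\<lambda>t. enn2real (w t) * indicator {p..q} t) = (\<lambda>t. if t \<in> {p..q} then enn2real (w t) else 0)"
      by (auto simp: indicator_def)
    finally show ?thesis by (simp only: has_integral_restrict_UNIV)
  qed
  have "((\<lambda>t. enn2real (w t) - (R + 1)) has_integral G b - G a) {a..b}" if "a \<le> b" for a b
  proof -
    have "((\<lambda>t. R + 1) has_integral (b - a) *\<^sub>R (R + 1)) {a..b}"
      using has_integral_const_real[of "R + 1" a b] that by simp
    from has_integral_diff[OF int[OF that] this] show ?thesis
      by (simp add: \<theta>_def algebra_simps)
  qed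
  then show ?thesis by (intro bexI[of _ "\<lambda>t. enn2real (w t) - (R + 1)"]) auto
qed

text \<open>Component densities carry no bound on the norm of the vector. The bound is read off from
  difference quotients at points of differentiability; on the null set of remaining points the
  density is reset to 0 where it is too large.\<close>

lemma lipschitz_density:
  fixes U :: "real \<Rightarrow> real^'m::finite"
  assumes lip: "\<And>a b. norm (U b - U a) \<le> R * \<bar>b - a\<bar>"
  shows "\<exists>u\<in>borel_measurable borel. (\<forall>s. norm (u s) \<le> R) \<and> (\<forall>a b. a \<le> b \<longrightarrow> (u has_integral U b - U a) {a..b})"
proof -
  have R: "R \<ge> 0" using order_trans[OF norm_ge_zero lip[of 1 0]] by simp
  have "\<exists>v\<in>borel_measurable borel. \<forall>a b. a \<le> b \<longrightarrow> (v has_integral U b $ i - U a $ i) {a..b}" for i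
  proof (rule lipschitz_real_density)
    show "\<bar>U b $ i - U a $ i\<bar> \<le> R * \<bar>b - a\<bar>" for a b
      using order_trans[OF component_le_norm_cart[of "U b - U a" i] lip[of b a]] by simp
  qed
  then obtain v where v: "\<And>i. v i \<in> borel_measurable borel"
    "\<And>i a b. a \<le> b \<Longrightarrow> (v i has_integral U b $ i - U a $ i) {a..b}" by metis
  define u0 :: "real \<Rightarrow> real^'m" where "u0 s = (\<chi> i. v i s)" for s
  have vec: "x = (\<Sum>i\<in>UNIV. (x $ i) *\<^sub>R axis i 1)" for x :: "real^'m"
    by (auto simp: vec_eq_iff axis_def if_distrib cong: if_cong)
  have u0_eq: "u0 = (\<lambda>s. \<Sum>i\<in>UNIV. v i s *\<^sub>R axis i 1)"
  proof
    fix s show "u0 s = (\<Sum>i\<in>UNIV. v i s *\<^sub>R axis i 1)" using vec[of "u0 s"] by (simp add: u0_def)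
  qed
  note [measurable] = v(1)
  have u0m [measurable]: "u0 \<in> borel_measurable borel" unfolding u0_eq by measurable
  have u0i: "(u0 has_integral U b - U a) {a..b}" if "a \<le> b" for a b
  proof -
    have "(u0 has_integral (\<Sum>i\<in>UNIV. (U b $ i - U a $ i) *\<^sub>R axis i 1)) {a..b}"
      unfolding u0_eq by (intro has_integral_sum has_integral_scaleR_left v that) auto
    then show ?thesis using vec[of "U b - U a"] by simp
  qed
  obtain N where N: "negligible N" "\<And>s. s \<notin> N \<Longrightarrow> (U has_vector_derivative u0 s) (at s)"
    using lebesgue_differentiation[OF u0i] by blast
  have bound: "norm (u0 s) \<le> R" if "s \<notin> N" for s
  proof -
    have D: "(U has_derivative (\<lambda>h. h *\<^sub>R u0 s)) (at s)"
      using N(2)[OF that] unfolding has_vector_derivative_def .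
    show ?thesis
    proof (rule field_le_epsilon)
      fix e :: real assume "e > 0"
      then obtain d where d: "d > 0" "\<And>y. norm (y - s) < d \<Longrightarrow> norm (U y - U s - (y - s) *\<^sub>R u0 s) \<le> e * norm (y - s)"
        using D unfolding has_derivative_at_alt by blast
      have "norm ((d / 2) *\<^sub>R u0 s) \<le> norm (U (s + d / 2) - U s) + norm (U (s + d / 2) - U s - (d / 2) *\<^sub>R u0 s)"
        by (metis norm_minus_commute norm_triangle_sub)
      also have "\<dots> \<le> R * (d / 2) + e * (d / 2)"
        using lip[of "s + d / 2" s] d(2)[of "s + d / 2"] d(1) by (intro add_mono) auto
      finally have "(d / 2) * norm (u0 s) \<le> (d / 2) * (R + e)" using d(1) by (simp add: algebra_simps)
      then show "norm (u0 s) \<le> R + e" using d(1) by simp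
    qed
  qed
  define u where "u s = (if norm (u0 s) \<le> R then u0 s else 0)" for s
  have "u \<in> borel_measurable borel" unfolding u_def by measurable
  moreover have "norm (u s) \<le> R" for s using R by (simp add: u_def)
  moreover have "(u has_integral U b - U a) {a..b}" if "a \<le> b" for a b
    by (rule has_integral_spike[OF N(1) _ u0i[OF that]]) (use bound in \<open>auto simp: u_def\<close>)
  ultimately show ?thesis by blast
qed

section \<open>Weak limits and convergent subsequences\<close>

lemma bounded_borel_set_integrable:
  fixes g :: "real \<Rightarrow> 'b::euclidean_space"
  assumes g: "g \<in> borel_measurable borel" and B: "\<And>s. s \<in> {a..b} \<Longrightarrow> norm (g s) \<le> B"
  shows "set_integrable lborel {a..b} g"
  unfolding set_integrable_def
proof (rule Bochner_Integration.integrable_bound[where f = "\<lambda>s. \<bar>B\<bar> * indicator {a..b} s"])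
  show "integrable lborel (\<lambda>s. \<bar>B\<bar> * indicator {a..b} s)" by (intro integrable_mult_right integrable_real_indicator) (auto simp: emeasure_lborel_Icc_eq)
  show "(\<lambda>x. indicator {a..b} x *\<^sub>R g x) \<in> borel_measurable lborel" using g by measurable
  show "AE x in lborel. norm (indicator {a..b} x *\<^sub>R g x) \<le> norm (\<bar>B\<bar> * indicator {a..b} x :: real)"
  proof (rule AE_I2)
    fix x show "norm (indicator {a..b} x *\<^sub>R g x) \<le> norm (\<bar>B\<bar> * indicator {a..b} x :: real)"
      using B[of x] by (auto simp: indicator_def)
  qed
qed

lemmas bounded_borel_integrable = set_borel_integral_eq_integral(1)[OF bounded_borel_set_integrable]

text \<open>This is \<open>weak_null\<close> for Lebesgue measure restricted to {a..b}: integrals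
  over half-lines become integrals of \<open>d n\<close> over subintervals.\<close>

lemma weak_limit_integral:
  fixes d :: "nat \<Rightarrow> real \<Rightarrow> real"
  assumes d: "\<And>n. d n \<in> borel_measurable borel" and R: "\<And>n x. \<bar>d n x\<bar> \<le> R"
    and lim: "\<And>p q. p \<le> q \<Longrightarrow> (\<lambda>n. integral {p..q} (d n)) \<longlonglongrightarrow> 0"
    and \<phi>: "\<phi> \<in> borel_measurable borel" "\<And>s. s \<in> {a..b} \<Longrightarrow> \<bar>\<phi> s\<bar> \<le> K"
  shows "(\<lambda>n. integral {a..b} (\<lambda>s. \<phi> s * d n s)) \<longlonglongrightarrow> 0"
proof -
  define M where "M = density lborel (indicator {a..b} :: real \<Rightarrow> ennreal)"
  have M: "M = density lborel (\<lambda>s. ennreal (indicator {a..b} s))" by (simp add: M_def ennreal_indicator)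
  note [measurable] = d \<phi>(1)
  have fin: "finite_measure M"
    by (rule finite_measureI) (simp add: M_def emeasure_density nn_integral_indicator emeasure_lborel_Icc_eq)
  have intM: "(\<integral>s. g s \<partial>M) = integral {a..b} g" if g: "g \<in> borel_measurable borel" and B: "\<And>s. s \<in> {a..b} \<Longrightarrow> \<bar>g s\<bar> \<le> B" for g :: "real \<Rightarrow> real" and B
  proof -
    have "(\<integral>s. g s \<partial>M) = (\<integral>s. indicator {a..b} s *\<^sub>R g s \<partial>lborel)"
      unfolding M using g by (subst integral_density) auto
    then show ?thesis
      using set_borel_integral_eq_integral(2)[OF bounded_borel_set_integrable[of g a b B]] g B by (simp add: set_lebesgue_integral_def)
  qed
  have R0: "R \<ge> 0" using order_trans[OF abs_ge_zero R] .
  have "(\<lambda>n. \<integral>s. \<phi> s * d n s \<partial>M) \<longlonglongrightarrow> 0"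
  proof (rule weak_null[OF fin _ d R])
    show "sets M = sets borel" by (simp add: M_def)
    show "integrable M \<phi>"
      unfolding M using bounded_borel_set_integrable[OF \<phi>(1), of a b K] \<phi>(2)
      by (subst integrable_density) (auto simp: set_integrable_def)
    show "(\<lambda>n. \<integral>x. d n x \<partial>M) \<longlonglongrightarrow> 0"
      using lim[of a b] intM[OF d R] by (cases "a \<le> b") auto
    fix c
    have "(\<integral>x. indicator {..c} x * d n x \<partial>M) = integral {a..min b c} (d n)" for n
    proof -
      have "(\<integral>x. indicator {..c} x * d n x \<partial>M) = integral {a..b} (\<lambda>x. indicator {..c} x * d n x)"
        by (rule intM[where B = R]) (use R R0 in \<open>auto simp: indicator_def\<close>)
      also have "\<dots> = integral {a..b} (\<lambda>x. if x \<in> {..c} then d n x else 0)"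
        by (intro Henstock_Kurzweil_Integration.integral_cong) (auto simp: indicator_def)
      also have "\<dots> = integral ({..c} \<inter> {a..b}) (d n)" by (rule integral_restrict_Int)
      also have "{..c} \<inter> {a..b} = {a..min b c}" by auto
      finally show ?thesis .
    qed
    then show "(\<lambda>n. \<integral>x. indicator {..c} x * d n x \<partial>M) \<longlonglongrightarrow> 0"
      using lim[of a "min b c"] by (cases "a \<le> min b c") auto
  qed
  moreover have "(\<integral>s. \<phi> s * d n s \<partial>M) = integral {a..b} (\<lambda>s. \<phi> s * d n s)" for n
  proof (rule intM[where B = "K * R"])
    show "\<bar>\<phi> s * d n s\<bar> \<le> K * R" if "s \<in> {a..b}" for s
      using mult_mono[OF \<phi>(2)[OF that] R[of n s]] \<phi>(2)[OF that] order_trans[OF abs_ge_zero \<phi>(2)[OF that]] by (simp add: abs_mult)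
  qed measurable
  ultimately show ?thesis by simp
qed

text \<open>Arzela-Ascoli on the whole line, in pointwise form. The values at rational times lie in
  a product of balls, compact by Tychonoff and sequentially compact because the index set is
  countable; the common Lipschitz constant turns convergence at rational times into Cauchy sequences
  at every real time.\<close>

lemma equi_lipschitz_subsequence:
  fixes F :: "nat \<Rightarrow> real \<Rightarrow> 'a::euclidean_space"
  assumes lip: "\<And>n s t. norm (F n t - F n s) \<le> C * \<bar>t - s\<bar>" and B: "\<And>n. norm (F n 0) \<le> B"
  shows "\<exists>r G. strict_mono r \<and> (\<forall>t. (\<lambda>n. F (r n) t) \<longlonglongrightarrow> G t)"
proof -
  have C: "C \<ge> 0" using order_trans[OF norm_ge_zero lip[of 0 1 0]] by simp
  define \<Phi> :: "nat \<Rightarrow> rat \<Rightarrow> 'a" where "\<Phi> n q = F n (of_rat q)" for n q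
  define K :: "(rat \<Rightarrow> 'a) set" where "K = PiE UNIV (\<lambda>q. cball 0 (B + C * \<bar>of_rat q\<bar>))"
  have "compactin (product_topology (\<lambda>_::rat. euclidean :: 'a topology) UNIV) K"
    unfolding K_def compactin_PiE by auto
  then have "compact K" by (simp add: euclidean_product_topology flip: compactin_euclidean_iff)
  then have "seq_compact K" by (simp add: compact_imp_seq_compact)
  moreover have "\<Phi> n \<in> K" for n
  proof -
    have "norm (F n t) \<le> B + C * \<bar>t\<bar>" for t
      using norm_triangle_sub[of "F n t" "F n 0"] lip[of n t 0] B[of n] by simp
    then have "\<Phi> n q \<in> cball 0 (B + C * \<bar>of_rat q\<bar>)" for q
      by (simp only: mem_cball_0 \<Phi>_def)
    then show ?thesis unfolding K_def by (intro PiE_I) blast+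
  qed
  ultimately obtain l r where r: "strict_mono r" and l: "(\<Phi> \<circ> r) \<longlonglongrightarrow> l"
    unfolding seq_compact_def by metis
  have ql: "(\<lambda>n. F (r n) (of_rat q)) \<longlonglongrightarrow> l q" for q
  proof -
    have "continuous_on UNIV (\<lambda>x :: rat \<Rightarrow> 'a. x q)" by (rule continuous_on_product_coordinates)
    then have "isCont (\<lambda>x :: rat \<Rightarrow> 'a. x q) l" by (rule continuous_on_interior) simp
    from isCont_tendsto_compose[OF this l] show ?thesis by (simp add: \<Phi>_def comp_def)
  qed
  have "\<exists>y. (\<lambda>n. F (r n) t) \<longlonglongrightarrow> y" for t
  proof -
    have "Cauchy (\<lambda>n. F (r n) t)"
    proof (rule metric_CauchyI)
      fix e :: real assume e: "e > 0"
      define \<delta> where "\<delta> = e / 3 / (C + 1)"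
      have \<delta>: "\<delta> > 0" using e C by (simp add: \<delta>_def)
      obtain q where q: "t < of_rat q" "of_rat q < t + \<delta>" using of_rat_dense[of t "t + \<delta>"] \<delta> by auto
      have "C * \<bar>t - of_rat q\<bar> \<le> C * \<delta>" using q C by (intro mult_left_mono) auto
      also have "\<dots> < e / 3"
      proof -
        have "C * \<delta> < (C + 1) * \<delta>" using \<delta> by simp
        also have "\<dots> = e / 3"
          unfolding \<delta>_def mult.commute[of "C + 1"]
          by (rule nonzero_eq_divide_eq[THEN iffD1, OF _ refl]) (use C in simp)
        finally show ?thesis .
      qed
      finally have near: "dist (F n t) (F n (of_rat q)) < e / 3" for n
        using lip[of n t "of_rat q"] by (simp add: dist_norm)
      from metric_CauchyD[OF LIMSEQ_imp_Cauchy[OF ql], of "e / 3" q] e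
      obtain M where M: "\<And>m n. m \<ge> M \<Longrightarrow> n \<ge> M \<Longrightarrow> dist (F (r m) (of_rat q)) (F (r n) (of_rat q)) < e / 3"
        by auto
      show "\<exists>M. \<forall>m\<ge>M. \<forall>n\<ge>M. dist (F (r m) t) (F (r n) t) < e"
      proof (intro exI allI impI)
        fix m n assume mn: "m \<ge> M" "n \<ge> M"
        have "dist (F (r m) t) (F (r n) t) \<le> dist (F (r m) t) (F (r m) (of_rat q)) + dist (F (r m) (of_rat q)) (F (r n) (of_rat q)) + dist (F (r n) (of_rat q)) (F (r n) t)"
          by (meson add_mono_thms_linordered_semiring(3) dist_triangle order_trans add_right_mono)
        also have "\<dots> < e"
          using near[of "r m"] near[of "r n"] M[OF mn] by (simp add: dist_commute)
        finally show "dist (F (r m) t) (F (r n) t) < e" .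
      qed
    qed
    then show ?thesis using Cauchy_convergent convergent_def by blast
  qed
  then obtain G where "\<And>t. (\<lambda>n. F (r n) t) \<longlonglongrightarrow> G t" by metis
  then show ?thesis using r by blast
qed

text \<open>An oriented integral from 0: for each sign of t one of the two terms vanishes.\<close>

definition primitive :: "(real \<Rightarrow> 'a::banach) \<Rightarrow> real \<Rightarrow> 'a" where
  "primitive u t = integral {0..t} u - integral {t..0} u"

lemma primitive_has_integral:
  assumes int: "\<And>a b. u integrable_on {a..b}" and ab: "a \<le> b"
  shows "(u has_integral primitive u b - primitive u a) {a..b}"
proof -
  have c: "integral {p..q} u + integral {q..r} u = integral {p..r} u" if "p \<le> q" "q \<le> r" for p q r
    using that by (intro Henstock_Kurzweil_Integration.integral_combine int)
  have z: "integral {t..0} u = 0" if "t \<ge> 0" for t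
    using that by (cases "t = 0") auto
  have z': "integral {0..t} u = 0" if "t \<le> 0" for t
    using that by (cases "t = 0") auto
  consider "0 \<le> a" | "b \<le> 0" | "a \<le> 0" "0 \<le> b" by linarith
  then have "primitive u b - primitive u a = integral {a..b} u"
  proof cases
    case 1 then show ?thesis using c[of 0 a b] z[of a] z[of b] ab by (simp add: primitive_def algebra_simps)
  next
    case 2 then show ?thesis using c[of a b 0] z'[of a] z'[of b] ab by (simp add: primitive_def algebra_simps)
  next
    case 3 then show ?thesis using c[of a 0 b] z'[of a] z[of b] ab by (simp add: primitive_def algebra_simps)
  qed
  then show ?thesis using int integrable_integral by metis
qed

section \<open>Compactness and lower semicontinuity\<close>

lemma has_integral_vec_nth:
  fixes h :: "real \<Rightarrow> real^'n"
  shows "(h has_integral I) S \<Longrightarrow> ((\<lambda>s. h s $ i) has_integral I $ i) S"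
  using has_integral_linear[OF _ bounded_linear_vec_nth[of i], of h I S] by (simp add: comp_def)

text \<open>Convexity in the control is stated through a continuous choice of subgradients
  \<open>Lu\<close>: the supporting inequality is the form in which both lower semicontinuity and
  the cost of a change of speed use it.\<close>

locale lagrangian_system = control_system f
  for f :: "'m::finite \<Rightarrow> real^'d \<Rightarrow> real^'d" +
  fixes L :: "real^'d \<Rightarrow> real^'m \<Rightarrow> real" and Lu :: "real^'d \<Rightarrow> real^'m \<Rightarrow> real^'m"
    and K1 K2 \<sigma> :: real
  assumes periodic_L: "periodic L"
    and continuous_L: "continuous_on UNIV (\<lambda>(x, u). L x u)"
    and continuous_Lu: "continuous_on UNIV (\<lambda>(x, u). Lu x u)"
    and subgradient: "L x v \<ge> L x u + Lu x u \<bullet> (v - u)"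
    and K1: "K1 > 0" and \<sigma>: "\<sigma> > 1" and coercive: "L x u \<ge> K1 * norm u powr \<sigma> - K2"
begin

lemma borel_pair:
  fixes h :: "real^'d \<Rightarrow> real^'m \<Rightarrow> 'b::topological_space"
  assumes h: "continuous_on UNIV (\<lambda>(x, u). h x u)" and g: "\<gamma> \<in> borel_measurable borel" and u: "u \<in> borel_measurable borel"
  shows "(\<lambda>s. h (\<gamma> s) (u s)) \<in> borel_measurable borel"
proof -
  have "(\<lambda>p. h (fst p) (snd p)) \<in> borel_measurable borel"
    using h by (intro borel_measurable_continuous_onI) (simp add: case_prod_unfold)
  moreover have "(\<lambda>s. (\<gamma> s, u s)) \<in> borel_measurable borel" using g u by (rule borel_measurable_Pair)
  ultimately show ?thesis using measurable_compose[of "\<lambda>s. (\<gamma> s, u s)" borel borel "\<lambda>p. h (fst p) (snd p)"] by simp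
qed

lemma L_bounded: "\<exists>M\<ge>0. \<forall>x u. norm u \<le> R \<longrightarrow> \<bar>L x u\<bar> \<le> M"
proof -
  have "compact ((\<lambda>(x, u). L x u) ` (cbox 0 1 \<times> cball 0 R))"
    by (intro compact_continuous_image continuous_on_subset[OF continuous_L] compact_Times) auto
  then obtain M where M: "\<And>x u. x \<in> cbox 0 1 \<Longrightarrow> u \<in> cball 0 R \<Longrightarrow> \<bar>L x u\<bar> \<le> M"
    using compact_imp_bounded bounded_iff by (metis (mono_tags, lifting) SigmaI case_prod_conv image_eqI real_norm_def)
  have "\<bar>L x u\<bar> \<le> \<bar>M\<bar>" if "norm u \<le> R" for x u
  proof -
    obtain y where y: "y \<in> cbox 0 1" "L x = L y" using periodic_eq_frac[OF periodic_L, of x] by blast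
    then show ?thesis using M[OF y(1), of u] that by auto
  qed
  then show ?thesis by (intro exI[of _ "\<bar>M\<bar>"]) auto
qed

lemma traj_measurable:
  assumes "bounded_traj f R \<gamma> u"
  shows "\<gamma> \<in> borel_measurable borel" "u \<in> borel_measurable borel"
  using assms bounded_traj_continuous[OF assms, of UNIV] borel_measurable_continuous_onI by (auto simp: bounded_traj_def)

definition act :: "(real \<Rightarrow> real^'d) \<Rightarrow> (real \<Rightarrow> real^'m) \<Rightarrow> real \<Rightarrow> real \<Rightarrow> real" where
  "act \<gamma> u a b = integral {a..b} (\<lambda>s. L (\<gamma> s) (u s))"

lemma L_integrable:
  assumes "bounded_traj f R \<gamma> u"
  shows "(\<lambda>s. L (\<gamma> s) (u s)) integrable_on {a..b}"
proof -
  obtain M where M: "\<And>x u. norm u \<le> R \<Longrightarrow> \<bar>L x u\<bar> \<le> M" using L_bounded by blast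
  show ?thesis
    by (rule bounded_borel_integrable[where B = M])
       (use assms M in \<open>auto intro!: borel_pair continuous_L traj_measurable[OF assms] simp: bounded_traj_def\<close>)
qed

text \<open>The curves and the primitives of the controls converge together along one subsequence.
  The limit of the primitives is Lipschitz, and its density \<open>v\<close> is the weak limit of
  the controls. The velocity is linear in the control, so \<open>v\<close> drives the limit curve;
  the Lagrangian is only convex in it, so the action is merely lower semicontinuous.\<close>

lemma bounded_traj_compact:
  fixes \<gamma> :: "nat \<Rightarrow> real \<Rightarrow> real^'d" and u :: "nat \<Rightarrow> real \<Rightarrow> real^'m"
  assumes traj: "\<And>n. bounded_traj f R (\<gamma> n) (u n)" and B: "\<And>n. norm (\<gamma> n 0) \<le> B"
  shows "\<exists>r \<gamma>' u'. strict_mono r \<and> bounded_traj f R \<gamma>' u' \<and> (\<forall>s. (\<lambda>n. \<gamma> (r n) s) \<longlonglongrightarrow> \<gamma>' s) \<and>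
    (\<forall>a b \<epsilon>. a \<le> b \<and> \<epsilon> > 0 \<longrightarrow> (\<forall>\<^sub>F n in sequentially. act \<gamma>' u' a b - \<epsilon> \<le> act (\<gamma> (r n)) (u (r n)) a b))"
proof -
  have R: "R \<ge> 0" using traj[of 0] norm_ge_zero order_trans unfolding bounded_traj_def by blast
  have um [measurable]: "u n \<in> borel_measurable borel" for n using traj_measurable[OF traj] by blast
  have uR: "norm (u n s) \<le> R" for n s using traj by (simp add: bounded_traj_def)
  have ui: "u n integrable_on {a..b}" for n a b
    by (rule bounded_borel_integrable[OF um]) (rule uR)
  define U where "U n = primitive (u n)" for n
  have U: "(u n has_integral U n b - U n a) {a..b}" if "a \<le> b" for n a b
    unfolding U_def by (rule primitive_has_integral[OF ui that])
  have Ulip: "norm (U n b - U n a) \<le> R * \<bar>b - a\<bar>" for n a b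
  proof -
    have *: "norm (U n b - U n a) \<le> R * (b - a)" if "a \<le> b" for a b
      using has_integral_bound[OF R, of "u n" "U n b - U n a" a b] U[OF that, of n] uR that by (simp add: content_real)
    show ?thesis using *[of a b] *[of b a] by (cases "a \<le> b") (auto simp: norm_minus_commute)
  qed
  have "\<exists>r G. strict_mono r \<and> (\<forall>t. (\<lambda>n. (\<gamma> (r n) t, U (r n) t)) \<longlonglongrightarrow> G t)"
  proof (rule equi_lipschitz_subsequence[where C = "speed * R + R" and B = B])
    fix n s t
    have "norm ((\<gamma> n t, U n t) - (\<gamma> n s, U n s)) \<le> norm (\<gamma> n t - \<gamma> n s) + norm (U n t - U n s)"
      using norm_Pair_le[of "\<gamma> n t - \<gamma> n s" "U n t - U n s"] by simp
    then show "norm ((\<gamma> n t, U n t) - (\<gamma> n s, U n s)) \<le> (speed * R + R) * \<bar>t - s\<bar>"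
      using bounded_traj_lipschitz[OF traj, of n t s] Ulip[of n t s] by (simp add: distrib_right)
    show "norm (\<gamma> n 0, U n 0) \<le> B" using B by (simp add: U_def primitive_def norm_Pair)
  qed
  then obtain r G where r: "strict_mono r" and G: "\<And>t. (\<lambda>n. (\<gamma> (r n) t, U (r n) t)) \<longlonglongrightarrow> G t" by blast
  define g where "g t = fst (G t)" for t
  define V where "V t = snd (G t)" for t
  have gl: "(\<lambda>n. \<gamma> (r n) t) \<longlonglongrightarrow> g t" and Vl: "(\<lambda>n. U (r n) t) \<longlonglongrightarrow> V t" for t
    using tendsto_fst[OF G[of t]] tendsto_snd[OF G[of t]] by (simp_all add: g_def V_def)
  have "norm (V b - V a) \<le> R * \<bar>b - a\<bar>" for a b
    by (rule LIMSEQ_le_const2[OF tendsto_norm[OF tendsto_diff[OF Vl Vl]]]) (use Ulip in blast)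
  from lipschitz_density[OF this] obtain v where vm [measurable]: "v \<in> borel_measurable borel"
    and vR: "\<And>s. norm (v s) \<le> R" and v: "\<And>a b. a \<le> b \<Longrightarrow> (v has_integral V b - V a) {a..b}" by blast
  have glip: "norm (g t - g s) \<le> speed * R * \<bar>t - s\<bar>" for s t
    by (rule LIMSEQ_le_const2[OF tendsto_norm[OF tendsto_diff[OF gl gl]]]) (use bounded_traj_lipschitz[OF traj] in blast)
  have gc: "continuous_on UNIV g"
    using glip R speed(1) by (intro lipschitz_on_continuous_on[of "speed * R"] lipschitz_onI) (auto simp: dist_norm)
  then have gm [measurable]: "g \<in> borel_measurable borel" by (rule borel_measurable_continuous_onI)
  \<comment> \<open>Convergence of the primitives makes the integrals of the differences over
    intervals vanish, hence also those against bounded Borel weights.\<close>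
  have weak: "(\<lambda>n. integral {a..b} (\<lambda>s. \<phi> s * ((u (r n) s - v s) $ i))) \<longlonglongrightarrow> 0"
    if "\<phi> \<in> borel_measurable borel" "\<And>s. s \<in> {a..b} \<Longrightarrow> \<bar>\<phi> s\<bar> \<le> K" for \<phi> K a b i
  proof (rule weak_limit_integral[where R = "2 * R", OF _ _ _ that])
    show "(\<lambda>s. (u (r n) s - v s) $ i) \<in> borel_measurable borel" for n
      by (rule borel_measurable_continuous_onI[THEN measurable_compose[rotated]]) (auto intro!: continuous_intros)
    show "\<bar>(u (r n) s - v s) $ i\<bar> \<le> 2 * R" for n s
      using component_le_norm_cart[of "u (r n) s - v s" i] norm_triangle_ineq4[of "u (r n) s" "v s"] uR[of "r n" s] vR[of s] by linarith
    fix p q :: real assume pq: "p \<le> q"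
    have "integral {p..q} (\<lambda>s. (u (r n) s - v s) $ i) = ((U (r n) q - U (r n) p) - (V q - V p)) $ i" for n
      using has_integral_vec_nth[OF has_integral_diff[OF U[OF pq, of "r n"] v[OF pq]], of i] by (simp add: integral_unique)
    moreover have "(\<lambda>n. ((U (r n) q - U (r n) p) - (V q - V p)) $ i) \<longlonglongrightarrow> ((V q - V p) - (V q - V p)) $ i"
      by (intro tendsto_intros Vl)
    ultimately show "(\<lambda>n. integral {p..q} (\<lambda>s. (u (r n) s - v s) $ i)) \<longlonglongrightarrow> 0" by simp
  qed
  have weak_inner: "(\<lambda>n. integral {a..b} (\<lambda>s. \<psi> s \<bullet> (u (r n) s - v s))) \<longlonglongrightarrow> 0"
    and weak_inner_int: "\<And>n. (\<lambda>s. \<psi> s \<bullet> (u (r n) s - v s)) integrable_on {a..b}"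
    if \<psi>: "\<psi> \<in> borel_measurable borel" "\<And>s. s \<in> {a..b} \<Longrightarrow> norm (\<psi> s) \<le> K" for \<psi> :: "real \<Rightarrow> real^'m" and K a b
  proof -
    note [measurable] = \<psi>(1)
    have pm: "(\<lambda>s. \<psi> s $ i) \<in> borel_measurable borel" for i
      by (rule borel_measurable_continuous_onI[THEN measurable_compose[rotated]]) (auto intro!: continuous_intros)
    have pK: "\<bar>\<psi> s $ i\<bar> \<le> K" if "s \<in> {a..b}" for s i
      using component_le_norm_cart[of "\<psi> s" i] \<psi>(2)[OF that] by linarith
    have dm: "(\<lambda>s. (u (r n) s - v s) $ i) \<in> borel_measurable borel" for n i
      by (rule borel_measurable_continuous_onI[THEN measurable_compose[rotated]]) (auto intro!: continuous_intros)
    have dR: "\<bar>(u (r n) s - v s) $ i\<bar> \<le> 2 * R" for n s i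
      using component_le_norm_cart[of "u (r n) s - v s" i] norm_triangle_ineq4[of "u (r n) s" "v s"] uR[of "r n" s] vR[of s] by linarith
    have int: "(\<lambda>s. \<psi> s $ i * ((u (r n) s - v s) $ i)) integrable_on {a..b}" for n i
    proof (rule bounded_borel_integrable[where B = "K * (2 * R)"])
      show "(\<lambda>s. \<psi> s $ i * ((u (r n) s - v s) $ i)) \<in> borel_measurable borel" using pm dm by (intro borel_measurable_times)
      show "norm (\<psi> s $ i * ((u (r n) s - v s) $ i)) \<le> K * (2 * R)" if "s \<in> {a..b}" for s
        unfolding real_norm_def abs_mult using pK[OF that] dR order_trans[OF abs_ge_zero pK[OF that]] by (intro mult_mono) auto
    qed
    have eq: "\<psi> s \<bullet> (u (r n) s - v s) = (\<Sum>i\<in>UNIV. \<psi> s $ i * ((u (r n) s - v s) $ i))" for n s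
      by (simp add: inner_vec_def)
    show "(\<lambda>s. \<psi> s \<bullet> (u (r n) s - v s)) integrable_on {a..b}" for n
      unfolding eq by (intro integrable_sum int) auto
    have "integral {a..b} (\<lambda>s. \<psi> s \<bullet> (u (r n) s - v s)) = (\<Sum>i\<in>UNIV. integral {a..b} (\<lambda>s. \<psi> s $ i * ((u (r n) s - v s) $ i)))" for n
      unfolding eq by (intro Henstock_Kurzweil_Integration.integral_sum int) auto
    moreover have "(\<lambda>n. \<Sum>i\<in>UNIV. integral {a..b} (\<lambda>s. \<psi> s $ i * ((u (r n) s - v s) $ i))) \<longlonglongrightarrow> (\<Sum>i\<in>(UNIV :: 'm set). 0)"
      by (intro tendsto_sum weak[OF pm pK]) auto
    ultimately show "(\<lambda>n. integral {a..b} (\<lambda>s. \<psi> s \<bullet> (u (r n) s - v s))) \<longlonglongrightarrow> 0" by simp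
  qed
  \<comment> \<open>The controls need not converge at any time, so only the state is replaced, with
    the same control in both terms; uniform continuity on a compact product makes the difference
    vanish.\<close>
  have uniform: "(\<lambda>n. h (\<gamma> (r n) s) (u (r n) s) - h (g s) (u (r n) s)) \<longlonglongrightarrow> 0"
    if h: "continuous_on UNIV (\<lambda>(x, u). h x u)" for h :: "real^'d \<Rightarrow> real^'m \<Rightarrow> real" and s
  proof -
    let ?K = "cball (g s) 1 \<times> cball (0 :: real^'m) R"
    have "uniformly_continuous_on ?K (\<lambda>(x, u). h x u)"
      by (intro compact_uniformly_continuous continuous_on_subset[OF h] compact_Times) auto
    show ?thesis
    proof (rule LIMSEQ_I)
      fix e :: real assume "e > 0"
      with \<open>uniformly_continuous_on ?K _\<close> obtain d where d: "d > 0"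
        "\<And>p q. p \<in> ?K \<Longrightarrow> q \<in> ?K \<Longrightarrow> dist q p < d \<Longrightarrow> dist ((\<lambda>(x, u). h x u) q) ((\<lambda>(x, u). h x u) p) < e"
        unfolding uniformly_continuous_on_def by blast
      have "min d 1 > 0" using d by simp
      from LIMSEQ_D[OF gl[of s] this] obtain n0 where n0: "\<And>n. n \<ge> n0 \<Longrightarrow> norm (\<gamma> (r n) s - g s) < min d 1" by blast
      show "\<exists>n0. \<forall>n\<ge>n0. norm (h (\<gamma> (r n) s) (u (r n) s) - h (g s) (u (r n) s) - 0) < e"
      proof (intro exI[of _ n0] allI impI)
        fix n assume n: "n \<ge> n0"
        have "dist ((\<lambda>(x, u). h x u) (\<gamma> (r n) s, u (r n) s)) ((\<lambda>(x, u). h x u) (g s, u (r n) s)) < e"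
          using n0[OF n] uR[of "r n" s] by (intro d) (auto simp: dist_norm norm_minus_commute dist_Pair_Pair)
        then show "norm (h (\<gamma> (r n) s) (u (r n) s) - h (g s) (u (r n) s) - 0) < e" by (simp add: dist_norm)
      qed
    qed
  qed
  have gap: "(\<lambda>n. integral {a..b} (\<lambda>s. h (\<gamma> (r n) s) (u (r n) s) - h (g s) (u (r n) s))) \<longlonglongrightarrow> 0"
    and gap_int: "\<And>n. (\<lambda>s. h (\<gamma> (r n) s) (u (r n) s) - h (g s) (u (r n) s)) integrable_on {a..b}"
    if h: "continuous_on UNIV (\<lambda>(x, u). h x u)" and M: "\<And>x w. norm w \<le> R \<Longrightarrow> \<bar>h x w\<bar> \<le> M" for h :: "real^'d \<Rightarrow> real^'m \<Rightarrow> real" and M a b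
  proof -
    have le: "norm (h (\<gamma> (r n) s) (u (r n) s) - h (g s) (u (r n) s)) \<le> 2 * M" for n s
      using M[OF uR[of "r n" s], of "\<gamma> (r n) s"] M[OF uR[of "r n" s], of "g s"] by simp
    show int: "(\<lambda>s. h (\<gamma> (r n) s) (u (r n) s) - h (g s) (u (r n) s)) integrable_on {a..b}" for n
      by (rule bounded_borel_integrable[OF _ le], intro borel_measurable_diff borel_pair[OF h] gm um)
         (rule traj_measurable[OF traj])
    have "(\<lambda>n. integral {a..b} (\<lambda>s. h (\<gamma> (r n) s) (u (r n) s) - h (g s) (u (r n) s))) \<longlonglongrightarrow> integral {a..b} (\<lambda>s. 0)"
      by (rule dominated_convergence(2)[where h = "\<lambda>_. 2 * M", OF int]) (use le uniform[OF h] in auto)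
    then show "(\<lambda>n. integral {a..b} (\<lambda>s. h (\<gamma> (r n) s) (u (r n) s) - h (g s) (u (r n) s))) \<longlonglongrightarrow> 0" by simp
  qed
  have "bounded_traj f R g v"
    unfolding bounded_traj_def
  proof (intro conjI allI impI vm vR)
    fix a b :: real assume ab: "a \<le> b"
    have Fi: "(\<lambda>s. Fmap f (g s) (v s)) integrable_on {a..b}"
    proof (rule bounded_borel_integrable[where B = "speed * R"])
      show "(\<lambda>s. Fmap f (g s) (v s)) \<in> borel_measurable borel" by (rule borel_pair[OF continuous_Fmap gm vm])
      show "norm (Fmap f (g s) (v s)) \<le> speed * R" for s
        using order_trans[OF speed(2) mult_left_mono[OF vR speed(1)]] .
    qed
    have "g b - g a = integral {a..b} (\<lambda>s. Fmap f (g s) (v s))"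
    proof (rule vec_eq_iff[THEN iffD2], rule allI)
      fix c
      let ?h = "\<lambda>x w. Fmap f x w $ c"
      have hc: "continuous_on UNIV (\<lambda>(x, w). ?h x w)"
        using continuous_Fmap unfolding case_prod_unfold by (intro continuous_intros)
      have hM: "\<bar>?h x w\<bar> \<le> speed * R" if "norm w \<le> R" for x w
        using component_le_norm_cart[of "Fmap f x w" c] order_trans[OF speed(2) mult_left_mono[OF that speed(1)], of x] by linarith
      define \<psi> :: "real \<Rightarrow> real^'m" where "\<psi> s = (\<chi> i. f i (g s) $ c)" for s
      have hin: "?h (g s) w = \<psi> s \<bullet> w" for s w
        by (simp add: Fmap_def \<psi>_def inner_vec_def mult.commute)
      have \<psi>c: "continuous_on UNIV \<psi>"
        unfolding \<psi>_def by (intro continuous_intros continuous_on_compose2[OF continuous_f[of UNIV] gc]) auto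
      have "compact (\<psi> ` {a..b})" by (intro compact_continuous_image continuous_on_subset[OF \<psi>c]) auto
      then obtain K where K: "\<And>s. s \<in> {a..b} \<Longrightarrow> norm (\<psi> s) \<le> K"
        using compact_imp_bounded bounded_iff by (metis imageI)
      note \<psi>m = borel_measurable_continuous_onI[OF \<psi>c]
      \<comment> \<open>Three terms: the error of replacing the state by its limit, the weak error
        of the control, and the integral for the limit pair. The first two tend to 0.\<close>
      have "(\<gamma> (r n) b - \<gamma> (r n) a) $ c = integral {a..b} (\<lambda>s. ?h (\<gamma> (r n) s) (u (r n) s) - ?h (g s) (u (r n) s))
          + integral {a..b} (\<lambda>s. \<psi> s \<bullet> (u (r n) s - v s)) + integral {a..b} (\<lambda>s. ?h (g s) (v s))" for n
      proof -
        have "((\<lambda>s. ?h (\<gamma> (r n) s) (u (r n) s)) has_integral (\<gamma> (r n) b - \<gamma> (r n) a) $ c) {a..b}"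
          using traj[of "r n"] ab by (intro has_integral_vec_nth) (auto simp: bounded_traj_def)
        then have eq1: "integral {a..b} (\<lambda>s. ?h (\<gamma> (r n) s) (u (r n) s)) = (\<gamma> (r n) b - \<gamma> (r n) a) $ c"
          by (rule integral_unique)
        have vi: "(\<lambda>s. ?h (g s) (v s)) integrable_on {a..b}"
          by (rule has_integral_integrable[OF has_integral_vec_nth[OF integrable_integral[OF Fi]]])
        have eq2: "(\<lambda>s. ?h (\<gamma> (r n) s) (u (r n) s)) = (\<lambda>s. (?h (\<gamma> (r n) s) (u (r n) s) - ?h (g s) (u (r n) s))
          + \<psi> s \<bullet> (u (r n) s - v s) + ?h (g s) (v s))"
          by (simp add: hin inner_diff_right)
        have iA: "(\<lambda>s. ?h (\<gamma> (r n) s) (u (r n) s) - ?h (g s) (u (r n) s)) integrable_on {a..b}"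
          by (rule gap_int[OF hc hM])
        have iB: "(\<lambda>s. \<psi> s \<bullet> (u (r n) s - v s)) integrable_on {a..b}"
          by (rule weak_inner_int[OF \<psi>m K])
        show ?thesis
          unfolding eq1[symmetric] by (subst eq2)
            (simp only: Henstock_Kurzweil_Integration.integral_add[OF integrable_add[OF iA iB] vi]
              Henstock_Kurzweil_Integration.integral_add[OF iA iB])
      qed
      moreover have "(\<lambda>n. integral {a..b} (\<lambda>s. ?h (\<gamma> (r n) s) (u (r n) s) - ?h (g s) (u (r n) s))
          + integral {a..b} (\<lambda>s. \<psi> s \<bullet> (u (r n) s - v s)) + integral {a..b} (\<lambda>s. ?h (g s) (v s)))
          \<longlonglongrightarrow> 0 + 0 + integral {a..b} (\<lambda>s. ?h (g s) (v s))"
        by (intro tendsto_add gap[OF hc hM] weak_inner[OF \<psi>m K] tendsto_const)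
      ultimately have "(\<lambda>n. (\<gamma> (r n) b - \<gamma> (r n) a) $ c) \<longlonglongrightarrow> integral {a..b} (\<lambda>s. ?h (g s) (v s))" by simp
      moreover have "(\<lambda>n. (\<gamma> (r n) b - \<gamma> (r n) a) $ c) \<longlonglongrightarrow> (g b - g a) $ c"
        by (intro tendsto_intros gl)
      ultimately have "(g b - g a) $ c = integral {a..b} (\<lambda>s. ?h (g s) (v s))" using LIMSEQ_unique by blast
      also have "\<dots> = integral {a..b} (\<lambda>s. Fmap f (g s) (v s)) $ c"
        by (rule integral_unique[OF has_integral_vec_nth[OF integrable_integral[OF Fi]]])
      finally show "(g b - g a) $ c = integral {a..b} (\<lambda>s. Fmap f (g s) (v s)) $ c" .
    qed
    then show "((\<lambda>s. Fmap f (g s) (v s)) has_integral g b - g a) {a..b}"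
      using integrable_integral[OF Fi] by simp
  qed
  moreover have "\<forall>\<^sub>F n in sequentially. act g v a b - \<epsilon> \<le> act (\<gamma> (r n)) (u (r n)) a b" if ab: "a \<le> b" and e: "\<epsilon> > 0" for a b \<epsilon>
  proof -
    obtain M where M: "\<And>x w. norm w \<le> R \<Longrightarrow> \<bar>L x w\<bar> \<le> M" using L_bounded by blast
    define \<psi> where "\<psi> s = Lu (g s) (v s)" for s
    have \<psi>m: "\<psi> \<in> borel_measurable borel" unfolding \<psi>_def by (rule borel_pair[OF continuous_Lu gm vm])
    have "compact ((\<lambda>(x, w). Lu x w) ` (g ` {a..b} \<times> cball 0 R))"
      by (intro compact_continuous_image continuous_on_subset[OF continuous_Lu] compact_Times continuous_on_subset[OF gc]) auto
    then obtain K where "\<And>y. y \<in> (\<lambda>(x, w). Lu x w) ` (g ` {a..b} \<times> cball 0 R) \<Longrightarrow> norm y \<le> K"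
      using compact_imp_bounded bounded_iff by metis
    then have K: "norm (\<psi> s) \<le> K" if "s \<in> {a..b}" for s
      using that vR[of s] unfolding \<psi>_def by force
    have Lv: "(\<lambda>s. L (g s) (v s)) integrable_on {a..b}"
      by (rule L_integrable) fact
    \<comment> \<open>The supporting hyperplane at the limit control \<open>v\<close> bounds the
      action from below by the limit action plus two errors of the kinds treated above.\<close>
    have "act (\<gamma> (r n)) (u (r n)) a b \<ge> act g v a b + integral {a..b} (\<lambda>s. L (\<gamma> (r n) s) (u (r n) s) - L (g s) (u (r n) s))
        + integral {a..b} (\<lambda>s. \<psi> s \<bullet> (u (r n) s - v s))" for n
    proof -
      have iA: "(\<lambda>s. L (\<gamma> (r n) s) (u (r n) s) - L (g s) (u (r n) s)) integrable_on {a..b}"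
        by (rule gap_int[OF continuous_L M])
      have iB: "(\<lambda>s. \<psi> s \<bullet> (u (r n) s - v s)) integrable_on {a..b}"
        by (rule weak_inner_int[OF \<psi>m K])
      have "act g v a b + integral {a..b} (\<lambda>s. L (\<gamma> (r n) s) (u (r n) s) - L (g s) (u (r n) s))
        + integral {a..b} (\<lambda>s. \<psi> s \<bullet> (u (r n) s - v s)) =
        integral {a..b} (\<lambda>s. L (g s) (v s) + (L (\<gamma> (r n) s) (u (r n) s) - L (g s) (u (r n) s)) + \<psi> s \<bullet> (u (r n) s - v s))"
        unfolding act_def by (simp only: Henstock_Kurzweil_Integration.integral_add[OF integrable_add[OF Lv iA] iB]
              Henstock_Kurzweil_Integration.integral_add[OF Lv iA])
      also have "\<dots> \<le> integral {a..b} (\<lambda>s. L (\<gamma> (r n) s) (u (r n) s))"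
      proof (rule integral_le)
        show "(\<lambda>s. L (g s) (v s) + (L (\<gamma> (r n) s) (u (r n) s) - L (g s) (u (r n) s)) + \<psi> s \<bullet> (u (r n) s - v s)) integrable_on {a..b}"
          by (intro integrable_add iA iB Lv)
        show "L (g s) (v s) + (L (\<gamma> (r n) s) (u (r n) s) - L (g s) (u (r n) s)) + \<psi> s \<bullet> (u (r n) s - v s) \<le> L (\<gamma> (r n) s) (u (r n) s)" for s
          using subgradient[where x = "g s" and u = "v s" and v = "u (r n) s"] by (simp add: \<psi>_def)
      qed (rule L_integrable[OF traj])
      finally show ?thesis by (simp add: act_def)
    qed
    moreover have "(\<lambda>n. integral {a..b} (\<lambda>s. L (\<gamma> (r n) s) (u (r n) s) - L (g s) (u (r n) s))
        + integral {a..b} (\<lambda>s. \<psi> s \<bullet> (u (r n) s - v s))) \<longlonglongrightarrow> 0 + 0"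
      by (intro tendsto_add gap[OF continuous_L M] weak_inner[OF \<psi>m K])
    then have "\<forall>\<^sub>F n in sequentially. integral {a..b} (\<lambda>s. L (\<gamma> (r n) s) (u (r n) s) - L (g s) (u (r n) s))
        + integral {a..b} (\<lambda>s. \<psi> s \<bullet> (u (r n) s - v s)) > - \<epsilon>"
      using e by (intro order_tendstoD(1)) auto
    ultimately show ?thesis by (auto elim!: eventually_mono) (smt (verit))
  qed
  ultimately show ?thesis using r gl by blast
qed

end

section \<open>Chow's theorem\<close>

context control_system
begin

lemma traj_pad:
  assumes g: "bounded_traj f R \<gamma> u" and t: "0 \<le> \<tau>" "\<tau> \<le> T"
  shows "\<exists>\<gamma>' u'. bounded_traj f R \<gamma>' u' \<and> \<gamma>' 0 = \<gamma> 0 \<and> \<gamma>' T = \<gamma> \<tau>"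
proof -
  have "R \<ge> 0" using g norm_ge_zero order_trans unfolding bounded_traj_def by blast
  from traj_join[OF g bounded_traj_const[OF this], of \<tau> "\<gamma> \<tau>" "T - \<tau>"] show ?thesis using t by simp
qed

text \<open>The moves are made one after another, while the coefficients multiply the fields at the
  fixed point \<open>z0\<close>. As long as the base point stays close to \<open>z0\<close>,
  continuity makes the discrepancy a small multiple of m, so the errors add up to at most \<epsilon>
  m.\<close>

lemma combined_move:
  assumes "finite A" "A \<subseteq> lie_gen f" "\<epsilon> > 0"
  shows "\<exists>\<delta>>0. \<exists>N\<ge>0. \<exists>p>0. \<forall>z c m. norm (z - z0) < \<delta> \<and> 0 \<le> m \<and> m < \<delta> \<and> (\<forall>Z\<in>A. \<bar>c Z\<bar> \<le> m) \<longrightarrow>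
    (\<exists>\<gamma> u \<tau>. bounded_traj f 1 \<gamma> u \<and> \<gamma> 0 = z \<and> 0 \<le> \<tau> \<and> \<tau> \<le> N * m powr p \<and>
      norm (\<gamma> \<tau> - z - (\<Sum>Z\<in>A. c Z *\<^sub>R Z z0)) \<le> \<epsilon> * m)"
  using assms
proof (induction A arbitrary: \<epsilon> rule: finite_induct)
  case empty
  show ?case
  proof (rule exI[of _ 1], rule conjI[OF zero_less_one], rule exI[of _ 0], rule conjI[OF order_refl],
      rule exI[of _ 1], rule conjI[OF zero_less_one], intro allI impI)
    fix z :: "real^'d" and c :: "(real^'d \<Rightarrow> real^'d) \<Rightarrow> real" and m :: real
    assume "norm (z - z0) < 1 \<and> 0 \<le> m \<and> m < 1 \<and> (\<forall>Z\<in>{}. \<bar>c Z\<bar> \<le> m)"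
    then show "\<exists>\<gamma> u \<tau>. bounded_traj f 1 \<gamma> u \<and> \<gamma> 0 = z \<and> 0 \<le> \<tau> \<and> \<tau> \<le> 0 * m powr 1 \<and>
      norm (\<gamma> \<tau> - z - (\<Sum>Z\<in>{}. c Z *\<^sub>R Z z0)) \<le> \<epsilon> * m"
      using \<open>\<epsilon> > 0\<close>
      by (intro exI[of _ "\<lambda>_. z"] exI[of _ "\<lambda>_. 0"] exI[of _ 0]) (auto simp: bounded_traj_const)
  qed
next
  case (insert Z A)
  have Z: "Z \<in> lie_gen f" and A: "A \<subseteq> lie_gen f" using insert.prems by auto
  have e2: "\<epsilon> / 2 > 0" and e4: "\<epsilon> / 4 > 0" using insert.prems by auto
  obtain \<delta>1 N1 p1 where 1: "\<delta>1 > 0" "N1 \<ge> 0" "p1 > 0" and mv1: "\<And>z c m. norm (z - z0) < \<delta>1 \<Longrightarrow> 0 \<le> m \<Longrightarrow> m < \<delta>1 \<Longrightarrow> (\<forall>Z\<in>A. \<bar>c Z\<bar> \<le> m) \<Longrightarrow>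
    (\<exists>\<gamma> u \<tau>. bounded_traj f 1 \<gamma> u \<and> \<gamma> 0 = z \<and> 0 \<le> \<tau> \<and> \<tau> \<le> N1 * m powr p1 \<and>
      norm (\<gamma> \<tau> - z - (\<Sum>Z\<in>A. c Z *\<^sub>R Z z0)) \<le> \<epsilon> / 2 * m)"
    using insert.IH[OF A e2] by auto
  obtain \<delta>2 N2 p2 where 2: "\<delta>2 > 0" "N2 \<ge> 0" "p2 > 0" and mv2: "\<And>z c. \<bar>c\<bar> \<le> \<delta>2 \<Longrightarrow> (\<exists>\<gamma> u \<tau>. bounded_traj f 1 \<gamma> u \<and> \<gamma> 0 = z \<and>
     0 \<le> \<tau> \<and> \<tau> \<le> N2 * \<bar>c\<bar> powr p2 \<and> norm (\<gamma> \<tau> - z - c *\<^sub>R Z z) \<le> \<epsilon> / 4 * \<bar>c\<bar>)"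
    using lie_gen_move[OF Z e4] by blast
  have "isCont Z z0"
    using smooth_imp_continuous[OF lie_gen_smooth[OF Z smooth_f]] by (simp add: continuous_on_eq_continuous_at)
  then obtain \<delta>3 where 3: "\<delta>3 > 0" "\<And>z. norm (z - z0) < \<delta>3 \<Longrightarrow> norm (Z z - Z z0) < \<epsilon> / 4"
    using e4 unfolding continuous_at_eps_delta dist_norm by blast
  \<comment> \<open>After the first move the point is within \<delta> * l of \<open>z0\<close>, so
    the induction hypothesis applies if \<delta> * l is at most \<open>\<delta>1\<close>.\<close>
  define l where "l = 1 + (\<epsilon> / 2 + norm (Z z0))"
  have l: "l > 0" using e2 norm_ge_zero[of "Z z0"] unfolding l_def by linarith
  define \<delta> where "\<delta> = min (min (\<delta>1 / l) \<delta>1) (min \<delta>2 (min \<delta>3 1))"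
  have d: "\<delta> > 0" "\<delta> \<le> \<delta>1 / l" "\<delta> \<le> \<delta>1" "\<delta> \<le> \<delta>2" "\<delta> \<le> \<delta>3" "\<delta> \<le> 1"
    using 1 2 3 l by (auto simp: \<delta>_def)
  have dl: "\<delta> * l \<le> \<delta>1" using d(2) l by (simp add: pos_le_divide_eq)
  \<comment> \<open>Since m < 1, the smaller exponent gives the larger power and thus a common time
    bound.\<close>
  define p where "p = min p1 p2"
  have N0: "N1 + N2 \<ge> 0" and p0: "p > 0" using 1 2 by (auto simp: p_def)
  show ?case
  proof (rule exI[of _ \<delta>], rule conjI[OF d(1)], rule exI[of _ "N1 + N2"], rule conjI[OF N0],
      rule exI[of _ p], rule conjI[OF p0], intro allI impI)
    fix z c m assume *: "norm (z - z0) < \<delta> \<and> 0 \<le> m \<and> m < \<delta> \<and> (\<forall>Z\<in>insert Z A. \<bar>c Z\<bar> \<le> m)"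
    then have z: "norm (z - z0) < \<delta>" and m: "0 \<le> m" "m < \<delta>" and c: "\<bar>c Z\<bar> \<le> m" "\<forall>Z\<in>A. \<bar>c Z\<bar> \<le> m" by auto
    have "\<bar>c Z\<bar> \<le> \<delta>2" using c(1) m d by linarith
    from mv2[OF this, of z] obtain \<gamma>1 u1 \<tau>1 where g1: "bounded_traj f 1 \<gamma>1 u1" "\<gamma>1 0 = z" "0 \<le> \<tau>1"
      "\<tau>1 \<le> N2 * \<bar>c Z\<bar> powr p2" "norm (\<gamma>1 \<tau>1 - z - c Z *\<^sub>R Z z) \<le> \<epsilon> / 4 * \<bar>c Z\<bar>" by blast
    let ?z = "\<gamma>1 \<tau>1"
    have "norm (c Z *\<^sub>R Z z - c Z *\<^sub>R Z z0) = \<bar>c Z\<bar> * norm (Z z - Z z0)"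
      by (simp flip: scaleR_diff_right)
    also have "\<dots> \<le> m * (\<epsilon> / 4)"
      using c(1) m 3(2)[of z] z d by (intro mult_mono) auto
    finally have b1: "norm (c Z *\<^sub>R Z z - c Z *\<^sub>R Z z0) \<le> \<epsilon> / 4 * m" by (simp add: mult.commute)
    have b2: "norm (?z - z - c Z *\<^sub>R Z z) \<le> \<epsilon> / 4 * m"
      using g1(5) mult_left_mono[OF c(1), of "\<epsilon> / 4"] e4 by linarith
    have b3: "norm (?z - z - c Z *\<^sub>R Z z0) \<le> \<epsilon> / 2 * m"
    proof -
      have "?z - z - c Z *\<^sub>R Z z0 = (?z - z - c Z *\<^sub>R Z z) + (c Z *\<^sub>R Z z - c Z *\<^sub>R Z z0)" by simp
      also have "norm \<dots> \<le> \<epsilon> / 4 * m + \<epsilon> / 4 * m" using b1 b2 by (rule norm_triangle_mono[rotated])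
      finally show ?thesis by simp
    qed
    have "norm (?z - z) \<le> norm (?z - z - c Z *\<^sub>R Z z0) + norm (c Z *\<^sub>R Z z0)"
      using norm_triangle_ineq[of "?z - z - c Z *\<^sub>R Z z0" "c Z *\<^sub>R Z z0"] by simp
    also have "\<dots> \<le> \<epsilon> / 2 * m + m * norm (Z z0)"
      using b3 c(1) by (intro add_mono) (auto intro: mult_right_mono)
    also have "\<dots> = m * (\<epsilon> / 2 + norm (Z z0))" by (simp add: algebra_simps)
    also have "\<dots> \<le> \<delta> * (\<epsilon> / 2 + norm (Z z0))" using m e2 by (intro mult_right_mono) auto
    finally have "norm (?z - z0) < \<delta> + \<delta> * (\<epsilon> / 2 + norm (Z z0))"
      using z norm_triangle_ineq[of "?z - z" "z - z0"] by simp
    also have "\<dots> = \<delta> * l" by (simp add: l_def algebra_simps)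
    finally have zn: "norm (?z - z0) < \<delta>1" using dl by linarith
    have "m < \<delta>1" using m d by linarith
    from mv1[OF zn m(1) this c(2)] obtain \<gamma>2 u2 \<tau>2 where g2: "bounded_traj f 1 \<gamma>2 u2" "\<gamma>2 0 = ?z" "0 \<le> \<tau>2"
      "\<tau>2 \<le> N1 * m powr p1" "norm (\<gamma>2 \<tau>2 - ?z - (\<Sum>Z\<in>A. c Z *\<^sub>R Z z0)) \<le> \<epsilon> / 2 * m" by blast
    obtain \<gamma> u where g: "bounded_traj f 1 \<gamma> u" "\<gamma> 0 = \<gamma>1 0" "\<gamma> (\<tau>1 + \<tau>2) = \<gamma>2 \<tau>2"
      using traj_join[OF g1(1) g2(1) g2(2)[symmetric] g1(3) g2(3)] by blast
    have "\<gamma>2 \<tau>2 - z - (\<Sum>Z\<in>insert Z A. c Z *\<^sub>R Z z0) = (\<gamma>2 \<tau>2 - ?z - (\<Sum>Z\<in>A. c Z *\<^sub>R Z z0)) + (?z - z - c Z *\<^sub>R Z z0)"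
      using insert.hyps by simp
    also have "norm \<dots> \<le> \<epsilon> / 2 * m + \<epsilon> / 2 * m" using g2(5) b3 by (rule norm_triangle_mono)
    finally have err: "norm (\<gamma>2 \<tau>2 - z - (\<Sum>Z\<in>insert Z A. c Z *\<^sub>R Z z0)) \<le> \<epsilon> * m" by simp
    have "N2 * \<bar>c Z\<bar> powr p2 \<le> N2 * m powr p"
    proof -
      have "\<bar>c Z\<bar> powr p2 \<le> m powr p2" using c(1) 2 by (intro powr_mono2) auto
      also have "\<dots> \<le> m powr p" using m d by (intro powr_mono') (auto simp: p_def)
      finally show ?thesis using 2 by (intro mult_left_mono)
    qed
    moreover have "N1 * m powr p1 \<le> N1 * m powr p"
      using m d 1 by (intro mult_left_mono powr_mono') (auto simp: p_def)
    ultimately have "\<tau>1 + \<tau>2 \<le> (N1 + N2) * m powr p" using g1(4) g2(4) by (simp add: distrib_right)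
    then show "\<exists>\<gamma> u \<tau>. bounded_traj f 1 \<gamma> u \<and> \<gamma> 0 = z \<and> 0 \<le> \<tau> \<and> \<tau> \<le> (N1 + N2) * m powr p \<and>
      norm (\<gamma> \<tau> - z - (\<Sum>Z\<in>insert Z A. c Z *\<^sub>R Z z0)) \<le> \<epsilon> * m"
      using g g1(2,3) g2(3) err by (intro exI[of _ \<gamma>] exI[of _ u] exI[of _ "\<tau>1 + \<tau>2"]) auto
  qed
qed

text \<open>Each coordinate vector is a combination of finitely many brackets at \<open>z0\<close>;
  their union over the coordinates is a finite spanning family, and expanding a vector in
  coordinates bounds its coefficients linearly.\<close>

lemma hoermander_frame:
  assumes H: "hoermander f"
  shows "\<exists>A M. finite A \<and> A \<subseteq> lie_gen f \<and> M \<ge> 0 \<and>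
    (\<forall>w. \<exists>c. w = (\<Sum>Z\<in>A. c Z *\<^sub>R Z z0) \<and> (\<forall>Z\<in>A. \<bar>c Z\<bar> \<le> M * norm w))"
proof -
  have "\<exists>A c. finite A \<and> A \<subseteq> lie_gen f \<and> axis j 1 = (\<Sum>Z\<in>A. c Z *\<^sub>R Z z0)" for j
  proof -
    have "axis j 1 \<in> span ((\<lambda>X. X z0) ` lie_gen f)" using H by (simp add: hoermander_def)
    then obtain S r where S: "finite S" "S \<subseteq> (\<lambda>X. X z0) ` lie_gen f" "axis j 1 = (\<Sum>a\<in>S. r a *\<^sub>R a)"
      unfolding span_explicit by auto
    obtain A where A: "A \<subseteq> lie_gen f" "inj_on (\<lambda>X. X z0) A" "S = (\<lambda>X. X z0) ` A"
      using S(2) by (auto simp: subset_image_inj)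
    have "axis j 1 = (\<Sum>Z\<in>A. r (Z z0) *\<^sub>R Z z0)"
      using S(3) by (simp add: A(3) sum.reindex[OF A(2)])
    moreover have "finite A" using S(1) A finite_image_iff by blast
    ultimately show ?thesis using A(1) by (intro exI[of _ A] exI[of _ "\<lambda>Z. r (Z z0)"]) auto
  qed
  moreover define P where "P j A c \<longleftrightarrow> finite A \<and> A \<subseteq> lie_gen f \<and> axis j 1 = (\<Sum>Z\<in>A. c Z *\<^sub>R Z z0)" for j A c
  ultimately have "\<exists>A c. P j A c" for j by simp
  then obtain A c where "\<And>j. P j (A j) (c j)" by metis
  then have A: "\<And>j. finite (A j)" "\<And>j. A j \<subseteq> lie_gen f"
    and c: "\<And>j. axis j 1 = (\<Sum>Z\<in>A j. c j Z *\<^sub>R Z z0)" by (simp_all add: P_def)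
  define B where "B = (\<Union>j. A j)"
  define c' where "c' j Z = (if Z \<in> A j then c j Z else 0)" for j Z
  have B: "finite B" "B \<subseteq> lie_gen f" using A by (auto simp: B_def)
  have cB: "axis j 1 = (\<Sum>Z\<in>B. c' j Z *\<^sub>R Z z0)" for j
    unfolding c[of j] using B(1) by (intro sum.mono_neutral_cong_left) (auto simp: B_def c'_def)
  define M where "M = (\<Sum>j\<in>UNIV. \<Sum>Z\<in>B. \<bar>c' j Z\<bar>)"
  have "\<exists>c. w = (\<Sum>Z\<in>B. c Z *\<^sub>R Z z0) \<and> (\<forall>Z\<in>B. \<bar>c Z\<bar> \<le> M * norm w)" for w :: "real^'d"
  proof (intro exI conjI ballI)
    have "w = (\<Sum>j\<in>UNIV. (w $ j) *\<^sub>R axis j 1)"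
      by (auto simp: vec_eq_iff axis_def if_distrib cong: if_cong)
    also have "\<dots> = (\<Sum>j\<in>UNIV. \<Sum>Z\<in>B. (w $ j * c' j Z) *\<^sub>R Z z0)"
      unfolding cB by (simp add: scaleR_sum_right)
    also have "\<dots> = (\<Sum>Z\<in>B. (\<Sum>j\<in>UNIV. w $ j * c' j Z) *\<^sub>R Z z0)"
      by (subst sum.swap) (simp add: scaleR_sum_left)
    finally show "w = (\<Sum>Z\<in>B. (\<Sum>j\<in>UNIV. w $ j * c' j Z) *\<^sub>R Z z0)" .
    fix Z assume Z: "Z \<in> B"
    have "\<bar>\<Sum>j\<in>UNIV. w $ j * c' j Z\<bar> \<le> (\<Sum>j\<in>UNIV. \<bar>w $ j * c' j Z\<bar>)" by (rule sum_abs)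
    also have "\<dots> \<le> (\<Sum>j\<in>UNIV. (\<Sum>Z\<in>B. \<bar>c' j Z\<bar>) * norm w)"
    proof (rule sum_mono)
      fix j
      have "\<bar>w $ j\<bar> * \<bar>c' j Z\<bar> \<le> norm w * (\<Sum>Z\<in>B. \<bar>c' j Z\<bar>)"
        using Z B by (intro mult_mono component_le_norm_cart member_le_sum) auto
      then show "\<bar>w $ j * c' j Z\<bar> \<le> (\<Sum>Z\<in>B. \<bar>c' j Z\<bar>) * norm w" by (simp add: abs_mult mult.commute)
    qed
    finally show "\<bar>\<Sum>j\<in>UNIV. w $ j * c' j Z\<bar> \<le> M * norm w" by (simp only: M_def sum_distrib_right)
  qed
  moreover have "M \<ge> 0" unfolding M_def by (intro sum_nonneg) auto
  ultimately show ?thesis using B by blast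
qed

text \<open>The tolerance 1 / (2 M') cancels the bound M' |w| on the coefficients, which leaves an
  error of half the desired displacement.\<close>

lemma approximate_steering:
  assumes H: "hoermander f"
  shows "\<exists>\<rho>>0. \<exists>N\<ge>0. \<exists>p>0. \<forall>z w. norm (z - z0) < \<rho> \<and> norm w < \<rho> \<longrightarrow>
    (\<exists>\<gamma> u \<tau>. bounded_traj f 1 \<gamma> u \<and> \<gamma> 0 = z \<and> 0 \<le> \<tau> \<and> \<tau> \<le> N * norm w powr p \<and> norm (\<gamma> \<tau> - z - w) \<le> norm w / 2)"
proof -
  obtain A M where A: "finite A" "A \<subseteq> lie_gen f" "M \<ge> 0"
    and frame: "\<forall>w. \<exists>c. w = (\<Sum>Z\<in>A. c Z *\<^sub>R Z z0) \<and> (\<forall>Z\<in>A. \<bar>c Z\<bar> \<le> M * norm w)"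
    using hoermander_frame[OF H, of z0] by (elim exE conjE)
  define M' where "M' = M + 1"
  have M': "M' > 0" using A by (simp add: M'_def)
  have "1 / (2 * M') > 0" using M' by simp
  from combined_move[OF A(1,2) this, of z0] obtain \<delta> N p where d: "\<delta> > 0" "N \<ge> 0" "p > 0"
    and mv: "\<And>z c m. norm (z - z0) < \<delta> \<Longrightarrow> 0 \<le> m \<Longrightarrow> m < \<delta> \<Longrightarrow> (\<forall>Z\<in>A. \<bar>c Z\<bar> \<le> m) \<Longrightarrow>
    (\<exists>\<gamma> u \<tau>. bounded_traj f 1 \<gamma> u \<and> \<gamma> 0 = z \<and> 0 \<le> \<tau> \<and> \<tau> \<le> N * m powr p \<and>
      norm (\<gamma> \<tau> - z - (\<Sum>Z\<in>A. c Z *\<^sub>R Z z0)) \<le> 1 / (2 * M') * m)" by auto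
  have d0: "min \<delta> (\<delta> / M') > 0" and N0: "N * M' powr p \<ge> 0" using d M' by auto
  show ?thesis
  proof (rule exI[of _ "min \<delta> (\<delta> / M')"], rule conjI[OF d0], rule exI[of _ "N * M' powr p"], rule conjI[OF N0],
      rule exI[of _ p], rule conjI[OF d(3)], intro allI impI)
    fix z w :: "real^'d" assume *: "norm (z - z0) < min \<delta> (\<delta> / M') \<and> norm w < min \<delta> (\<delta> / M')"
    obtain c where w: "w = (\<Sum>Z\<in>A. c Z *\<^sub>R Z z0)" and c: "\<forall>Z\<in>A. \<bar>c Z\<bar> \<le> M * norm w"
      using frame[THEN spec, of w] by (elim exE conjE)
    have le: "M * norm w \<le> M' * norm w" by (intro mult_right_mono) (auto simp: M'_def)
    have c': "\<forall>Z\<in>A. \<bar>c Z\<bar> \<le> M' * norm w" using c le by force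
    have "M' * norm w < \<delta>" using * M' by (simp add: pos_less_divide_eq mult.commute)
    moreover have "norm (z - z0) < \<delta>" using * by simp
    ultimately obtain \<gamma> u \<tau> where g: "bounded_traj f 1 \<gamma> u" "\<gamma> 0 = z" "0 \<le> \<tau>" "\<tau> \<le> N * (M' * norm w) powr p"
      "norm (\<gamma> \<tau> - z - w) \<le> 1 / (2 * M') * (M' * norm w)"
      using mv[of z "M' * norm w" c] c' M' unfolding w[symmetric] by (auto simp: mult_nonneg_nonneg)
    moreover have "N * (M' * norm w) powr p = N * M' powr p * norm w powr p" using M' by (simp add: powr_mult)
    moreover have "1 / (2 * M') * (M' * norm w) = norm w / 2" using M' by simp
    ultimately show "\<exists>\<gamma> u \<tau>. bounded_traj f 1 \<gamma> u \<and> \<gamma> 0 = z \<and> 0 \<le> \<tau> \<and> \<tau> \<le> N * M' powr p * norm w powr p \<and> norm (\<gamma> \<tau> - z - w) \<le> norm w / 2"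
      by (intro exI[of _ \<gamma>] exI[of _ u] exI[of _ \<tau>]) simp
  qed
qed

text \<open>A Newton-like scheme: each round aims at the remaining displacement and halves it, so
  the durations are bounded by a geometric series. Every finite stage is padded by rest to the same
  time \<open>T\<close>, in preparation for the passage to the limit.\<close>

lemma iterated_steering:
  assumes \<rho>: "\<rho> > 0" and N: "N \<ge> 0" and p: "p > 0" and T: "T > 0"
    and steer: "\<And>z w. norm (z - z0) < \<rho> \<Longrightarrow> norm w < \<rho> \<Longrightarrow>
      (\<exists>\<gamma> u \<tau>. bounded_traj f 1 \<gamma> u \<and> \<gamma> 0 = z \<and> 0 \<le> \<tau> \<and> \<tau> \<le> N * norm w powr p \<and> norm (\<gamma> \<tau> - z - w) \<le> norm w / 2)"
  shows "\<exists>\<delta>>0. \<forall>z q. norm (z - z0) < \<delta> \<and> norm (q - z0) < \<delta> \<longrightarrow>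
    (\<forall>n::nat. \<exists>\<gamma> u. bounded_traj f 1 \<gamma> u \<and> \<gamma> 0 = z \<and> norm (q - \<gamma> T) \<le> norm (q - z) / 2 ^ n)"
proof -
  \<comment> \<open>The factor by which the time bound N |w|^p shrinks when the displacement is
    halved.\<close>
  define a where "a = (1 / 2) powr p"
  have a: "0 < a" "a < 1" using p powr_less_mono2[of p "1/2" 1] by (auto simp: a_def)
  \<comment> \<open>Solves (N + 1) b / (1 - a) = T, so displacements with |w|^p \<le> b are
    corrected within total time \<open>T\<close>; N + 1 avoids division by 0.\<close>
  define b where "b = T * (1 - a) / (N + 1)"
  have b: "b > 0" using T a N by (simp add: b_def)
  \<comment> \<open>Two points within \<delta> of \<open>z0\<close> are less than 2 \<delta> apart,
    and all later base points stay within 3 \<delta> < \<rho> of \<open>z0\<close>, where steering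
    applies again.\<close>
  define \<delta> where "\<delta> = min (\<rho> / 4) (b powr (1 / p) / 2)"
  have d: "\<delta> > 0" "\<delta> \<le> \<rho> / 4" "2 * \<delta> \<le> b powr (1 / p)" using \<rho> b by (auto simp: \<delta>_def)
  have "\<exists>\<gamma> u. bounded_traj f 1 \<gamma> u \<and> \<gamma> 0 = z \<and> norm (q - \<gamma> T) \<le> norm (q - z) / 2 ^ n"
    if z: "norm (z - z0) < \<delta>" and q: "norm (q - z0) < \<delta>" for z q and n :: nat
  proof -
    let ?w = "norm (q - z)"
    have w: "?w < 2 * \<delta>" using norm_triangle_ineq4[of "q - z0" "z - z0"] z q by simp
    have chain: "\<exists>\<gamma> u \<tau>. bounded_traj f 1 \<gamma> u \<and> \<gamma> 0 = z \<and> 0 \<le> \<tau> \<and> \<tau> \<le> N * ?w powr p * (\<Sum>k<n. a ^ k) \<and> norm (q - \<gamma> \<tau>) \<le> ?w / 2 ^ n" for n :: nat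
    proof (induction n)
      case 0
      show ?case by (intro exI[of _ "\<lambda>_. z"] exI[of _ "\<lambda>_. 0"] exI[of _ 0]) (simp add: bounded_traj_const)
    next
      case (Suc n)
      then obtain \<gamma>1 u1 \<tau>1 where g1: "bounded_traj f 1 \<gamma>1 u1" "\<gamma>1 0 = z" "0 \<le> \<tau>1"
        "\<tau>1 \<le> N * ?w powr p * (\<Sum>k<n. a ^ k)" "norm (q - \<gamma>1 \<tau>1) \<le> ?w / 2 ^ n" by blast
      have "?w / 2 ^ n \<le> ?w / 1" by (intro divide_left_mono) auto
      then have small: "norm (q - \<gamma>1 \<tau>1) < 2 * \<delta>" using g1(5) w by simp
      have "norm (\<gamma>1 \<tau>1 - z0) < \<rho>"
        using norm_triangle_ineq4[of "q - z0" "q - \<gamma>1 \<tau>1"] small q d by simp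
      moreover have "norm (q - \<gamma>1 \<tau>1) < \<rho>" using small d by simp
      ultimately obtain \<gamma>2 u2 \<tau>2 where g2: "bounded_traj f 1 \<gamma>2 u2" "\<gamma>2 0 = \<gamma>1 \<tau>1" "0 \<le> \<tau>2"
        "\<tau>2 \<le> N * norm (q - \<gamma>1 \<tau>1) powr p" "norm (\<gamma>2 \<tau>2 - \<gamma>1 \<tau>1 - (q - \<gamma>1 \<tau>1)) \<le> norm (q - \<gamma>1 \<tau>1) / 2"
        using steer by blast
      obtain \<gamma> u where g: "bounded_traj f 1 \<gamma> u" "\<gamma> 0 = \<gamma>1 0" "\<gamma> (\<tau>1 + \<tau>2) = \<gamma>2 \<tau>2"
        using traj_join[OF g1(1) g2(1) g2(2)[symmetric] g1(3) g2(3)] by blast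
      have "norm (q - \<gamma>1 \<tau>1) powr p \<le> (?w * (1 / 2) ^ n) powr p"
        using g1(5) p by (intro powr_mono2) (auto simp: power_one_over)
      also have "\<dots> = ?w powr p * ((1 / 2) ^ n) powr p" by (simp add: powr_mult)
      also have "((1 / 2) ^ n) powr p = a ^ n"
        by (simp add: a_def powr_powr powr_realpow[symmetric] mult.commute)
      finally have "\<tau>2 \<le> N * (?w powr p * a ^ n)" using g2(4) N mult_left_mono by (meson order_trans)
      then have "\<tau>1 + \<tau>2 \<le> N * ?w powr p * (\<Sum>k<Suc n. a ^ k)" using g1(4) by (simp add: algebra_simps)
      moreover have "norm (q - \<gamma>2 \<tau>2) \<le> ?w / 2 ^ Suc n"
        using g2(5) g1(5) by (simp add: norm_minus_commute)
      ultimately show ?case using g g1(2,3) g2(3)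
        by (intro exI[of _ \<gamma>] exI[of _ u] exI[of _ "\<tau>1 + \<tau>2"]) auto
    qed
    obtain \<gamma> u \<tau> where g: "bounded_traj f 1 \<gamma> u" "\<gamma> 0 = z" "0 \<le> \<tau>" "\<tau> \<le> N * ?w powr p * (\<Sum>k<n. a ^ k)" "norm (q - \<gamma> \<tau>) \<le> ?w / 2 ^ n"
      using chain by blast
    have "(\<Sum>k<n. a ^ k) \<le> 1 / (1 - a)"
    proof -
      have "(\<Sum>k<n. a ^ k) = (1 - a ^ n) / (1 - a)" using a by (simp add: sum_gp_strict)
      also have "\<dots> \<le> 1 / (1 - a)" using a by (intro divide_right_mono) auto
      finally show ?thesis .
    qed
    moreover have "?w powr p \<le> b"
    proof -
      have "?w powr p \<le> (b powr (1 / p)) powr p" using w d p by (intro powr_mono2) auto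
      then show ?thesis using b p by (simp add: powr_powr)
    qed
    ultimately have "N * ?w powr p * (\<Sum>k<n. a ^ k) \<le> (N + 1) * b * (1 / (1 - a))"
      using N b a by (intro mult_mono) (auto intro!: sum_nonneg)
    also have "\<dots> = T" using a N by (simp add: b_def)
    finally have "\<tau> \<le> T" using g(4) by simp
    then show ?thesis using traj_pad[OF g(1,3), of T] g(2,5) by auto
  qed
  then show ?thesis using d(1) by blast
qed

end

section \<open>Exact controllability in short time and in the large\<close>

context lagrangian_system
begin

text \<open>The approximate connections all have duration \<open>T\<close> and controls of norm at
  most 1, so \<open>bounded_traj_compact\<close> provides a limit; it ends exactly at
  \<open>q\<close> because the endpoint errors tend to 0.\<close>

theorem local_controllability:
  assumes H: "hoermander f" and T: "T > 0"
  shows "\<exists>\<delta>>0. \<forall>z q. norm (z - z0) < \<delta> \<and> norm (q - z0) < \<delta> \<longrightarrow>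
    (\<exists>\<gamma> u. bounded_traj f 1 \<gamma> u \<and> \<gamma> 0 = z \<and> \<gamma> T = q)"
proof -
  obtain \<rho> N p where "\<rho> > 0" "N \<ge> 0" "p > 0" and steer: "\<And>z w. norm (z - z0) < \<rho> \<Longrightarrow> norm w < \<rho> \<Longrightarrow>
      (\<exists>\<gamma> u \<tau>. bounded_traj f 1 \<gamma> u \<and> \<gamma> 0 = z \<and> 0 \<le> \<tau> \<and> \<tau> \<le> N * norm w powr p \<and> norm (\<gamma> \<tau> - z - w) \<le> norm w / 2)"
    using approximate_steering[OF H] by metis
  from iterated_steering[OF this(1-3) T steer] obtain \<delta> where d: "\<delta> > 0"
    and it: "\<And>z q n. norm (z - z0) < \<delta> \<Longrightarrow> norm (q - z0) < \<delta> \<Longrightarrow>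
    \<exists>\<gamma> u. bounded_traj f 1 \<gamma> u \<and> \<gamma> 0 = z \<and> norm (q - \<gamma> T) \<le> norm (q - z) / 2 ^ n" by blast
  have "\<exists>\<gamma> u. bounded_traj f 1 \<gamma> u \<and> \<gamma> 0 = z \<and> \<gamma> T = q" if zq: "norm (z - z0) < \<delta>" "norm (q - z0) < \<delta>" for z q
  proof -
    obtain \<gamma> u where g: "\<And>n. bounded_traj f 1 (\<gamma> n) (u n)" "\<And>n. \<gamma> n 0 = z" "\<And>n. norm (q - \<gamma> n T) \<le> norm (q - z) / 2 ^ n"
      using it[OF zq] by metis
    obtain r \<gamma>' u' where r: "strict_mono r" and g': "bounded_traj f 1 \<gamma>' u'" and lim: "\<And>s. (\<lambda>n. \<gamma> (r n) s) \<longlonglongrightarrow> \<gamma>' s"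
      using bounded_traj_compact[where \<gamma> = \<gamma> and u = u and B = "norm z", OF g(1)] g(2) by auto
    have "(\<lambda>n. norm (q - z) / 2 ^ n) \<longlonglongrightarrow> 0"
      using LIMSEQ_divide_realpow_zero[of 2 "norm (q - z)"] by simp
    then have "(\<lambda>n. norm (q - \<gamma> n T)) \<longlonglongrightarrow> 0"
      by (rule tendsto_sandwich[OF _ _ tendsto_const, rotated 2]) (use g(3) in auto)
    then have "(\<lambda>n. norm (q - \<gamma> (r n) T)) \<longlonglongrightarrow> 0"
      using LIMSEQ_subseq_LIMSEQ[OF _ r] by (fastforce simp: comp_def)
    moreover have "(\<lambda>n. norm (q - \<gamma> (r n) T)) \<longlonglongrightarrow> norm (q - \<gamma>' T)" by (intro tendsto_intros lim)
    ultimately have "\<gamma>' T = q" using LIMSEQ_unique by fastforce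
    moreover have "\<gamma>' 0 = z" using lim[of 0] g(2) LIMSEQ_unique[OF tendsto_const] by force
    ultimately show ?thesis using g' by blast
  qed
  then show ?thesis using d by blast
qed

text \<open>The set reachable from \<open>x\<close> is open and closed in the connected space R^d.
  Both follow from one fact: near any point, reachable or not, all pairs of points can be
  joined.\<close>

theorem global_controllability:
  assumes H: "hoermander f"
  shows "\<exists>T\<ge>0. \<exists>\<gamma> u. bounded_traj f 1 \<gamma> u \<and> \<gamma> 0 = x \<and> \<gamma> T = y"
proof -
  define S where "S = {y. \<exists>T\<ge>0. \<exists>\<gamma> u. bounded_traj f 1 \<gamma> u \<and> \<gamma> 0 = x \<and> \<gamma> T = y}"
  have step: "q \<in> S" if z: "z \<in> S" and g: "bounded_traj f 1 \<gamma> u" "\<gamma> 0 = z" "\<gamma> 1 = q" for z q \<gamma> u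
  proof -
    obtain T \<gamma>1 u1 where 1: "T \<ge> 0" "bounded_traj f 1 \<gamma>1 u1" "\<gamma>1 0 = x" "\<gamma>1 T = z" using z by (auto simp: S_def)
    have "\<exists>\<gamma>' u'. bounded_traj f 1 \<gamma>' u' \<and> \<gamma>' 0 = \<gamma>1 0 \<and> \<gamma>' (T + 1) = \<gamma> 1"
      by (rule traj_join[OF 1(2) g(1)]) (use 1 g in auto)
    then show ?thesis using 1 g unfolding S_def by (intro CollectI exI[of _ "T + 1"]) auto
  qed
  have nbhd: "\<exists>\<delta>>0. \<forall>z q. norm (z - z0) < \<delta> \<and> norm (q - z0) < \<delta> \<longrightarrow> (z \<in> S \<longrightarrow> q \<in> S)" for z0
    using local_controllability[OF H, of 1 z0] step by (metis zero_less_one)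
  have "open S"
    unfolding open_contains_ball
  proof
    fix z assume z: "z \<in> S"
    obtain \<delta> where d: "\<delta> > 0" "\<And>w q. norm (w - z) < \<delta> \<Longrightarrow> norm (q - z) < \<delta> \<Longrightarrow> w \<in> S \<Longrightarrow> q \<in> S" using nbhd by blast
    have "q \<in> S" if "q \<in> ball z \<delta>" for q
      using d(2)[of z q] that z d(1) by (simp add: dist_norm norm_minus_commute)
    then show "\<exists>e>0. ball z e \<subseteq> S" using d(1) by blast
  qed
  moreover have "open (- S)"
    unfolding open_contains_ball
  proof
    fix z assume z: "z \<in> - S"
    obtain \<delta> where d: "\<delta> > 0" "\<And>w q. norm (w - z) < \<delta> \<Longrightarrow> norm (q - z) < \<delta> \<Longrightarrow> w \<in> S \<Longrightarrow> q \<in> S" using nbhd by blast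
    have "q \<notin> S" if "q \<in> ball z \<delta>" for q
      using d(2)[of q z] that z d(1) by (auto simp add: dist_norm norm_minus_commute)
    then show "\<exists>e>0. ball z e \<subseteq> - S" using d(1) by blast
  qed
  moreover have "x \<in> S" unfolding S_def
    by (intro CollectI exI[of _ 0] conjI exI[of _ "\<lambda>_. x"] exI[of _ "\<lambda>_. 0"]) (auto simp: bounded_traj_const)
  ultimately have "S = UNIV" using clopen[of S] by (auto simp: closed_def)
  then show ?thesis unfolding S_def by blast
qed

end

section \<open>Bounding the control\<close>

text \<open>Admissible controls are only Lebesgue measurable, while the time change composes them
  with other functions and so calls for a Borel version. The value 0 outside the interval lets the
  extended curve rest there.\<close>

lemma lebesgue_on_borel_version:
  fixes u :: "real \<Rightarrow> real^'m::finite"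
  assumes "u \<in> borel_measurable (lebesgue_on {a..b})"
  shows "\<exists>v N. v \<in> borel_measurable borel \<and> negligible N \<and> (\<forall>t\<in>{a..b} - N. v t = u t) \<and> (\<forall>t. t \<notin> {a..b} \<longrightarrow> v t = 0)"
proof -
  let ?u = "\<lambda>t. if t \<in> {a..b} then u t else 0"
  have "?u \<in> borel_measurable lebesgue"
    using assms by (rule borel_measurable_if_I) simp
  then have "(\<lambda>t. ?u t $ i) \<in> borel_measurable (completion lborel)" for i
    by (rule measurable_compose) (intro borel_measurable_continuous_onI continuous_intros)
  then have "\<forall>i. \<exists>g. g \<in> borel_measurable lborel \<and> (AE t in lborel. ?u t $ i = g t)"
    using completion_ex_borel_measurable_real[of _ lborel] by (simp only: Bex_def) blast
  from choice[OF this] obtain g where "\<forall>i. g i \<in> borel_measurable lborel \<and> (AE t in lborel. ?u t $ i = g i t)"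
    by (elim exE)
  then have g: "\<And>i. g i \<in> borel_measurable lborel" "\<And>i. AE t in lborel. ?u t $ i = g i t" by blast+
  have "AE t in lborel. \<forall>i. ?u t $ i = g i t" using g(2) by (simp add: AE_all_countable)
  then obtain N where N: "N \<in> null_sets lborel" "\<And>t. t \<notin> N \<Longrightarrow> \<forall>i. ?u t $ i = g i t"
    by (auto elim!: AE_E3)
  define v :: "real \<Rightarrow> real^'m" where "v t = (if t \<in> {a..b} then \<Sum>i\<in>UNIV. g i t *\<^sub>R axis i 1 else 0)" for t
  have [measurable]: "g i \<in> borel_measurable borel" for i using g(1) by simp
  have "v \<in> borel_measurable borel" unfolding v_def by measurable
  moreover have "negligible N" using N(1) by (simp add: negligible_iff_null_sets null_sets_completionI)
  moreover have "v t = u t" if "t \<in> {a..b} - N" for t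
  proof -
    have "u t = (\<Sum>i\<in>UNIV. (u t $ i) *\<^sub>R axis i 1)"
      by (auto simp: vec_eq_iff axis_def if_distrib cong: if_cong)
    then show ?thesis using N(2)[of t] that by (simp add: v_def)
  qed
  ultimately show ?thesis by (intro exI[of _ v] exI[of _ N]) (auto simp: v_def)
qed

lemma abs_cont_on_imp_continuous_on:
  assumes "abs_cont_on g a b"
  shows "continuous_on {a..b} g"
  unfolding continuous_on_iff
proof (intro ballI allI impI)
  fix x and e :: real assume x: "x \<in> {a..b}" and "e > 0"
  then obtain \<delta> where \<delta>: "\<delta> > 0" and main: "\<And>(n::nat) (s::nat \<Rightarrow> real) t. (\<forall>k<n. a \<le> s k \<and> s k \<le> t k \<and> t k \<le> b) \<Longrightarrow>
       (\<forall>k<n. \<forall>j<n. k \<noteq> j \<longrightarrow> t k \<le> s j \<or> t j \<le> s k) \<Longrightarrow>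
       (\<Sum>k<n. t k - s k) < \<delta> \<Longrightarrow> (\<Sum>k<n. norm (g (t k) - g (s k))) < e"
    using assms[unfolded abs_cont_on_def, rule_format, of e] by auto
  have "dist (g y) (g x) < e" if y: "y \<in> {a..b}" "dist y x < \<delta>" for y
    using main[of 1 "\<lambda>_. min x y" "\<lambda>_. max x y"] x y
    by (cases "x \<le> y") (auto simp: dist_norm norm_minus_commute min_def max_def)
  then show "\<exists>d>0. \<forall>x'\<in>{a..b}. dist x' x < d \<longrightarrow> dist (g x') (g x) < e" using \<delta> by blast
qed

lemma primitive_continuous:
  fixes w :: "real \<Rightarrow> real"
  assumes int: "\<And>a b. w integrable_on {a..b}"
  shows "continuous_on UNIV (primitive w)"
  unfolding continuous_on_eq_continuous_at[OF open_UNIV]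
proof
  fix x :: real
  have eq: "primitive w t = primitive w (x - 1) + integral {x - 1..t} w" if "t \<in> {x - 1..x + 1}" for t
    using primitive_has_integral[OF int, of "x - 1" t] that by (simp add: has_integral_iff)
  have "continuous_on {x - 1..x + 1} (\<lambda>t. primitive w (x - 1) + integral {x - 1..t} w)"
    by (intro continuous_on_add continuous_on_const indefinite_integral_continuous_1 int)
  then have "continuous_on {x - 1..x + 1} (primitive w)"
    by (rule continuous_on_eq) (rule eq[symmetric])
  then show "isCont (primitive w) x" by (rule continuous_on_interior) simp
qed

section \<open>Cost of a change of speed\<close>

context lagrangian_system
begin

lemma L_convex:
  assumes t: "0 \<le> t" "t \<le> 1"
  shows "L x ((1 - t) *\<^sub>R u + t *\<^sub>R v) \<le> (1 - t) * L x u + t * L x v"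
proof -
  let ?m = "(1 - t) *\<^sub>R u + t *\<^sub>R v"
  have "(1 - t) * (L x ?m + Lu x ?m \<bullet> (u - ?m)) + t * (L x ?m + Lu x ?m \<bullet> (v - ?m)) \<le> (1 - t) * L x u + t * L x v"
    using t subgradient[of x ?m u] subgradient[of x ?m v] by (intro add_mono mult_left_mono) auto
  moreover have "(1 - t) * (L x ?m + Lu x ?m \<bullet> (u - ?m)) + t * (L x ?m + Lu x ?m \<bullet> (v - ?m))
     = L x ?m + Lu x ?m \<bullet> ((1 - t) *\<^sub>R (u - ?m) + t *\<^sub>R (v - ?m))"
    by (simp add: inner_add_right distrib_left left_diff_distrib)
  moreover have "(1 - t) *\<^sub>R (u - ?m) + t *\<^sub>R (v - ?m) = 0" by (simp add: algebra_simps)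
  ultimately show ?thesis by simp
qed

text \<open>Superlinearity in the form used for choosing constants: it suffices that r^(\<sigma> -
  1) \<ge> B / K1.\<close>

lemma powr_dominates:
  assumes B: "B \<ge> 0" and r: "r \<ge> (B / K1) powr (1 / (\<sigma> - 1))"
  shows "B * r \<le> K1 * r powr \<sigma>"
proof (cases "r = 0")
  case False
  have r0: "r > 0" using r False powr_ge_zero[of "B / K1" "1 / (\<sigma> - 1)"] by linarith
  have "B / K1 = ((B / K1) powr (1 / (\<sigma> - 1))) powr (\<sigma> - 1)"
    using B K1 \<sigma> by (cases "B = 0") (auto simp: powr_powr)
  also have "\<dots> \<le> r powr (\<sigma> - 1)" using r \<sigma> by (intro powr_mono2) auto
  finally have "B \<le> K1 * r powr (\<sigma> - 1)" using K1 by (simp add: pos_divide_le_eq mult.commute)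
  then have "B * r \<le> K1 * r powr (\<sigma> - 1) * r" using r0 by (intro mult_right_mono) auto
  also have "\<dots> = K1 * r powr \<sigma>" using r0 by (simp add: powr_diff)
  finally show ?thesis .
qed simp

lemma L_linear_bound: "\<exists>b. \<forall>x u. norm u - b \<le> L x u"
proof -
  define r where "r = (1 / K1) powr (1 / (\<sigma> - 1))"
  have "norm u - (K2 + r) \<le> L x u" for x u
  proof (cases "norm u \<ge> r")
    case True
    have r: "r \<ge> 0" by (simp add: r_def)
    have "norm u \<le> K1 * norm u powr \<sigma>" using powr_dominates[of 1 "norm u"] True by (simp add: r_def)
    then show ?thesis using coercive[where x = x and u = u] r by linarith
  next
    case False
    have "K1 * norm u powr \<sigma> \<ge> 0" using K1 by simp
    then show ?thesis using coercive[where x = x and u = u] False by linarith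
  qed
  then show ?thesis by blast
qed

text \<open>Travelling the direction \<open>u\<close> at speed \<open>u / w\<close> instead of \<open>u\<close> costs \<open>w * L x (u / w)\<close>.
  By convexity and superlinearity, slowing down fast pieces to speed \<open>R\<close> gains at least \<open>E\<close> per
  unit of additional time, while saving that time on slow pieces costs at most \<open>E\<close> per unit.\<close>

lemma slow_piece_cost:
  assumes w: "1 / 2 \<le> w" "w \<le> 1"
    and M: "\<bar>L x u\<bar> \<le> M" "\<bar>L x (2 *\<^sub>R u)\<bar> \<le> M"
  shows "w * L x ((1 / w) *\<^sub>R u) \<le> L x u - 3 * M * (w - 1)"
proof -
  define s where "s = 1 / w - 1"
  have s: "0 \<le> s" "s \<le> 1" using w by (auto simp: s_def field_simps)
  have ws: "w * s = 1 - w" "w * (1 - s) = 2 * w - 1" using w by (auto simp: s_def field_simps)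
  have "(1 - s) *\<^sub>R u + s *\<^sub>R (2 *\<^sub>R u) = ((1 - s) + s * 2) *\<^sub>R u"
    by (simp only: scaleR_scaleR scaleR_add_left)
  then have "(1 / w) *\<^sub>R u = (1 - s) *\<^sub>R u + s *\<^sub>R (2 *\<^sub>R u)" by (simp add: s_def)
  then have "w * L x ((1 / w) *\<^sub>R u) \<le> w * ((1 - s) * L x u + s * L x (2 *\<^sub>R u))"
    using L_convex[OF s, of x u "2 *\<^sub>R u"] w by (intro mult_left_mono) auto
  also have "\<dots> = (w * (1 - s)) * L x u + (w * s) * L x (2 *\<^sub>R u)" by (simp add: algebra_simps)
  also have "\<dots> = L x u + (1 - w) * (L x (2 *\<^sub>R u) - 2 * L x u)" unfolding ws by (simp add: algebra_simps)
  also have "\<dots> \<le> L x u + (1 - w) * (3 * M)" using w M by (intro add_left_mono mult_left_mono) auto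
  finally show ?thesis by (simp add: algebra_simps)
qed

text \<open>The slowed control has norm \<open>R\<close> and lies on the segment from the unit
  vector in its direction to \<open>u\<close>. Convexity bounds its cost by the costs of the two
  ends, and \<open>large\<close> makes the cost at norm \<open>R\<close> exceed R times that of the
  unit vector by the gain required.\<close>

lemma fast_piece_cost:
  assumes R: "R > 1" and u: "norm u \<ge> R" and e: "\<And>e. norm e = 1 \<Longrightarrow> L x e \<le> M"
    and large: "K1 * R powr \<sigma> \<ge> K2 + R * M + E * (R - 1)" and w: "w = norm u / R"
  shows "w * L x ((1 / w) *\<^sub>R u) \<le> L x u - E * (w - 1)"
proof -
  have w1: "w \<ge> 1" using u R by (simp add: w)
  have u0: "norm u > 1" using u R by linarith
  have un: "u \<noteq> 0" using u0 by auto
  define v where "v = (1 / w) *\<^sub>R u"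
  define e where "e = (1 / norm u) *\<^sub>R u"
  have ne: "norm e = 1" using un by (simp add: e_def)
  have nv: "norm v = R" using un R by (simp add: v_def w)
  \<comment> \<open>The position of norm \<open>R\<close> on the way from norm 1 to the norm of
    \<open>u\<close>.\<close>
  define t where "t = (R - 1) / (norm u - 1)"
  have t: "0 < t" "t \<le> 1" using u R by (auto simp: t_def)
  have "(1 - t) *\<^sub>R e + t *\<^sub>R u = ((1 - t) / norm u + t) *\<^sub>R u" by (simp add: e_def algebra_simps)
  moreover have "(1 - t) / norm u + t = 1 / w"
  proof -
    have "t * (norm u - 1) = R - 1" using u0 by (simp add: t_def)
    then have "(1 - t) + t * norm u = R" by (simp add: algebra_simps)
    moreover have "(1 - t) / norm u + t = ((1 - t) + t * norm u) / norm u"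
      using un by (simp add: add_divide_distrib)
    ultimately have "(1 - t) / norm u + t = R / norm u" by simp
    then show ?thesis using R un by (simp add: w)
  qed
  ultimately have "v = (1 - t) *\<^sub>R e + t *\<^sub>R u" by (simp add: v_def)
  then have cv: "L x v \<le> (1 - t) * L x e + t * L x u" using L_convex[of t x e u] t by simp
  have "E * (R - 1) \<le> L x v - R * L x e"
  proof -
    have "R * L x e \<le> R * M" using e[OF ne] R by (intro mult_left_mono) auto
    then show ?thesis using coercive[where x = x and u = v] nv large by simp
  qed
  then have "(w - 1) * (E * (R - 1)) \<le> (w - 1) * (L x v - R * L x e)" using w1 by (intro mult_left_mono) auto
  then have "E * (w - 1) * (R - 1) + w * (R - 1) * L x v \<le> (w - 1) * (L x v - R * L x e) + w * (R - 1) * L x v"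
    by (simp add: algebra_simps)
  also have "\<dots> = (w * R - 1) * L x v - (w * R - R) * L x e" by (simp add: algebra_simps)
  also have "w * R = norm u" using R by (simp add: w)
  also have "(norm u - 1) * L x v - (norm u - R) * L x e \<le> (R - 1) * L x u"
  proof -
    have "(norm u - 1) * L x v \<le> (norm u - 1) * ((1 - t) * L x e + t * L x u)"
      using cv u0 by (intro mult_left_mono) auto
    also have "\<dots> = ((norm u - 1) - (norm u - 1) * t) * L x e + ((norm u - 1) * t) * L x u"
      by (simp add: algebra_simps)
    also have "(norm u - 1) * t = R - 1" using u0 by (simp add: t_def)
    finally show ?thesis by simp
  qed
  finally have "(R - 1) * (E * (w - 1) + w * L x v) \<le> (R - 1) * L x u" by (simp add: algebra_simps)
  then have "E * (w - 1) + w * L x v \<le> L x u" using R by (simp add: mult_le_cancel_left)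
  then show ?thesis by (simp add: v_def)
qed

lemma speed_tradeoff:
  "\<exists>R>1. \<exists>E. R \<ge> R0 \<and> (\<forall>x u w. (norm u \<ge> R \<and> w = norm u / R) \<or> (norm u \<le> r \<and> 1 / 2 \<le> w \<and> w \<le> 1) \<or> w = 1 \<longrightarrow>
     w * L x ((1 / w) *\<^sub>R u) \<le> L x u - E * (w - 1))"
proof -
  obtain M where M: "M \<ge> 0" "\<And>x u. norm u \<le> max 1 (2 * r) \<Longrightarrow> \<bar>L x u\<bar> \<le> M" using L_bounded by blast
  \<comment> \<open>Collects the constants of K2 + R * M + 3 * M * (R - 1) into one multiple of
    \<open>R\<close>, using R \<ge> 1. The common price E is 3 * M, the one paid on slow
    pieces.\<close>
  define B where "B = \<bar>K2\<bar> + 4 * M"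
  define R where "R = max (max R0 2) ((B / K1) powr (1 / (\<sigma> - 1)))"
  have R: "R > 1" "R \<ge> R0" "R \<ge> (B / K1) powr (1 / (\<sigma> - 1))" by (auto simp: R_def)
  have B0: "B \<ge> 0" using M by (simp add: B_def)
  have "K2 + R * M + 3 * M * (R - 1) \<le> B * R"
  proof -
    have "K2 \<le> \<bar>K2\<bar> * R" using R(1) mult_left_mono[of 1 R "\<bar>K2\<bar>"] by simp
    moreover have "M * R \<ge> 0" using M R by simp
    ultimately show ?thesis using M(1) by (simp add: B_def algebra_simps)
  qed
  also have "\<dots> \<le> K1 * R powr \<sigma>" by (rule powr_dominates[OF B0 R(3)])
  finally have large: "K1 * R powr \<sigma> \<ge> K2 + R * M + 3 * M * (R - 1)" .
  have e1: "L x e \<le> M" if "norm e = 1" for x e using M(2)[of e x] that by (simp add: abs_le_iff)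
  have "w * L x ((1 / w) *\<^sub>R u) \<le> L x u - 3 * M * (w - 1)"
    if "(norm u \<ge> R \<and> w = norm u / R) \<or> (norm u \<le> r \<and> 1 / 2 \<le> w \<and> w \<le> 1) \<or> w = 1" for x u w
    using that
  proof (elim disjE conjE)
    assume "norm u \<ge> R" "w = norm u / R"
    then show ?thesis by (intro fast_piece_cost[OF R(1) _ e1 large])
  next
    assume *: "norm u \<le> r" "1 / 2 \<le> w" "w \<le> 1"
    then show ?thesis using norm_ge_zero[of u]
      by (intro slow_piece_cost M(2)) (simp_all add: max_def)
  qed simp
  then show ?thesis using R by blast
qed

text \<open>\<open>w t\<close> is the new time spent per unit of old time. By the bound on the mean
  speed, the speed is at most 2 M during at least half of the time, whereas limiting it to
  \<open>R\<close> takes at most a quarter of the time in addition. A common factor of at least 1/2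
  on the slow set therefore recovers the excess exactly.\<close>

lemma time_change_weight:
  fixes v :: "real \<Rightarrow> real^'m"
  assumes T: "T > 0" and v [measurable]: "v \<in> borel_measurable borel"
    and vint: "set_integrable lborel {a..a + T} (\<lambda>t. norm (v t))"
    and mean: "integral {a..a + T} (\<lambda>t. norm (v t)) \<le> M * T" and M: "M > 0" and R: "R \<ge> 4 * M"
  shows "\<exists>w. w \<in> borel_measurable borel \<and> (\<forall>t. 1 / 2 \<le> w t) \<and> (\<forall>t. t \<notin> {a..a + T} \<longrightarrow> w t = 1) \<and>
    (\<forall>t\<in>{a..a + T}. (norm (v t) \<ge> R \<and> w t = norm (v t) / R) \<or> (norm (v t) \<le> 2 * M \<and> 1 / 2 \<le> w t \<and> w t \<le> 1) \<or> w t = 1) \<and>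
    (\<forall>t\<in>{a..a + T}. norm ((1 / w t) *\<^sub>R v t) \<le> R) \<and>
    set_integrable lborel {a..a + T} w \<and> integral {a..a + T} w = T"
proof -
  let ?I = "{a..a + T}"
  have R0: "R > 0" using M R by linarith
  \<comment> \<open>\<open>\<phi>\<close> is the extra time on fast pieces; \<open>\<xi>\<close>
    marks the slow ones, where time is saved.\<close>
  define \<phi> where "\<phi> t = max 0 (norm (v t) / R - 1)" for t
  define \<xi> :: "real \<Rightarrow> real" where "\<xi> t = (if norm (v t) \<le> 2 * M then 1 else 0)" for t
  have [measurable]: "\<phi> \<in> borel_measurable borel" "\<xi> \<in> borel_measurable borel"
    unfolding \<phi>_def \<xi>_def by measurable
  have \<phi>0: "0 \<le> \<phi> t" "\<phi> t \<le> norm (v t) / R" for t using R0 by (auto simp: \<phi>_def max_def)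
  have \<phi>i: "set_integrable lborel ?I \<phi>"
    unfolding set_integrable_def
  proof (rule Bochner_Integration.integrable_bound[where f = "\<lambda>t. (1 / R) * (indicator ?I t *\<^sub>R norm (v t))"])
    show "integrable lborel (\<lambda>t. (1 / R) * (indicator ?I t *\<^sub>R norm (v t)))"
      using vint unfolding set_integrable_def by (rule integrable_mult_right)
    show "AE t in lborel. norm (indicator ?I t *\<^sub>R \<phi> t) \<le> norm ((1 / R) * (indicator ?I t *\<^sub>R norm (v t)))"
      using \<phi>0 R0 by (intro AE_I2) (auto simp: indicator_def)
  qed measurable
  have \<xi>i: "set_integrable lborel ?I \<xi>"
    by (rule bounded_borel_set_integrable[where B = 1]) (auto simp: \<xi>_def)
  note [simp] = set_borel_integral_eq_integral(1)[OF \<phi>i] set_borel_integral_eq_integral(1)[OF \<xi>i] set_borel_integral_eq_integral(1)[OF vint]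
  define F where "F = integral ?I \<phi>"
  define A where "A = integral ?I \<xi>"
  have F: "0 \<le> F" "F \<le> T / 4"
  proof -
    show "0 \<le> F" unfolding F_def using \<phi>0(1) by (intro integral_nonneg) auto
    have "F \<le> integral ?I (\<lambda>t. norm (v t) / R)"
      unfolding F_def using \<phi>0(2) by (intro integral_le) (auto intro: integrable_on_divide)
    also have "\<dots> = integral ?I (\<lambda>t. norm (v t)) / R" by simp
    also have "\<dots> \<le> M * T / R" using mean R0 by (intro divide_right_mono) auto
    also have "\<dots> \<le> T / 4"
    proof -
      have "4 * M * T \<le> R * T" using R T by (intro mult_right_mono) auto
      then show ?thesis using R0 by (simp add: pos_divide_le_eq field_simps)
    qed
    finally show "F \<le> T / 4" .
  qed
  have A: "A \<ge> T / 2"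
  proof -
    \<comment> \<open>Markov's inequality: the integrand is at most the indicator of speeds up to 2
      M.\<close>
    have "integral ?I (\<lambda>t. 1 - norm (v t) / (2 * M)) \<le> A"
      unfolding A_def
    proof (rule integral_le)
      show "(\<lambda>t. 1 - norm (v t) / (2 * M)) integrable_on ?I" by (intro integrable_diff integrable_on_divide) auto
      show "1 - norm (v t) / (2 * M) \<le> \<xi> t" for t using M by (auto simp: \<xi>_def field_simps)
    qed simp
    also have "integral ?I (\<lambda>t. 1 - norm (v t) / (2 * M)) = T - integral ?I (\<lambda>t. norm (v t)) / (2 * M)"
      using T by (subst Henstock_Kurzweil_Integration.integral_diff) (auto intro: integrable_on_divide)
    finally have "T - integral ?I (\<lambda>t. norm (v t)) / (2 * M) \<le> A" .
    moreover have "integral ?I (\<lambda>t. norm (v t)) / (2 * M) \<le> M * T / (2 * M)" using mean M by (intro divide_right_mono) auto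
    moreover have "M * T / (2 * M) = T / 2" using M by simp
    ultimately show ?thesis by linarith
  qed
  have A0: "A > 0" using A T by linarith
  \<comment> \<open>Determined by F = (1 - \<kappa>) A: the time saved equals the time
    added.\<close>
  define \<kappa> where "\<kappa> = 1 - F / A"
  have FA: "0 \<le> F / A" "F / A \<le> 1 / 2"
  proof -
    show "0 \<le> F / A" using F A0 by simp
    have "2 * F \<le> A" using F A by linarith
    then show "F / A \<le> 1 / 2" using A0 by (simp add: pos_divide_le_eq)
  qed
  have \<kappa>: "1 / 2 \<le> \<kappa>" "\<kappa> \<le> 1" using FA by (auto simp: \<kappa>_def)
  have sep: "2 * M < R" using M R by linarith
  define w where "w t = (if t \<in> ?I then 1 + \<phi> t - (1 - \<kappa>) * \<xi> t else 1)" for t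
  have w_cases: "(norm (v t) \<ge> R \<and> w t = norm (v t) / R) \<or> (norm (v t) \<le> 2 * M \<and> w t = \<kappa>) \<or> (norm (v t) \<le> R \<and> w t = 1)" if "t \<in> ?I" for t
  proof -
    consider "norm (v t) \<ge> R" | "norm (v t) \<le> 2 * M" | "2 * M < norm (v t)" "norm (v t) < R" by linarith
    then show ?thesis
    proof cases
      case 1
      then show ?thesis using that sep R0 by (auto simp: w_def \<phi>_def \<xi>_def max_def)
    next
      case 2
      then have "norm (v t) / R \<le> 1" using sep R0 by simp
      then show ?thesis using that 2 by (auto simp: w_def \<phi>_def \<xi>_def max_def)
    next
      case 3
      then have "norm (v t) / R \<le> 1" using R0 by simp
      then show ?thesis using that 3 by (auto simp: w_def \<phi>_def \<xi>_def max_def)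
    qed
  qed
  have w_pos: "1 / 2 \<le> w t" for t
  proof (cases "t \<in> ?I")
    case True
    show ?thesis
      using w_cases[OF True]
    proof (elim disjE conjE)
      assume "R \<le> norm (v t)" "w t = norm (v t) / R"
      then have "1 \<le> w t" using R0 by simp
      then show ?thesis by simp
    qed (use \<kappa>(1) in auto)
  qed (auto simp: w_def)
  have w_bound: "norm ((1 / w t) *\<^sub>R v t) \<le> R" if "t \<in> ?I" for t
    using w_cases[OF that]
  proof (elim disjE conjE)
    assume *: "norm (v t) \<ge> R" "w t = norm (v t) / R"
    then have "norm (v t) > 0" using R0 by linarith
    then have "v t \<noteq> 0" by simp
    then show ?thesis using * R0 by simp
  next
    assume *: "norm (v t) \<le> 2 * M" "w t = \<kappa>"
    have "norm (v t) \<le> \<kappa> * R"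
    proof -
      have "1 / 2 * R \<le> \<kappa> * R" using \<kappa> R0 by (intro mult_right_mono) auto
      then show ?thesis using *(1) R by linarith
    qed
    then show ?thesis using *(2) \<kappa> by (simp add: pos_divide_le_eq mult.commute)
  qed simp
  have wm: "w \<in> borel_measurable borel" unfolding w_def by measurable
  have wi: "set_integrable lborel ?I (\<lambda>t. 1 + \<phi> t - (1 - \<kappa>) * \<xi> t)"
    by (intro set_integral_diff set_integral_add set_integrable_mult_right \<phi>i \<xi>i
        bounded_borel_set_integrable[where B = 1]) auto
  have eq: "indicator ?I t *\<^sub>R w t = indicator ?I t *\<^sub>R (1 + \<phi> t - (1 - \<kappa>) * \<xi> t)" for t
    by (auto simp add: w_def indicator_def)
  have wi': "set_integrable lborel ?I w" using wi unfolding set_integrable_def eq .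
  have "integral ?I w = integral ?I (\<lambda>t. 1 + \<phi> t - (1 - \<kappa>) * \<xi> t)"
    by (intro Henstock_Kurzweil_Integration.integral_cong) (simp add: w_def)
  also have "\<dots> = integral ?I (\<lambda>t. 1 + \<phi> t) - integral ?I (\<lambda>t. (1 - \<kappa>) * \<xi> t)"
    by (intro Henstock_Kurzweil_Integration.integral_diff integrable_add integrable_on_mult_right) auto
  also have "\<dots> = T + F - (1 - \<kappa>) * A"
    using T Henstock_Kurzweil_Integration.integral_add[OF integrable_const_ivl set_borel_integral_eq_integral(1)[OF \<phi>i], of 1]
    by (simp add: F_def A_def)
  also have "\<dots> = T" using A0 by (simp add: \<kappa>_def)
  finally have "integral ?I w = T" .
  moreover have "(norm (v t) \<ge> R \<and> w t = norm (v t) / R) \<or> (norm (v t) \<le> 2 * M \<and> 1 / 2 \<le> w t \<and> w t \<le> 1) \<or> w t = 1"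
    if "t \<in> ?I" for t
    using w_cases[OF that] \<kappa> by auto
  moreover have "w t = 1" if "t \<notin> ?I" for t using that by (auto simp: w_def)
  ultimately show ?thesis using wm w_pos w_bound wi' by (intro exI[of _ w] conjI) blast+
qed

section \<open>Admissible pairs and their reparametrization\<close>

lemma admissible_integral:
  assumes adm: "admissible f \<gamma> u a b" and cd: "a \<le> c" "c \<le> d" "d \<le> b"
  shows "((\<lambda>s. Fmap f (\<gamma> s) (u s)) has_integral \<gamma> d - \<gamma> c) {c..d}"
proof -
  obtain N where N: "negligible N" "\<And>t. t \<in> {a..b} - N \<Longrightarrow> (\<gamma> has_vector_derivative Fmap f (\<gamma> t) (u t)) (at t)"
    using adm unfolding admissible_def by blast
  show ?thesis
  proof (rule fundamental_theorem_of_calculus_abs_cont[OF cd(2) _ N(1)])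
    show "abs_cont_on \<gamma> c d" using adm cd abs_cont_on_subinterval by (auto simp: admissible_def)
    fix t assume "t \<in> {c..d} - N"
    then have "t \<in> {a..b} - N" using cd by auto
    from has_vector_derivative_at_within[OF N(2)[OF this]]
    show "(\<gamma> has_vector_derivative Fmap f (\<gamma> t) (u t)) (at t within {c..d})" .
  qed
qed

lemma bounded_traj_admissible:
  assumes "bounded_traj f R \<gamma> u"
  shows "admissible f \<gamma> u a b"
  unfolding admissible_def
proof (intro conjI)
  show "abs_cont_on \<gamma> a b"
    by (rule lipschitz_imp_abs_cont_on[OF bounded_traj_lipschitz[OF assms]])
  have um: "u \<in> borel_measurable borel" and uR: "norm (u s) \<le> R" for s using assms by (auto simp: bounded_traj_def)
  have "u \<in> borel_measurable (lebesgue_on {a..b})"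
    using um by (intro measurable_restrict_space1 measurable_completion) simp
  moreover have "(\<lambda>t. norm (u t) ^ 2) integrable_on {a..b}"
  proof (rule bounded_borel_integrable[where B = "R ^ 2"])
    show "(\<lambda>t. norm (u t) ^ 2) \<in> borel_measurable borel" using um by measurable
    show "norm (norm (u s) ^ 2) \<le> R ^ 2" for s using power_mono[OF uR[of s], of 2] by simp
  qed
  ultimately show "L2_on u a b" by (simp add: L2_on_def)
  have "\<exists>N. negligible N \<and> (\<forall>x. x \<notin> N \<longrightarrow> (\<gamma> has_vector_derivative Fmap f (\<gamma> x) (u x)) (at x))"
    by (rule lebesgue_differentiation) (use assms in \<open>auto simp: bounded_traj_def\<close>)
  then show "\<exists>N. negligible N \<and> (\<forall>t\<in>{a..b} - N. (\<gamma> has_vector_derivative Fmap f (\<gamma> t) (u t)) (at t))" by blast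
qed

text \<open>The new pair runs through the same curve in the same total time, and its action is the
  integral of w L(\<gamma>, v / w). The bound w L(\<gamma>, v / w) \<le> L(\<gamma>, v) - E (w - 1)
  integrates to the claim because \<open>w\<close> has mean 1. \<open>R\<close> is chosen from the
  mean cost \<open>C\<close> before the interval and the pair.\<close>

theorem reparametrize:
  "\<exists>R\<ge>0. \<forall>a T \<gamma> u. T > 0 \<and> admissible f \<gamma> u a (a + T) \<and> (\<lambda>s. L (\<gamma> s) (u s)) integrable_on {a..a + T} \<and>
      integral {a..a + T} (\<lambda>s. L (\<gamma> s) (u s)) \<le> C * T \<longrightarrow>
    (\<exists>\<gamma>' u'. bounded_traj f R \<gamma>' u' \<and> \<gamma>' 0 = \<gamma> a \<and> \<gamma>' T = \<gamma> (a + T) \<and>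
      act \<gamma>' u' 0 T \<le> integral {a..a + T} (\<lambda>s. L (\<gamma> s) (u s)))"
proof -
  obtain b where b: "\<And>x u. norm u - b \<le> L x u" using L_linear_bound by blast
  \<comment> \<open>Since L \<ge> |u| - b, a mean cost of at most \<open>C\<close> forces a mean
    speed of at most C + b; the modulus and the 1 make the bound positive.\<close>
  define M where "M = \<bar>C + b\<bar> + 1"
  have M: "M > 0" "C + b \<le> M" by (auto simp: M_def)
  obtain R E where R: "R > 1" "R \<ge> 4 * M" and trade: "\<And>x u w. (norm u \<ge> R \<and> w = norm u / R) \<or> (norm u \<le> 2 * M \<and> 1 / 2 \<le> w \<and> w \<le> 1) \<or> w = 1 \<Longrightarrow>
     w * L x ((1 / w) *\<^sub>R u) \<le> L x u - E * (w - 1)"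
    using speed_tradeoff[of "4 * M" "2 * M"] by blast
  have "\<exists>\<gamma>' u'. bounded_traj f R \<gamma>' u' \<and> \<gamma>' 0 = \<gamma> a \<and> \<gamma>' T = \<gamma> (a + T) \<and>
      act \<gamma>' u' 0 T \<le> integral {a..a + T} (\<lambda>s. L (\<gamma> s) (u s))"
    if T: "T > 0" and adm: "admissible f \<gamma> u a (a + T)" and Li: "(\<lambda>s. L (\<gamma> s) (u s)) integrable_on {a..a + T}"
      and Lb: "integral {a..a + T} (\<lambda>s. L (\<gamma> s) (u s)) \<le> C * T" for a T \<gamma> u
  proof -
    let ?I = "{a..a + T}"
    have um: "u \<in> borel_measurable (lebesgue_on ?I)" and ac: "abs_cont_on \<gamma> a (a + T)"
      using adm by (auto simp: admissible_def L2_on_def)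
    obtain v N where v [measurable]: "v \<in> borel_measurable borel" and N: "negligible N" "\<And>t. t \<in> ?I - N \<Longrightarrow> v t = u t"
      and v0: "\<And>t. t \<notin> ?I \<Longrightarrow> v t = 0"
      using lebesgue_on_borel_version[OF um] by blast
    have spike: "(h v has_integral i) ?I" if "(h u has_integral i) ?I" and "\<And>t. v t = u t \<Longrightarrow> h v t = h u t"
      for h :: "(real \<Rightarrow> real^'m) \<Rightarrow> real \<Rightarrow> real" and i
      by (rule has_integral_spike[OF N(1) _ that(1)]) (use N(2) that(2) in auto)
    have Lv: "((\<lambda>s. L (\<gamma> s) (v s)) has_integral integral ?I (\<lambda>s. L (\<gamma> s) (u s))) ?I"
      using spike[of "\<lambda>v s. L (\<gamma> s) (v s)"] integrable_integral[OF Li] by auto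
    have vabs: "(\<lambda>t. norm (v t)) absolutely_integrable_on ?I"
    proof (rule measurable_bounded_by_integrable_imp_absolutely_integrable)
      show "(\<lambda>t. norm (v t)) \<in> borel_measurable (lebesgue_on ?I)"
        by (intro measurable_restrict_space1 measurable_completion) simp
      show "(\<lambda>t. L (\<gamma> t) (v t) + b) integrable_on ?I" using Lv by (intro integrable_add) auto
      show "norm (norm (v t)) \<le> L (\<gamma> t) (v t) + b" for t using b[of "v t" "\<gamma> t"] by simp
    qed simp
    have vint: "set_integrable lborel ?I (\<lambda>t. norm (v t))"
      using vabs unfolding set_integrable_def by (subst (asm) integrable_completion) auto
    have mean: "integral ?I (\<lambda>t. norm (v t)) \<le> M * T"
    proof -
      have "integral ?I (\<lambda>t. norm (v t)) \<le> integral ?I (\<lambda>t. L (\<gamma> t) (v t) + b)"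
      proof (rule integral_le)
        show "norm (v t) \<le> L (\<gamma> t) (v t) + b" for t using b[of "v t" "\<gamma> t"] by simp
      qed (use Lv set_borel_integral_eq_integral(1)[OF vint] in \<open>auto intro!: integrable_add\<close>)
      also have "\<dots> = integral ?I (\<lambda>s. L (\<gamma> s) (u s)) + b * T"
        using Lv T by (subst Henstock_Kurzweil_Integration.integral_add) (auto simp: has_integral_iff)
      also have "\<dots> \<le> (C + b) * T" using Lb by (simp add: algebra_simps)
      also have "\<dots> \<le> M * T" using M T by (intro mult_right_mono) auto
      finally show ?thesis .
    qed
    obtain w where w [measurable]: "w \<in> borel_measurable borel" and w2: "\<And>t. 1 / 2 \<le> w t" and w1: "\<And>t. t \<notin> ?I \<Longrightarrow> w t = 1"
      and wc: "\<And>t. t \<in> ?I \<Longrightarrow> (norm (v t) \<ge> R \<and> w t = norm (v t) / R) \<or> (norm (v t) \<le> 2 * M \<and> 1 / 2 \<le> w t \<and> w t \<le> 1) \<or> w t = 1"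
      and wb: "\<And>t. t \<in> ?I \<Longrightarrow> norm ((1 / w t) *\<^sub>R v t) \<le> R"
      and wi: "set_integrable lborel ?I w" and wT: "integral ?I w = T"
      using time_change_weight[OF T v vint mean M(1) R(2)] by blast
    have w0: "0 \<le> w t" "w t \<noteq> 0" for t using w2[of t] by auto
    have vb: "norm ((1 / w t) *\<^sub>R v t) \<le> R" for t
      using wb[of t] v0[of t] R(1) by (cases "t \<in> ?I") auto
    have wint: "w integrable_on {p..q}" for p q
    proof -
      have "(\<lambda>t. if t \<in> ?I then w t - 1 else 0) integrable_on UNIV"
        unfolding integrable_restrict_UNIV using set_borel_integral_eq_integral(1)[OF wi] by (intro integrable_diff) auto
      moreover have "(\<lambda>t. if t \<in> ?I then w t - 1 else 0) = (\<lambda>t. w t - 1)" using w1 by auto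
      ultimately have "(\<lambda>t. w t - 1) integrable_on {p..q}"
        using integrable_on_subinterval[of "\<lambda>t. w t - 1" UNIV p q] by simp
      from integrable_add[OF this integrable_const_ivl[of 1]] show ?thesis by simp
    qed
    define \<theta> where "\<theta> t = primitive w t - primitive w a" for t
    have thint: "(w has_integral \<theta> q - \<theta> p) {p..q}" if "p \<le> q" for p q
      using primitive_has_integral[OF wint that] by (simp add: \<theta>_def)
    have slope: "1 / 2 * (q - p) \<le> \<theta> q - \<theta> p" if "p \<le> q" for p q
      using has_integral_le[OF has_integral_const_real[of "1 / 2" p q] thint[OF that]] w2 that by simp
    have thc: "continuous_on UNIV \<theta>"
      unfolding \<theta>_def by (intro continuous_on_diff primitive_continuous wint continuous_on_const)
    have th0: "\<theta> a = 0" by (simp add: \<theta>_def)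
    have thT: "\<theta> (a + T) = T" using thint[of a "a + T"] th0 wT T by (simp add: has_integral_iff)
    obtain \<beta> where \<beta>: "\<And>s t. \<beta> s \<le> t \<longleftrightarrow> s \<le> \<theta> t" "\<And>s t. t \<le> \<beta> s \<longleftrightarrow> \<theta> t \<le> s" "\<And>s. \<theta> (\<beta> s) = s" "\<And>t. \<beta> (\<theta> t) = t"
      using increasing_homeomorphism_inverse[of "1 / 2" \<theta>] slope thc by auto
    note change = has_integral_time_change[OF \<beta>(1,2) w w0(1) thint]
    have [measurable]: "\<beta> \<in> borel_measurable borel" by (rule distr_inverse_density(1)[OF \<beta>(1,2) w w0(1) thint])
    \<comment> \<open>Outside the interval the curve is frozen at its endpoints, matching v = 0 and
      w = 1 there.\<close>
    define clip where "clip t = max a (min (a + T) t)" for t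
    define g where "g t = \<gamma> (clip t)" for t
    have clip: "clip t \<in> ?I" "t \<in> ?I \<Longrightarrow> clip t = t" for t using T by (auto simp: clip_def)
    have clipc: "continuous_on UNIV clip" unfolding clip_def by (intro continuous_intros)
    have gc: "continuous_on UNIV g"
      unfolding g_def by (rule continuous_on_compose2[OF abs_cont_on_imp_continuous_on[OF ac] clipc]) (use clip in auto)
    then have gm [measurable]: "g \<in> borel_measurable borel" by (rule borel_measurable_continuous_onI)
    define \<gamma>' where "\<gamma>' s = g (\<beta> s)" for s
    define u' where "u' s = (1 / w (\<beta> s)) *\<^sub>R v (\<beta> s)" for s
    have sm: "(\<lambda>t. (1 / w t) *\<^sub>R v t) \<in> borel_measurable borel" by measurable
    have traj: "bounded_traj f R \<gamma>' u'"
      unfolding bounded_traj_def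
    proof (intro conjI allI impI)
      show "u' \<in> borel_measurable borel" unfolding u'_def by measurable
      show "norm (u' s) \<le> R" for s unfolding u'_def by (rule vb)
      fix s1 s2 :: real assume s: "s1 \<le> s2"
      define p where "p = \<beta> s1"
      define q where "q = \<beta> s2"
      have pq: "p \<le> q" unfolding p_def q_def using \<beta>(1)[of s1 "\<beta> s2"] \<beta>(3)[of s2] s by simp
      \<comment> \<open>The velocity is linear in the control, so the change of speed cancels
        against the change of time.\<close>
      have Fv: "w t *\<^sub>R Fmap f (g t) ((1 / w t) *\<^sub>R v t) = Fmap f (g t) (v t)" for t
        using w0(2)[of t] by (simp add: Fmap_scaleR)
      have Fint: "set_integrable lborel {p..q} (\<lambda>t. Fmap f (g t) (v t))"
        unfolding set_integrable_def
      proof (rule Bochner_Integration.integrable_bound[where f = "\<lambda>t. speed * (indicator ?I t *\<^sub>R norm (v t))"])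
        show "integrable lborel (\<lambda>t. speed * (indicator ?I t *\<^sub>R norm (v t)))"
          using vint unfolding set_integrable_def by (rule integrable_mult_right)
        have "(\<lambda>t. Fmap f (g t) (v t)) \<in> borel_measurable borel" by (rule borel_pair[OF continuous_Fmap gm v])
        then show "(\<lambda>t. indicator {p..q} t *\<^sub>R Fmap f (g t) (v t)) \<in> borel_measurable lborel" by measurable
        show "AE t in lborel. norm (indicator {p..q} t *\<^sub>R Fmap f (g t) (v t)) \<le> norm (speed * (indicator ?I t *\<^sub>R norm (v t)))"
        proof (rule AE_I2)
          fix t
          show "norm (indicator {p..q} t *\<^sub>R Fmap f (g t) (v t)) \<le> norm (speed * (indicator ?I t *\<^sub>R norm (v t)))"
            using speed(2)[of "g t" "v t"] speed(1) v0[of t] by (auto simp: indicator_def)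
        qed
      qed
      have FI: "((\<lambda>t. Fmap f (g t) (v t)) has_integral g q - g p) {p..q}"
      proof -
        have cpq: "a \<le> clip p" "clip p \<le> clip q" "clip q \<le> a + T" using pq T by (auto simp: clip_def)
        have base: "((\<lambda>t. Fmap f (\<gamma> t) (u t)) has_integral g q - g p) {clip p..clip q}"
          unfolding g_def by (rule admissible_integral[OF adm cpq])
        have eq: "Fmap f (g t) (v t) = Fmap f (\<gamma> t) (u t)" if "t \<in> {clip p..clip q} - N" for t
          using that cpq clip(2)[of t] N(2)[of t] by (simp add: g_def)
        have 1: "((\<lambda>t. Fmap f (g t) (v t)) has_integral g q - g p) {clip p..clip q}"
          by (rule has_integral_spike[OF N(1) eq base])
        have 2: "(\<lambda>t. Fmap f (g t) (v t)) = (\<lambda>t. if t \<in> ?I then Fmap f (g t) (v t) else 0)"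
          using v0 by auto
        show ?thesis
        proof (cases "q < a \<or> a + T < p")
          case True
          then have "clip p = clip q" using pq T by (auto simp: clip_def)
          then have "g q - g p = 0" by (simp add: g_def)
          moreover have "Fmap f (g t) (v t) = 0" if "t \<in> {p..q}" for t using True that v0[of t] by auto
          ultimately show ?thesis by (simp only:) (rule has_integral_is_0)
        next
          case False
          then have "?I \<inter> {p..q} = {clip p..clip q}" using pq T by (auto simp: clip_def max_def min_def)
          with 1 show ?thesis by (subst 2) (simp only: has_integral_restrict_Int)
        qed
      qed
      have "((\<lambda>s. Fmap f (g (\<beta> s)) ((1 / w (\<beta> s)) *\<^sub>R v (\<beta> s))) has_integral integral {p..q} (\<lambda>t. w t *\<^sub>R Fmap f (g t) ((1 / w t) *\<^sub>R v t))) {\<theta> p..\<theta> q}"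
        by (rule change[of "\<lambda>t. Fmap f (g t) ((1 / w t) *\<^sub>R v t)"])
           (use Fint in \<open>simp_all only: Fv borel_pair[OF continuous_Fmap gm sm]\<close>)
      then show "((\<lambda>s. Fmap f (\<gamma>' s) (u' s)) has_integral \<gamma>' s2 - \<gamma>' s1) {s1..s2}"
        unfolding Fv integral_unique[OF FI] by (simp add: \<gamma>'_def u'_def p_def q_def \<beta>(3))
    qed
    have ends: "\<gamma>' 0 = \<gamma> a" "\<gamma>' T = \<gamma> (a + T)"
      using \<beta>(4)[of a] \<beta>(4)[of "a + T"] th0 thT clip(2)[of a] clip(2)[of "a + T"] T by (simp_all add: \<gamma>'_def g_def)
    obtain B where B: "\<And>x (u :: real^'m). norm u \<le> R \<Longrightarrow> \<bar>L x u\<bar> \<le> B" using L_bounded by blast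
    let ?h = "\<lambda>t. L (g t) ((1 / w t) *\<^sub>R v t)"
    have hm: "?h \<in> borel_measurable borel" by (rule borel_pair[OF continuous_L gm sm])
    have hi: "set_integrable lborel ?I (\<lambda>t. w t *\<^sub>R ?h t)"
      unfolding set_integrable_def
    proof (rule Bochner_Integration.integrable_bound[where f = "\<lambda>t. B * (indicator ?I t *\<^sub>R w t)"])
      show "integrable lborel (\<lambda>t. B * (indicator ?I t *\<^sub>R w t))"
        using wi unfolding set_integrable_def by (rule integrable_mult_right)
      show "(\<lambda>t. indicator ?I t *\<^sub>R (w t *\<^sub>R ?h t)) \<in> borel_measurable lborel" using hm by measurable
      show "AE t in lborel. norm (indicator ?I t *\<^sub>R (w t *\<^sub>R ?h t)) \<le> norm (B * (indicator ?I t *\<^sub>R w t))"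
      proof (rule AE_I2)
        fix t
        have "w t * \<bar>?h t\<bar> \<le> w t * \<bar>B\<bar>" using B[OF vb[of t], of "g t"] w0(1)[of t] by (intro mult_left_mono) auto
        then show "norm (indicator ?I t *\<^sub>R (w t *\<^sub>R ?h t)) \<le> norm (B * (indicator ?I t *\<^sub>R w t))"
          using w0(1)[of t] by (auto simp: indicator_def abs_mult mult.commute)
      qed
    qed
    have "((\<lambda>s. ?h (\<beta> s)) has_integral integral ?I (\<lambda>t. w t *\<^sub>R ?h t)) {\<theta> a..\<theta> (a + T)}"
      by (rule change[OF _ hm hi])
    then have "act \<gamma>' u' 0 T = integral ?I (\<lambda>t. w t *\<^sub>R ?h t)"
      unfolding th0 thT act_def \<gamma>'_def u'_def by (rule integral_unique)
    also have "\<dots> \<le> integral ?I (\<lambda>t. L (\<gamma> t) (v t) - E * (w t - 1))"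
    proof (rule integral_le)
      show "(\<lambda>t. w t *\<^sub>R ?h t) integrable_on ?I" by (rule set_borel_integral_eq_integral(1)[OF hi])
      show "(\<lambda>t. L (\<gamma> t) (v t) - E * (w t - 1)) integrable_on ?I"
        using Lv wint by (intro integrable_diff integrable_on_mult_right) auto
      show "w t *\<^sub>R ?h t \<le> L (\<gamma> t) (v t) - E * (w t - 1)" if "t \<in> ?I" for t
        using trade[OF wc[OF that], of "\<gamma> t"] clip(2)[OF that] by (simp add: g_def)
    qed
    also have "\<dots> = integral ?I (\<lambda>t. L (\<gamma> t) (v t)) - integral ?I (\<lambda>t. E * (w t - 1))"
      using Lv wint by (intro Henstock_Kurzweil_Integration.integral_diff integrable_diff integrable_on_mult_right) auto
    also have "integral ?I (\<lambda>t. E * (w t - 1)) = E * (integral ?I w - T)"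
      using Henstock_Kurzweil_Integration.integral_diff[OF wint integrable_const_ivl, of a "a + T" 1] T by simp
    also have "integral ?I (\<lambda>t. L (\<gamma> t) (v t)) = integral ?I (\<lambda>s. L (\<gamma> s) (u s))" using Lv by (rule integral_unique)
    finally have "act \<gamma>' u' 0 T \<le> integral ?I (\<lambda>s. L (\<gamma> s) (u s))" by (simp add: wT)
    then show ?thesis using traj ends by blast
  qed
  then show ?thesis using R(1) by (intro exI[of _ R]) auto
qed

end

section \<open>The Peierls barrier\<close>

lemma Liminf_at_top_le_sequence:
  fixes F :: "real \<Rightarrow> ereal"
  assumes s: "filterlim s at_top sequentially" and le: "\<forall>\<^sub>F n in sequentially. F (s n) \<le> B"
  shows "Liminf at_top F \<le> B"
  unfolding Liminf_def
proof (rule SUP_least)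
  fix P :: "real \<Rightarrow> bool" assume "P \<in> {P. eventually P at_top}"
  then have "\<forall>\<^sub>F n in sequentially. P (s n)"
    using s by (simp add: filterlim_iff)
  with le have "\<forall>\<^sub>F n in sequentially. P (s n) \<and> F (s n) \<le> B" by eventually_elim auto
  from eventually_happens'[OF sequentially_bot this] obtain n where n: "P (s n) \<and> F (s n) \<le> B" ..
  show "Inf (F ` Collect P) \<le> B" by (rule INF_lower2[of "s n"]) (use n in auto)
qed

lemma Liminf_at_top_frequently:
  fixes F :: "real \<Rightarrow> ereal"
  assumes "Liminf at_top F < B"
  shows "\<exists>t\<ge>T. F t < B"
proof (rule ccontr)
  assume "\<not> ?thesis"
  then have "\<forall>\<^sub>F t in at_top. B \<le> F t" by (auto simp: eventually_at_top_linorder not_less intro!: exI[of _ T])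
  then have "B \<le> Liminf at_top F" by (rule Liminf_bounded)
  then show False using assms by simp
qed

lemma Liminf_at_top_shift_le:
  fixes F G :: "real \<Rightarrow> ereal"
  assumes FG: "\<And>t. t > 0 \<Longrightarrow> F (t + s) \<le> ereal c + G t"
  shows "Liminf at_top F \<le> ereal c + Liminf at_top G"
proof -
  have "eventually P (filtermap (\<lambda>t. t + s) at_top)" if "eventually P at_top" for P
  proof -
    obtain N where "\<And>t. t \<ge> N \<Longrightarrow> P t" using \<open>eventually P at_top\<close> by (auto simp: eventually_at_top_linorder)
    then have "\<And>t. t \<ge> N - s \<Longrightarrow> P (t + s)" by simp
    then show ?thesis by (auto simp: eventually_filtermap eventually_at_top_linorder)
  qed
  then have "Liminf at_top F \<le> Liminf (filtermap (\<lambda>t. t + s) at_top) F"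
    unfolding Liminf_def by (intro SUP_subset_mono) auto
  also have "\<dots> \<le> Liminf at_top (\<lambda>t. F (t + s))" by (rule Liminf_filtermap_le)
  also have "\<dots> \<le> Liminf at_top (\<lambda>t. ereal c + G t)"
  proof (rule Liminf_mono)
    show "\<forall>\<^sub>F t in at_top. F (t + s) \<le> ereal c + G t"
      using eventually_gt_at_top[of "0::real"] by eventually_elim (rule FG)
  qed
  also have "\<dots> = ereal c + Liminf at_top G" by (rule Liminf_add_ereal_left) auto
  finally show ?thesis .
qed

section \<open>Actions, gluing and the triangle inequality\<close>

context lagrangian_system
begin

lemma action_bounded_traj: "bounded_traj f R \<gamma> u \<Longrightarrow> action L \<gamma> u a b = ereal (act \<gamma> u a b)"
  using L_integrable[of R \<gamma> u a b] by (simp add: action_def act_def)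

lemma act_combine:
  assumes "bounded_traj f R \<gamma> u" "a \<le> b" "b \<le> c"
  shows "act \<gamma> u a b + act \<gamma> u b c = act \<gamma> u a c"
  unfolding act_def using assms L_integrable[OF assms(1)]
  by (intro Henstock_Kurzweil_Integration.integral_combine)

lemma act_shift: "act (\<lambda>s. \<gamma> (s + \<tau>)) (\<lambda>s. u (s + \<tau>)) a b = act \<gamma> u (a + \<tau>) (b + \<tau>)"
  unfolding act_def using integral_shift_real_ivl[of "a + \<tau>" \<tau> "b + \<tau>" "\<lambda>s. L (\<gamma> s) (u s)"] by simp

lemma L_shift: "intvec k \<Longrightarrow> L (x + k) = L x"
  using periodic_L by (simp add: periodic_def)

lemma act_shift_space: "intvec k \<Longrightarrow> act (\<lambda>s. \<gamma> s + k) u a b = act \<gamma> u a b"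
  by (simp add: act_def L_shift)

lemma act_cong: "(\<And>s. s \<in> {a..b} - {a, b} \<Longrightarrow> \<gamma> s = \<gamma>' s \<and> u s = u' s) \<Longrightarrow> act \<gamma> u a b = act \<gamma>' u' a b"
  unfolding act_def by (rule integral_spike[of "{a, b}"]) auto

lemma join_act:
  assumes 1: "bounded_traj f R \<gamma>1 u1" and 2: "bounded_traj f R \<gamma>2 u2"
    and eq: "intvec (\<gamma>1 S - \<gamma>2 0)" and S: "0 \<le> S" "0 \<le> T"
  shows "\<exists>\<gamma> u. bounded_traj f R \<gamma> u \<and> \<gamma> 0 = \<gamma>1 0 \<and> intvec (\<gamma> (S + T) - \<gamma>2 T) \<and> act \<gamma> u 0 (S + T) = act \<gamma>1 u1 0 S + act \<gamma>2 u2 0 T"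
proof -
  let ?k = "\<gamma>1 S - \<gamma>2 0"
  let ?g = "\<lambda>s. if s \<le> S then \<gamma>1 s else \<gamma>2 (s - S) + ?k" and ?u = "\<lambda>s. if s \<le> S then u1 s else u2 (s - S)"
  have tr: "bounded_traj f R ?g ?u" by (rule bounded_traj_join[OF 1 2 eq])
  have "act ?g ?u 0 S = act \<gamma>1 u1 0 S" by (rule act_cong) auto
  moreover have "act ?g ?u S (S + T) = act \<gamma>2 u2 0 T"
  proof -
    have "act ?g ?u S (S + T) = act (\<lambda>s. \<gamma>2 (s + - S) + ?k) (\<lambda>s. u2 (s + - S)) S (S + T)" by (rule act_cong) auto
    also have "\<dots> = act (\<lambda>s. \<gamma>2 (s + - S)) (\<lambda>s. u2 (s + - S)) S (S + T)" by (rule act_shift_space[OF eq])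
    also have "\<dots> = act \<gamma>2 u2 (S + - S) (S + T + - S)" by (rule act_shift)
    finally show ?thesis by simp
  qed
  ultimately have "act ?g ?u 0 (S + T) = act \<gamma>1 u1 0 S + act \<gamma>2 u2 0 T"
    using act_combine[OF tr, of 0 S "S + T"] S by simp
  moreover have "?g 0 = \<gamma>1 0" using S by simp
  moreover have "intvec (?g (S + T) - \<gamma>2 T)" using eq S by (auto simp: intvec_simps)
  ultimately show ?thesis using tr by (intro exI[of _ ?g] exI[of _ ?u] conjI)
qed

lemma Afun_le_act:
  assumes "bounded_traj f R \<gamma> u" "\<gamma> 0 = x" "intvec (\<gamma> t - y)"
  shows "Afun f L t x y \<le> ereal (act \<gamma> u 0 t)"
  unfolding Afun_def
  by (rule INF_lower2[of "(\<gamma>, u)"]) (use assms bounded_traj_admissible[OF assms(1)] action_bounded_traj[OF assms(1)] in auto)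

lemma action_less_infinity:
  assumes "action L \<gamma> u a b < \<infinity>"
  shows "(\<lambda>s. L (\<gamma> s) (u s)) integrable_on {a..b}" "action L \<gamma> u a b = ereal (integral {a..b} (\<lambda>s. L (\<gamma> s) (u s)))"
  using assms by (auto simp: action_def split: if_splits)

text \<open>Loops of any length whose cost is at most \<open>C\<close> times their duration have a
  common bound on their controls, since \<open>R\<close> depends on \<open>C\<close> alone.\<close>

lemma Afun_less_imp_traj:
  "\<exists>R\<ge>0. \<forall>t x y B. t > 0 \<and> B \<le> C * t \<and> Afun f L t x y < ereal B \<longrightarrow>
    (\<exists>\<gamma> u. bounded_traj f R \<gamma> u \<and> \<gamma> 0 = x \<and> intvec (\<gamma> t - y) \<and> act \<gamma> u 0 t \<le> B)"
proof -
  obtain R where R: "R \<ge> 0" and rep: "\<forall>a T \<gamma> u. T > 0 \<and> admissible f \<gamma> u a (a + T) \<and> (\<lambda>s. L (\<gamma> s) (u s)) integrable_on {a..a + T} \<and>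
      integral {a..a + T} (\<lambda>s. L (\<gamma> s) (u s)) \<le> C * T \<longrightarrow>
    (\<exists>\<gamma>' u'. bounded_traj f R \<gamma>' u' \<and> \<gamma>' 0 = \<gamma> a \<and> \<gamma>' T = \<gamma> (a + T) \<and>
      act \<gamma>' u' 0 T \<le> integral {a..a + T} (\<lambda>s. L (\<gamma> s) (u s)))"
    using reparametrize[of C] by (elim exE conjE)
  have "\<exists>\<gamma> u. bounded_traj f R \<gamma> u \<and> \<gamma> 0 = x \<and> intvec (\<gamma> t - y) \<and> act \<gamma> u 0 t \<le> B"
    if t: "t > 0" and B: "B \<le> C * t" and A: "Afun f L t x y < ereal B" for t x y B
  proof -
    from A obtain p where "p \<in> {(\<gamma>, u). admissible f \<gamma> u 0 t \<and> \<gamma> 0 = x \<and> intvec (\<gamma> t - y)}" "action L (fst p) (snd p) 0 t < ereal B"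
      unfolding Afun_def INF_less_iff ..
    moreover define \<gamma> u where "\<gamma> = fst p" and "u = snd p"
    ultimately have g: "admissible f \<gamma> u 0 t" "\<gamma> 0 = x" "intvec (\<gamma> t - y)" "action L \<gamma> u 0 t < ereal B"
      by (auto simp: case_prod_unfold)
    have "action L \<gamma> u 0 t < \<infinity>" by (rule less_trans[OF g(4)]) simp
    note ac = action_less_infinity[OF this]
    have lt: "integral {0..t} (\<lambda>s. L (\<gamma> s) (u s)) < B" using g(4) ac(2) by simp
    have "\<exists>\<gamma>' u'. bounded_traj f R \<gamma>' u' \<and> \<gamma>' 0 = \<gamma> 0 \<and> \<gamma>' t = \<gamma> (0 + t) \<and>
      act \<gamma>' u' 0 t \<le> integral {0..0 + t} (\<lambda>s. L (\<gamma> s) (u s))"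
      by (rule rep[rule_format]) (use t B g lt ac(1) in auto)
    then obtain \<gamma>' u' where g': "bounded_traj f R \<gamma>' u'" "\<gamma>' 0 = \<gamma> 0" "\<gamma>' t = \<gamma> t" "act \<gamma>' u' 0 t \<le> integral {0..t} (\<lambda>s. L (\<gamma> s) (u s))"
      by (elim exE conjE) simp
    show ?thesis by (rule exI[of _ \<gamma>'], rule exI[of _ u']) (use g' g lt in simp)
  qed
  then show ?thesis using R by (intro exI[of _ R]) auto
qed

lemma action_less_infinity_imp_traj:
  assumes "admissible f \<gamma> u a b" "a < b" "action L \<gamma> u a b < \<infinity>"
  shows "\<exists>R \<gamma>' u'. bounded_traj f R \<gamma>' u' \<and> \<gamma>' 0 = \<gamma> a \<and> \<gamma>' (b - a) = \<gamma> b \<and> ereal (act \<gamma>' u' 0 (b - a)) \<le> action L \<gamma> u a b"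
proof -
  define T where "T = b - a"
  have T: "T > 0" "b = a + T" using assms(2) by (auto simp: T_def)
  note ac = action_less_infinity[OF assms(3)]
  define C where "C = integral {a..b} (\<lambda>s. L (\<gamma> s) (u s)) / T"
  have C: "integral {a..b} (\<lambda>s. L (\<gamma> s) (u s)) \<le> C * T" using T by (simp add: C_def)
  obtain R where rep: "\<forall>a T \<gamma> u. T > 0 \<and> admissible f \<gamma> u a (a + T) \<and> (\<lambda>s. L (\<gamma> s) (u s)) integrable_on {a..a + T} \<and>
      integral {a..a + T} (\<lambda>s. L (\<gamma> s) (u s)) \<le> C * T \<longrightarrow>
    (\<exists>\<gamma>' u'. bounded_traj f R \<gamma>' u' \<and> \<gamma>' 0 = \<gamma> a \<and> \<gamma>' T = \<gamma> (a + T) \<and>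
      act \<gamma>' u' 0 T \<le> integral {a..a + T} (\<lambda>s. L (\<gamma> s) (u s)))"
    using reparametrize[of C] by (elim exE conjE)
  have "\<exists>\<gamma>' u'. bounded_traj f R \<gamma>' u' \<and> \<gamma>' 0 = \<gamma> a \<and> \<gamma>' T = \<gamma> (a + T) \<and>
      act \<gamma>' u' 0 T \<le> integral {a..a + T} (\<lambda>s. L (\<gamma> s) (u s))"
    by (rule rep[rule_format]) (use T C assms(1) ac(1) in auto)
  then show ?thesis using ac(2) T(2) unfolding T_def[symmetric] by (intro exI[of _ R]) simp
qed

lemma Afun_less_imp_traj':
  assumes "t > 0" "Afun f L t x y < ereal B"
  shows "\<exists>R \<gamma> u. bounded_traj f R \<gamma> u \<and> \<gamma> 0 = x \<and> intvec (\<gamma> t - y) \<and> act \<gamma> u 0 t \<le> B"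
proof -
  have "B \<le> B / t * t" using assms(1) by simp
  moreover obtain R where "\<forall>t' x y B'. t' > 0 \<and> B' \<le> B / t * t' \<and> Afun f L t' x y < ereal B' \<longrightarrow>
    (\<exists>\<gamma> u. bounded_traj f R \<gamma> u \<and> \<gamma> 0 = x \<and> intvec (\<gamma> t' - y) \<and> act \<gamma> u 0 t' \<le> B')"
    using Afun_less_imp_traj[of "B / t"] by (elim exE conjE)
  ultimately show ?thesis using assms by (intro exI[of _ R]) blast
qed

lemma Afun_triangle:
  assumes "bounded_traj f R \<gamma> u" "0 \<le> s" "0 < t" "\<gamma> 0 = x" "intvec (\<gamma> s - y)"
  shows "Afun f L (t + s) x z \<le> ereal (act \<gamma> u 0 s) + Afun f L t y z"
    and "Afun f L (t + s) z y \<le> ereal (act \<gamma> u 0 s) + Afun f L t z x"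
proof -
  have *: "A1 \<le> ereal a + A2" if "\<And>B. A2 < ereal B \<Longrightarrow> A1 \<le> ereal (a + B)" for A1 A2 :: ereal and a :: real
  proof (cases A2)
    case (real r)
    show ?thesis
    proof (rule ereal_le_epsilon2)
      fix e :: real assume "e > 0"
      then show "A1 \<le> ereal a + A2 + ereal e" using that[of "r + e"] by (simp add: real add.assoc)
    qed
  next
    case MInf
    have "A1 \<le> ereal B" for B using that[of "B - a"] MInf by simp
    then have "A1 = - \<infinity>" using ereal_bot by blast
    then show ?thesis by simp
  qed simp
  show "Afun f L (t + s) x z \<le> ereal (act \<gamma> u 0 s) + Afun f L t y z"
  proof (rule *)
    fix B assume A: "Afun f L t y z < ereal B"
    obtain R' \<gamma>' u' where
      g': "bounded_traj f R' \<gamma>' u'" "\<gamma>' 0 = y" "intvec (\<gamma>' t - z)" "act \<gamma>' u' 0 t \<le> B"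
      using Afun_less_imp_traj'[OF assms(3) A] by (elim exE conjE)
    let ?R = "max R R'"
    have b: "bounded_traj f ?R \<gamma> u" "bounded_traj f ?R \<gamma>' u'"
      using bounded_traj_mono[OF assms(1), of ?R] bounded_traj_mono[OF g'(1), of ?R] by auto
    obtain \<Gamma> U where G: "bounded_traj f ?R \<Gamma> U" "\<Gamma> 0 = \<gamma> 0" "intvec (\<Gamma> (s + t) - \<gamma>' t)" "act \<Gamma> U 0 (s + t) = act \<gamma> u 0 s + act \<gamma>' u' 0 t"
      using join_act[OF b _ assms(2) less_imp_le[OF assms(3)]] assms(5) unfolding g'(2) by (elim meta_impE exE conjE)
    have "intvec (\<Gamma> (s + t) - z)" using intvec_simps(3)[OF G(3) g'(3)] by simp
    then have "Afun f L (s + t) x z \<le> ereal (act \<Gamma> U 0 (s + t))" using Afun_le_act[OF G(1)] G(2) assms(4) by simp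
    also have "\<dots> \<le> ereal (act \<gamma> u 0 s + B)" using G(4) g'(4) by simp
    finally show "Afun f L (t + s) x z \<le> ereal (act \<gamma> u 0 s + B)" by (simp add: add.commute)
  qed
  show "Afun f L (t + s) z y \<le> ereal (act \<gamma> u 0 s) + Afun f L t z x"
  proof (rule *)
    fix B assume A: "Afun f L t z x < ereal B"
    obtain R' \<gamma>' u' where
      g': "bounded_traj f R' \<gamma>' u'" "\<gamma>' 0 = z" "intvec (\<gamma>' t - x)" "act \<gamma>' u' 0 t \<le> B"
      using Afun_less_imp_traj'[OF assms(3) A] by (elim exE conjE)
    let ?R = "max R R'"
    have b: "bounded_traj f ?R \<gamma> u" "bounded_traj f ?R \<gamma>' u'"
      using bounded_traj_mono[OF assms(1), of ?R] bounded_traj_mono[OF g'(1), of ?R] by auto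
    obtain \<Gamma> U where G: "bounded_traj f ?R \<Gamma> U" "\<Gamma> 0 = \<gamma>' 0" "intvec (\<Gamma> (t + s) - \<gamma> s)" "act \<Gamma> U 0 (t + s) = act \<gamma>' u' 0 t + act \<gamma> u 0 s"
      using join_act[OF b(2,1) _ less_imp_le[OF assms(3)] assms(2)] g'(3) unfolding assms(4) by (elim meta_impE exE conjE)
    have "intvec (\<Gamma> (t + s) - y)" using intvec_simps(3)[OF G(3) assms(5)] by simp
    then have "Afun f L (t + s) z y \<le> ereal (act \<Gamma> U 0 (t + s))" using Afun_le_act[OF G(1)] G(2) g'(2) by simp
    also have "\<dots> \<le> ereal (act \<gamma> u 0 s + B)" using G(4) g'(4) by simp
    finally show "Afun f L (t + s) z y \<le> ereal (act \<gamma> u 0 s + B)" .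
  qed
qed

text \<open>The Peierls barrier with a free slope \<open>c\<close>; the critical value is inserted
  at the end.\<close>

definition barrier :: "real \<Rightarrow> real^'d \<Rightarrow> real^'d \<Rightarrow> ereal" where
  "barrier c x y = Liminf at_top (\<lambda>t. Afun f L t x y - ereal (c * t))"

text \<open>Prepending or appending a fixed arc of duration \<open>s\<close> shifts time by
  \<open>s\<close>, which accounts for the term c s, and a limit inferior at infinity is insensitive
  to the shift.\<close>

lemma barrier_triangle:
  assumes "bounded_traj f R \<gamma> u" "0 \<le> s" "\<gamma> 0 = x" "intvec (\<gamma> s - y)"
  shows "barrier c x z \<le> ereal (act \<gamma> u 0 s - c * s) + barrier c y z"
    and "barrier c z y \<le> ereal (act \<gamma> u 0 s - c * s) + barrier c z x"
proof -
  have *: "A1 - ereal (c * (t + s)) \<le> ereal (a - c * s) + (A2 - ereal (c * t))" if "A1 \<le> ereal a + A2" for A1 A2 :: ereal and a t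
    using that by (cases A1; cases A2) (auto simp: algebra_simps)
  show "barrier c x z \<le> ereal (act \<gamma> u 0 s - c * s) + barrier c y z"
    unfolding barrier_def
  proof (rule Liminf_at_top_shift_le[where s = s])
    fix t :: real assume t: "t > 0"
    show "Afun f L (t + s) x z - ereal (c * (t + s)) \<le> ereal (act \<gamma> u 0 s - c * s) + (Afun f L t y z - ereal (c * t))"
      by (rule *[OF Afun_triangle(1)[OF assms(1,2) t assms(3,4)]])
  qed
  show "barrier c z y \<le> ereal (act \<gamma> u 0 s - c * s) + barrier c z x"
    unfolding barrier_def
  proof (rule Liminf_at_top_shift_le[where s = s])
    fix t :: real assume t: "t > 0"
    show "Afun f L (t + s) z y - ereal (c * (t + s)) \<le> ereal (act \<gamma> u 0 s - c * s) + (Afun f L t z x - ereal (c * t))"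
      by (rule *[OF Afun_triangle(2)[OF assms(1,2) t assms(3,4)]])
  qed
qed

end

section \<open>Subgradients of the given Lagrangian\<close>

lemma Dlist_component_derivative:
  fixes g :: "'a::real_normed_vector \<Rightarrow> real" and z v :: 'a
  assumes "Dlist vs g differentiable (at (z + s *\<^sub>R v))"
  shows "((\<lambda>s. Dlist vs g (z + s *\<^sub>R v)) has_real_derivative Dlist (v # vs) g (z + s *\<^sub>R v)) (at s)"
proof -
  let ?D = "frechet_derivative (Dlist vs g) (at (z + s *\<^sub>R v))"
  have "((\<lambda>s. Dlist vs g (z + s *\<^sub>R v)) has_derivative (\<lambda>r. ?D (r *\<^sub>R v))) (at s)"
    by (rule has_derivative_compose[of "\<lambda>s. z + s *\<^sub>R v"])
       (auto intro!: derivative_eq_intros simp: assms frechet_derivative_works[symmetric])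
  moreover have "?D (r *\<^sub>R v) = Dlist (v # vs) g (z + s *\<^sub>R v) * r" for r
    using linear_frechet_derivative[OF assms] by (simp add: linear_scale Dlist.simps)
  ultimately show ?thesis by (simp add: has_field_derivative_def)
qed

text \<open>Along the line through \<open>z\<close> in direction \<open>v\<close>, \<open>g\<close>
  is a convex function of one variable, which lies above its tangent at 0.\<close>

lemma second_derivative_nonneg_imp_subgradient:
  fixes g :: "'a::real_normed_vector \<Rightarrow> real" and z v :: 'a
  assumes g: "Ck 2 g" and nonneg: "\<And>s::real. Dlist [v, v] g (z + s *\<^sub>R v) \<ge> 0"
  shows "g (z + v) \<ge> g z + Dlist [v] g z"
proof -
  have diff: "Dlist vs g differentiable (at y)" if "length vs < 2" for vs :: "'a list" and y
    using g that by (simp add: Ck_def)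
  have d1: "((\<lambda>s. g (z + s *\<^sub>R v)) has_real_derivative Dlist [v] g (z + s *\<^sub>R v)) (at s)" for s
    using Dlist_component_derivative[OF diff[of "[]" "z + s *\<^sub>R v"]] by (simp add: Dlist.simps(1))
  have d2: "((\<lambda>s. Dlist [v] g (z + s *\<^sub>R v)) has_real_derivative Dlist [v, v] g (z + s *\<^sub>R v)) (at s)" for s
    using Dlist_component_derivative[OF diff[of "[v]" "z + s *\<^sub>R v"]] by simp
  have "convex_on UNIV (\<lambda>s. g (z + s *\<^sub>R v))"
    by (rule f''_ge0_imp_convex[OF _ d1 d2]) (use nonneg in auto)
  then have "g (z + 1 *\<^sub>R v) - g (z + 0 *\<^sub>R v) \<ge> Dlist [v] g (z + 0 *\<^sub>R v) * (1 - 0)"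
    by (rule convex_on_imp_above_tangent) (use d1[of 0] in auto)
  then show ?thesis by simp
qed

lemma assm_L_lagrangian_system:
  fixes f :: "'m::finite \<Rightarrow> real^'d \<Rightarrow> real^'d" and L :: "real^'d \<Rightarrow> real^'m \<Rightarrow> real"
  assumes f: "\<forall>i. smooth (f i) \<and> periodic (f i)" and L: "assm_L L"
  shows "\<exists>Lu K1 K2 \<sigma>. lagrangian_system f L Lu K1 K2 \<sigma>"
proof -
  let ?g = "\<lambda>p. L (fst p) (snd p)"
  have per: "periodic L" and C2: "Ck 2 ?g" and conv: "\<And>x u v. Dlist [(0, v), (0, v)] ?g (x, u) \<ge> 0"
    using L by (auto simp: assm_L_def)
  obtain K1 K2 \<sigma> where K: "K1 > 0" "\<sigma> > 1" "\<And>x u. L x u \<ge> K1 * norm u powr \<sigma> - K2"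
    using L unfolding assm_L_def by blast
  have cont: "continuous_on UNIV (Dlist vs ?g)" if "length vs \<le> 2" for vs :: "((real^'d) \<times> (real^'m)) list"
    using C2 that by (simp add: Ck_def)
  have "Dlist [] ?g differentiable (at p)" for p
    using C2 unfolding Ck_def by (metis list.size(3) zero_less_numeral)
  then have diff: "?g differentiable (at p)" for p by (simp add: Dlist.simps(1))
  \<comment> \<open>The gradient in the control variable, assembled from the derivatives along (0,
    e_i).\<close>
  define Lu where "Lu x u = vec_lambda (\<lambda>i. Dlist [(0, axis i 1)] ?g (x, u))" for x u
  have Dlin: "Dlist [(0, v)] ?g (x, u) = Lu x u \<bullet> v" for x u v
  proof -
    let ?D = "frechet_derivative ?g (at (x, u))"
    have lin: "linear ?D" by (rule linear_frechet_derivative[OF diff])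
    have "linear (\<lambda>v. ?D (0, v))"
      using linear_compose[of "\<lambda>v. (0, v)" ?D] lin by (simp add: comp_def linear_iff)
    from linear_sum[OF this, of "\<lambda>i. v $ i *\<^sub>R axis i 1" UNIV]
    have "?D (0, v) = (\<Sum>i\<in>UNIV. v $ i * ?D (0, axis i 1))"
      using linear_scale[OF \<open>linear (\<lambda>v. ?D (0, v))\<close>] basis_expansion[of v] by (simp add: scalar_mult_eq_scaleR)
    then show ?thesis by (simp add: Dlist.simps Lu_def inner_vec_def mult.commute)
  qed
  have "lagrangian_system f L Lu K1 K2 \<sigma>"
  proof
    show "smooth (f i)" "periodic (f i)" for i using f by auto
    show "continuous_on UNIV (\<lambda>(x, u). L x u)"
      using cont[of "[]"] by (simp add: Dlist.simps(1) case_prod_unfold)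
    have "(\<lambda>(x, u). Lu x u) = (\<lambda>p. vec_lambda (\<lambda>i. Dlist [(0, axis i 1)] ?g p))"
      by (auto simp: Lu_def)
    then show "continuous_on UNIV (\<lambda>(x, u). Lu x u)"
      using cont by (simp add: continuous_on_vec_lambda)
    show "L x u + Lu x u \<bullet> (v - u) \<le> L x v" for x u v
    proof -
      have "Dlist [(0, v - u), (0, v - u)] ?g ((x, u) + s *\<^sub>R (0, v - u)) \<ge> 0" for s
        using conv[of "v - u" x "u + s *\<^sub>R (v - u)"] by simp
      from second_derivative_nonneg_imp_subgradient[OF C2 this]
      show ?thesis by (simp add: Dlin)
    qed
  qed (use per K in auto)
  then show ?thesis by blast
qed

section \<open>Limits, finiteness and sign of the barrier\<close>

context lagrangian_system
begin

lemma act_le: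
  assumes "bounded_traj f R \<gamma> u" "\<And>x u. norm u \<le> R \<Longrightarrow> \<bar>L x u\<bar> \<le> M" "0 \<le> t"
  shows "act \<gamma> u 0 t \<le> M * t"
proof -
  have "act \<gamma> u 0 t \<le> integral {0..t} (\<lambda>_. M)"
    unfolding act_def
  proof (rule integral_le)
    show "(\<lambda>s. L (\<gamma> s) (u s)) integrable_on {0..t}" by (rule L_integrable[OF assms(1)])
    show "L (\<gamma> s) (u s) \<le> M" for s
      using assms(2)[of "u s" "\<gamma> s"] assms(1) by (simp add: bounded_traj_def)
  qed auto
  then show ?thesis using assms(3) by (simp add: mult.commute)
qed

text \<open>Curves that start and end only near the required points are completed by two arcs of
  duration \<delta>, each of cost at most M \<delta>; as \<delta> is arbitrary, nothing is lost. The
  vectors \<open>k n\<close> account for lifted curves winding around the torus.\<close>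

lemma barrier_le_limit:
  fixes \<gamma> :: "nat \<Rightarrow> real \<Rightarrow> real^'d" and u :: "nat \<Rightarrow> real \<Rightarrow> real^'m" and T :: "nat \<Rightarrow> real" and k :: "nat \<Rightarrow> real^'d"
  assumes H: "hoermander f" and traj: "\<And>n. bounded_traj f R (\<gamma> n) (u n)"
    and x: "(\<lambda>n. \<gamma> n 0) \<longlonglongrightarrow> x" and y: "(\<lambda>n. \<gamma> n (T n) - k n) \<longlonglongrightarrow> y" and k: "\<And>n. intvec (k n)"
    and T: "filterlim T at_top sequentially"
    and B: "\<forall>\<^sub>F n in sequentially. act (\<gamma> n) (u n) 0 (T n) - c * T n \<le> B"
  shows "barrier c x y \<le> ereal B"
proof (rule ereal_le_epsilon2)
  fix e :: real assume e: "0 < e"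
  obtain M where M: "M \<ge> 0" "\<And>x u. norm u \<le> 1 \<Longrightarrow> \<bar>L x u\<bar> \<le> M" using L_bounded[of 1] by blast
  \<comment> \<open>The two arcs change the action by at most 2 M \<delta> and the subtracted term
    by at most 2 |c| \<delta>; together these stay below e.\<close>
  define \<delta> where "\<delta> = e / (2 * (M + \<bar>c\<bar> + 1))"
  have pos: "M + \<bar>c\<bar> + 1 > 0" using M(1) by simp
  have \<delta>: "\<delta> > 0" using e pos by (simp add: \<delta>_def)
  have "2 * (M + \<bar>c\<bar> + 1) * \<delta> = e" using pos by (simp add: \<delta>_def field_simps)
  then have "2 * (M * \<delta>) + 2 * (\<bar>c\<bar> * \<delta>) + 2 * \<delta> = e" by (simp add: algebra_simps)
  moreover have "- c * \<delta> \<le> \<bar>c\<bar> * \<delta>" using \<delta> by (intro mult_right_mono) auto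
  ultimately have small: "2 * (M * \<delta>) - 2 * (c * \<delta>) \<le> e" using \<delta> by linarith
  define P where "P z q \<longleftrightarrow> (\<exists>\<gamma> u. bounded_traj f 1 \<gamma> u \<and> \<gamma> 0 = z \<and> \<gamma> \<delta> = q)" for z q
  have loc: "\<exists>d>0. \<forall>z q. norm (z - z0) < d \<and> norm (q - z0) < d \<longrightarrow> P z q" for z0
    unfolding P_def by (rule local_controllability[OF H \<delta>])
  obtain d where d: "d > 0" "\<And>z q. norm (z - x) < d \<Longrightarrow> norm (q - x) < d \<Longrightarrow> P z q" using loc[of x] by auto
  obtain d' where d': "d' > 0" "\<And>z q. norm (z - y) < d' \<Longrightarrow> norm (q - y) < d' \<Longrightarrow> P z q" using loc[of y] by auto
  have "\<forall>\<^sub>F n in sequentially. norm (\<gamma> n 0 - x) < d" using tendstoD[OF x d(1)] by (simp add: dist_norm)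
  moreover have "\<forall>\<^sub>F n in sequentially. norm (\<gamma> n (T n) - k n - y) < d'" using tendstoD[OF y d'(1)] by (simp add: dist_norm)
  moreover have "\<forall>\<^sub>F n in sequentially. T n \<ge> 0" using T by (simp add: filterlim_at_top)
  ultimately have "\<forall>\<^sub>F n in sequentially. Afun f L (\<delta> + T n + \<delta>) x y - ereal (c * (\<delta> + T n + \<delta>)) \<le> ereal B + ereal e"
    using B
  proof eventually_elim
    case (elim n)
    have "P x (\<gamma> n 0)" by (rule d(2)) (use elim d in auto)
    then obtain g1 u1 where 1: "bounded_traj f 1 g1 u1" "g1 0 = x" "g1 \<delta> = \<gamma> n 0" unfolding P_def by (elim exE conjE)
    have "P (\<gamma> n (T n) - k n) y" by (rule d'(2)) (use elim d' in auto)
    then obtain g3 u3 where 3: "bounded_traj f 1 g3 u3" "g3 0 = \<gamma> n (T n) - k n" "g3 \<delta> = y" unfolding P_def by (elim exE conjE)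
    let ?R = "max 1 R"
    have b: "bounded_traj f ?R g1 u1" "bounded_traj f ?R g3 u3" "bounded_traj f ?R (\<gamma> n) (u n)"
      by (rule bounded_traj_mono[OF 1(1)], simp, rule bounded_traj_mono[OF 3(1)], simp, rule bounded_traj_mono[OF traj], simp)
    have i1: "intvec (g1 \<delta> - \<gamma> n 0)" using 1 intvec_simps(1) by simp
    obtain g2 u2 where 2: "bounded_traj f ?R g2 u2" "g2 0 = g1 0" "intvec (g2 (\<delta> + T n) - \<gamma> n (T n))"
      "act g2 u2 0 (\<delta> + T n) = act g1 u1 0 \<delta> + act (\<gamma> n) (u n) 0 (T n)"
      using join_act[OF b(1) b(3) i1 less_imp_le[OF \<delta>] elim(3)] by (elim exE conjE)
    have i2: "intvec (g2 (\<delta> + T n) - g3 0)" using intvec_simps(3)[OF 2(3) k[of n]] unfolding 3(2) by (simp add: algebra_simps)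
    have "0 \<le> \<delta> + T n" using \<delta> elim(3) by simp
    from join_act[OF 2(1) b(2) i2 this less_imp_le[OF \<delta>]]
    obtain g u' where g: "bounded_traj f ?R g u'" "g 0 = g2 0" "intvec (g (\<delta> + T n + \<delta>) - g3 \<delta>)"
      "act g u' 0 (\<delta> + T n + \<delta>) = act g2 u2 0 (\<delta> + T n) + act g3 u3 0 \<delta>" by (elim exE conjE)
    have "Afun f L (\<delta> + T n + \<delta>) x y \<le> ereal (act g u' 0 (\<delta> + T n + \<delta>))"
      by (rule Afun_le_act[OF g(1)]) (use g(2,3) 2(2) 1(2) 3(3) in auto)
    also have "act g u' 0 (\<delta> + T n + \<delta>) \<le> c * (\<delta> + T n + \<delta>) + B + e"
    proof -
      have "act g1 u1 0 \<delta> \<le> M * \<delta>" by (rule act_le[OF 1(1) M(2)]) (use \<delta> in auto)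
      moreover have "act g3 u3 0 \<delta> \<le> M * \<delta>" by (rule act_le[OF 3(1) M(2)]) (use \<delta> in auto)
      ultimately show ?thesis using small elim(4) g(4) 2(4) by (simp add: algebra_simps)
    qed
    finally have "Afun f L (\<delta> + T n + \<delta>) x y \<le> ereal (c * (\<delta> + T n + \<delta>) + B + e)" by simp
    then show ?case by (cases "Afun f L (\<delta> + T n + \<delta>) x y") auto
  qed
  moreover have "filterlim (\<lambda>n. \<delta> + T n + \<delta>) at_top sequentially"
  proof (rule filterlim_at_top_mono[OF T])
    show "\<forall>\<^sub>F n in sequentially. T n \<le> \<delta> + T n + \<delta>" using \<delta> by (intro always_eventually) auto
  qed
  ultimately show "barrier c x y \<le> ereal B + ereal e"
    unfolding barrier_def by (intro Liminf_at_top_le_sequence)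
qed

text \<open>Arcs of finite cost lead from \<open>x\<close> to \<open>y\<close> and back, so both
  barriers are bounded above and below by the value 0 at x up to real constants.\<close>

lemma barrier_finite:
  assumes H: "hoermander f" and x: "barrier c x x = 0"
  shows "\<bar>barrier c y x\<bar> \<noteq> \<infinity>" "\<bar>barrier c x y\<bar> \<noteq> \<infinity>"
proof -
  have path: "\<exists>a. \<forall>z. barrier c p z \<le> ereal a + barrier c q z \<and> barrier c z q \<le> ereal a + barrier c z p" for p q
  proof -
    obtain T \<gamma> u where g: "T \<ge> 0" "bounded_traj f 1 \<gamma> u" "\<gamma> 0 = p" "\<gamma> T = q"
      using global_controllability[OF H, of p q] by (elim exE conjE)
    have "intvec (\<gamma> T - q)" using g(4) intvec_simps(1) by simp
    note barrier_triangle[OF g(2,1,3) this]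
    then show ?thesis by (intro exI[of _ "act \<gamma> u 0 T - c * T"]) auto
  qed
  obtain a where a: "\<And>z. barrier c x z \<le> ereal a + barrier c y z" "\<And>z. barrier c z y \<le> ereal a + barrier c z x" using path[of x y] by auto
  obtain b where b: "\<And>z. barrier c y z \<le> ereal b + barrier c x z" "\<And>z. barrier c z x \<le> ereal b + barrier c z y" using path[of y x] by auto
  show "\<bar>barrier c y x\<bar> \<noteq> \<infinity>" using a(1)[of x] b(1)[of x] x by (cases "barrier c y x") auto
  show "\<bar>barrier c x y\<bar> \<noteq> \<infinity>" using a(2)[of x] b(2)[of x] x by (cases "barrier c x y") auto
qed

text \<open>A loop at \<open>y\<close> of cost below c t would give barrier c y x \<le> a + barrier
  c y x with a < 0, impossible for a finite value.\<close>

lemma barrier_nonneg: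
  assumes H: "hoermander f" and x: "barrier c x x = 0"
  shows "0 \<le> barrier c y y"
proof (rule ccontr)
  assume "\<not> ?thesis"
  then have "barrier c y y < 0" by simp
  from Liminf_at_top_frequently[OF this[unfolded barrier_def], of 1]
  obtain t where t: "t \<ge> 1" "Afun f L t y y - ereal (c * t) < 0" by (elim exE conjE)
  then have "Afun f L t y y < ereal (c * t)" by (cases "Afun f L t y y") auto
  then obtain B where B: "Afun f L t y y < ereal B" "B < c * t"
    using ereal_dense2[of "Afun f L t y y" "ereal (c * t)"] by auto
  have "t > 0" using t by simp
  from Afun_less_imp_traj'[OF this B(1)]
  obtain R \<gamma> u where g: "bounded_traj f R \<gamma> u" "\<gamma> 0 = y" "intvec (\<gamma> t - y)" "act \<gamma> u 0 t \<le> B" by (elim exE conjE)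
  have "barrier c y x \<le> ereal (act \<gamma> u 0 t - c * t) + barrier c y x"
    by (rule barrier_triangle(1)[OF g(1) _ g(2,3)]) (use t in simp)
  moreover have "act \<gamma> u 0 t - c * t < 0" using g(4) B(2) by simp
  ultimately show False using barrier_finite(1)[OF H x, of y] by (cases "barrier c y x") auto
qed

text \<open>The disjunction treats the forward and the backward half of a calibrated curve alike.
  Finiteness of the barrier makes the action of the pair finite, so the pair can be exchanged for a
  bounded one with the same ends and no larger action, to which the triangle inequality
  applies.\<close>

lemma calibrated_imp_barrier_zero:
  assumes H: "hoermander f" and x: "barrier c x x = 0"
    and adm: "admissible f \<gamma> u a b" "a \<le> b"
    and cal: "\<gamma> a = x \<and> \<gamma> b = y \<and> barrier c y x = - action L \<gamma> u a b + ereal (c * (b - a)) \<or>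
      \<gamma> a = y \<and> \<gamma> b = x \<and> barrier c x y = - action L \<gamma> u a b + ereal (c * (b - a))"
  shows "barrier c y y = 0"
proof (cases "a = b")
  case True
  then show ?thesis using cal x by auto
next
  case False
  then have ab: "a < b" using adm by simp
  have fin: "action L \<gamma> u a b < \<infinity>"
    using cal barrier_finite[OF H x, of y] by (cases "action L \<gamma> u a b") auto
  from action_less_infinity_imp_traj[OF adm(1) ab this]
  obtain R g v where g: "bounded_traj f R g v" "g 0 = \<gamma> a" "g (b - a) = \<gamma> b" "ereal (act g v 0 (b - a)) \<le> action L \<gamma> u a b"
    by (elim exE conjE)
  obtain A where A: "action L \<gamma> u a b = ereal A" using action_less_infinity(2)[OF fin] by auto
  have iv: "intvec (g (b - a) - \<gamma> b)" using g(3) intvec_simps(1) by simp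
  have "0 \<le> b - a" using ab by simp
  note tri = barrier_triangle[OF g(1) this g(2) iv]
  have le: "act g v 0 (b - a) \<le> A" using g(4) A by simp
  have "barrier c y y \<le> 0"
    using cal
  proof (elim disjE conjE)
    assume *: "\<gamma> a = x" "\<gamma> b = y" "barrier c y x = - action L \<gamma> u a b + ereal (c * (b - a))"
    have "barrier c y y \<le> ereal (act g v 0 (b - a) - c * (b - a)) + barrier c y x" using tri(2)[of c y] * by simp
    also have "\<dots> \<le> 0" using le *(3) A by simp
    finally show ?thesis .
  next
    assume *: "\<gamma> a = y" "\<gamma> b = x" "barrier c x y = - action L \<gamma> u a b + ereal (c * (b - a))"
    have "barrier c y y \<le> ereal (act g v 0 (b - a) - c * (b - a)) + barrier c x y" using tri(1)[of c y] * by simp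
    also have "\<dots> \<le> 0" using le *(3) A by simp
    finally show ?thesis .
  qed
  with barrier_nonneg[OF H x] show ?thesis by (meson antisym)
qed

section \<open>Calibrated curves through a point of the Aubry set\<close>

lemma minimizing_loops:
  assumes "barrier c x x = 0"
  shows "\<exists>R T k \<gamma> u. \<forall>n::nat. T n \<ge> real n + 1 \<and> intvec (k n) \<and> bounded_traj f R (\<gamma> n) (u n) \<and> \<gamma> n 0 = x \<and>
    \<gamma> n (T n) = x + k n \<and> act (\<gamma> n) (u n) 0 (T n) \<le> c * T n + 1 / (real n + 1)"
proof -
  obtain R where R: "\<forall>t x y B. t > 0 \<and> B \<le> (c + 1) * t \<and> Afun f L t x y < ereal B \<longrightarrow>
    (\<exists>\<gamma> u. bounded_traj f R \<gamma> u \<and> \<gamma> 0 = x \<and> intvec (\<gamma> t - y) \<and> act \<gamma> u 0 t \<le> B)"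
    using Afun_less_imp_traj[of "c + 1"] by (elim exE conjE)
  define P where "P n p \<longleftrightarrow> (case p of (t, \<gamma>, u) \<Rightarrow> t \<ge> real n + 1 \<and> bounded_traj f R \<gamma> u \<and> \<gamma> 0 = x \<and> intvec (\<gamma> t - x) \<and>
    act \<gamma> u 0 t \<le> c * t + 1 / (real n + 1))" for n p
  have "\<exists>p. P n p" for n
  proof -
    have "barrier c x x < ereal (1 / (real n + 1))" using assms by simp
    from Liminf_at_top_frequently[OF this[unfolded barrier_def], of "real n + 1"]
    obtain t where t: "t \<ge> real n + 1" "Afun f L t x x - ereal (c * t) < ereal (1 / (real n + 1))" by (elim exE conjE)
    have A: "Afun f L t x x < ereal (c * t + 1 / (real n + 1))"
      using t(2) by (cases "Afun f L t x x") auto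
    \<comment> \<open>Durations of at least 1 absorb the excess into the mean cost c + 1, so a
      single \<open>R\<close> bounds the controls of all loops.\<close>
    have "1 / (real n + 1) \<le> 1" by simp
    also have "1 \<le> t" using t(1) by simp
    finally have le: "c * t + 1 / (real n + 1) \<le> (c + 1) * t" by (simp add: distrib_right)
    have "\<exists>\<gamma> u. bounded_traj f R \<gamma> u \<and> \<gamma> 0 = x \<and> intvec (\<gamma> t - x) \<and> act \<gamma> u 0 t \<le> c * t + 1 / (real n + 1)"
      by (rule R[rule_format]) (use A le t(1) in auto)
    then obtain \<gamma> u where "bounded_traj f R \<gamma> u" "\<gamma> 0 = x" "intvec (\<gamma> t - x)" "act \<gamma> u 0 t \<le> c * t + 1 / (real n + 1)"
      by (elim exE conjE)
    then have "P n (t, \<gamma>, u)" using t(1) by (simp add: P_def)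
    then show ?thesis ..
  qed
  then have "P n (SOME p. P n p)" for n by (rule someI_ex)
  moreover define q where "q n = (SOME p. P n p)" for n
  ultimately have q: "P n (q n)" for n by simp
  show ?thesis
    by (rule exI[of _ R], rule exI[of _ "\<lambda>n. fst (q n)"], rule exI[of _ "\<lambda>n. fst (snd (q n)) (fst (q n)) - x"],
        rule exI[of _ "\<lambda>n. fst (snd (q n))"], rule exI[of _ "\<lambda>n. snd (snd (q n))"])
       (use q in \<open>simp add: P_def case_prod_unfold\<close>)
qed

lemma barrier_zero_imp_calibrated:
  assumes H: "hoermander f" and x: "barrier c x x = 0"
  shows "\<exists>R \<gamma> u. bounded_traj f R \<gamma> u \<and> \<gamma> 0 = x \<and> (\<forall>t\<ge>0. barrier c (\<gamma> t) x = ereal (c * t - act \<gamma> u 0 t) \<and>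
    barrier c x (\<gamma> (- t)) = ereal (c * t - act \<gamma> u (- t) 0))"
proof -
  obtain R T k \<gamma> u where "\<forall>n::nat. T n \<ge> real n + 1 \<and> intvec (k n) \<and> bounded_traj f R (\<gamma> n) (u n) \<and> \<gamma> n 0 = x \<and>
    \<gamma> n (T n) = x + k n \<and> act (\<gamma> n) (u n) 0 (T n) \<le> c * T n + 1 / (real n + 1)"
    using minimizing_loops[OF x] by (elim exE)
  then have T: "T n \<ge> real n + 1" and k: "intvec (k n)" and g: "bounded_traj f R (\<gamma> n) (u n)" "\<gamma> n 0 = x" "\<gamma> n (T n) = x + k n"
    and act: "act (\<gamma> n) (u n) 0 (T n) \<le> c * T n + 1 / (real n + 1)" for n :: nat by auto
  \<comment> \<open>Positive times follow the beginning of the n-th loop, negative times its end,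
    translated by -k n so that both halves pass through \<open>x\<close> at time 0.\<close>
  define \<Gamma> where "\<Gamma> n s = (if s \<le> 0 then \<gamma> n (s + T n) + - k n else \<gamma> n s)" for n s
  define U where "U n s = (if s \<le> 0 then u n (s + T n) else u n s)" for n s
  have G: "bounded_traj f R (\<Gamma> n) (U n)" for n
    unfolding \<Gamma>_def U_def
    by (rule bounded_traj_append[OF bounded_traj_shift_space[OF bounded_traj_shift_time[OF g(1)] intvec_simps(2)[OF k]] g(1)])
      (use g in simp)
  have G0: "\<Gamma> n 0 = x" for n using g(3)[of n] by (simp add: \<Gamma>_def)
  have fwd: "act (\<Gamma> n) (U n) 0 t = act (\<gamma> n) (u n) 0 t" for n t
    by (rule act_cong) (auto simp: \<Gamma>_def U_def)
  have bwd: "act (\<Gamma> n) (U n) (- t) 0 = act (\<gamma> n) (u n) (T n - t) (T n)" for n t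
  proof -
    have "act (\<Gamma> n) (U n) (- t) 0 = act (\<lambda>s. \<gamma> n (s + T n) + - k n) (\<lambda>s. u n (s + T n)) (- t) 0"
      by (rule act_cong) (auto simp: \<Gamma>_def U_def)
    also have "\<dots> = act (\<lambda>s. \<gamma> n (s + T n)) (\<lambda>s. u n (s + T n)) (- t) 0" by (rule act_shift_space[OF intvec_simps(2)[OF k]])
    also have "\<dots> = act (\<gamma> n) (u n) (- t + T n) (0 + T n)" by (rule act_shift)
    finally show ?thesis by (simp add: add.commute)
  qed
  have "\<exists>r \<gamma>' u'. strict_mono r \<and> bounded_traj f R \<gamma>' u' \<and> (\<forall>s. (\<lambda>n. \<Gamma> (r n) s) \<longlonglongrightarrow> \<gamma>' s) \<and>
    (\<forall>a b \<epsilon>. a \<le> b \<and> \<epsilon> > 0 \<longrightarrow> (\<forall>\<^sub>F n in sequentially. act \<gamma>' u' a b - \<epsilon> \<le> act (\<Gamma> (r n)) (U (r n)) a b))"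
    by (rule bounded_traj_compact[where \<gamma> = \<Gamma> and u = U and B = "norm x"]) (use G G0 in auto)
  then obtain r \<gamma>' u' where r: "strict_mono (r :: nat \<Rightarrow> nat)" and g': "bounded_traj f R \<gamma>' u'" and lim': "\<forall>s. (\<lambda>n. \<Gamma> (r n) s) \<longlonglongrightarrow> \<gamma>' s"
    and lsc: "\<forall>a b \<epsilon>. a \<le> b \<and> \<epsilon> > 0 \<longrightarrow> (\<forall>\<^sub>F n in sequentially. act \<gamma>' u' a b - \<epsilon> \<le> act (\<Gamma> (r n)) (U (r n)) a b)"
    by (elim exE conjE)
  note lim = lim'[rule_format]
  have g0: "\<gamma>' 0 = x" using LIMSEQ_unique[OF lim[of 0]] G0 by auto
  have rn: "n \<le> r n" for n by (rule seq_suble[OF r])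
  \<comment> \<open>For each fixed t the remaining duration tends to infinity, as the barrier
    demands.\<close>
  have Tlim: "filterlim (\<lambda>n. T (r n) - t) at_top sequentially" for t
  proof (rule filterlim_at_top_mono)
    show "filterlim (\<lambda>n. - t + real n) at_top sequentially"
      by (rule filterlim_tendsto_add_at_top[OF tendsto_const filterlim_real_sequentially])
    show "\<forall>\<^sub>F n in sequentially. - t + real n \<le> T (r n) - t"
    proof (rule always_eventually, rule allI)
      fix n show "- t + real n \<le> T (r n) - t" using rn[of n] T[of "r n"] by simp
    qed
  qed
  have Tge: "\<forall>\<^sub>F n in sequentially. t \<le> T (r n)" for t
    using Tlim[of 0] by (simp add: filterlim_at_top)
  have cost: "\<forall>\<^sub>F n in sequentially. act (\<gamma> (r n)) (u (r n)) 0 (T (r n)) \<le> c * T (r n) + \<eta>" if \<eta>: "\<eta> > 0" for \<eta>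
  proof -
    obtain N where N: "inverse (real (Suc N)) < \<eta>" using reals_Archimedean[OF \<eta>] by blast
    show ?thesis
    proof (rule eventually_sequentiallyI[of N])
      fix n assume "N \<le> n"
      then have "real (Suc N) \<le> real (r n) + 1" using rn[of n] by simp
      then have "1 / (real (r n) + 1) \<le> inverse (real (Suc N))" unfolding inverse_eq_divide by (intro divide_left_mono) auto
      then show "act (\<gamma> (r n)) (u (r n)) 0 (T (r n)) \<le> c * T (r n) + \<eta>" using act[of "r n"] N by linarith
    qed
  qed
  have "barrier c (\<gamma>' t) x = ereal (c * t - act \<gamma>' u' 0 t)" if t: "t \<ge> 0" for t
  proof (rule antisym)
    have "intvec (\<gamma>' t - \<gamma>' t)" using intvec_simps(1) by simp
    from barrier_triangle(1)[OF g' t g0 this, of c x]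
    show "ereal (c * t - act \<gamma>' u' 0 t) \<le> barrier c (\<gamma>' t) x"
      unfolding x by (cases "barrier c (\<gamma>' t) x") auto
    \<comment> \<open>The competitor is the loop without its initial piece of duration t. Its cost
      is the total, at most c T + e/2, minus the piece, which costs at least the limit action minus
      e/2.\<close>
    show "barrier c (\<gamma>' t) x \<le> ereal (c * t - act \<gamma>' u' 0 t)"
    proof (rule ereal_le_epsilon2)
      fix e :: real assume "0 < e"
      then have e: "e / 2 > 0" by simp
      have "\<forall>\<^sub>F n in sequentially. act (\<lambda>s. \<gamma> (r n) (s + t)) (\<lambda>s. u (r n) (s + t)) 0 (T (r n) - t) - c * (T (r n) - t) \<le> c * t - act \<gamma>' u' 0 t + e"
        using lsc[rule_format, of 0 t, OF conjI[OF t e]] cost[OF e] Tge[of t]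
      proof eventually_elim
        case (elim n)
        have "act (\<lambda>s. \<gamma> (r n) (s + t)) (\<lambda>s. u (r n) (s + t)) 0 (T (r n) - t) = act (\<gamma> (r n)) (u (r n)) t (T (r n))"
          unfolding act_shift by simp
        then show ?case using act_combine[OF g(1)[of "r n"] t elim(3)] elim(1,2) unfolding fwd by (simp add: algebra_simps)
      qed
      moreover have "(\<lambda>n. \<gamma> (r n) (0 + t)) \<longlonglongrightarrow> \<gamma>' t"
      proof (rule Lim_transform_eventually[OF lim[of t]])
        show "\<forall>\<^sub>F n in sequentially. \<Gamma> (r n) t = \<gamma> (r n) (0 + t)"
          using t g(2) g(3) by (intro always_eventually) (auto simp: \<Gamma>_def)
      qed
      moreover have "(\<lambda>n. \<gamma> (r n) (T (r n) - t + t) - k (r n)) \<longlonglongrightarrow> x" by (simp add: g(3))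
      ultimately have "barrier c (\<gamma>' t) x \<le> ereal (c * t - act \<gamma>' u' 0 t + e)"
        by (intro barrier_le_limit[OF H bounded_traj_shift_time[OF g(1)] _ _ k Tlim])
      then show "barrier c (\<gamma>' t) x \<le> ereal (c * t - act \<gamma>' u' 0 t) + ereal e" by simp
    qed
  qed
  moreover have "barrier c x (\<gamma>' (- t)) = ereal (c * t - act \<gamma>' u' (- t) 0)" if t: "t \<ge> 0" for t
  proof (rule antisym)
    \<comment> \<open>The arc from \<gamma>'(-t) to \<open>x\<close> is shifted to start at time 0,
      the form required by the triangle inequality.\<close>
    have "intvec (\<gamma>' (t + - t) - x)" using intvec_simps(1) g0 by simp
    from barrier_triangle(2)[OF bounded_traj_shift_time[OF g'] t _ this, of "\<gamma>' (- t)" c x]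
    have "barrier c x x \<le> ereal (act \<gamma>' u' (- t) 0 - c * t) + barrier c x (\<gamma>' (- t))" unfolding act_shift by simp
    then show "ereal (c * t - act \<gamma>' u' (- t) 0) \<le> barrier c x (\<gamma>' (- t))"
      unfolding x by (cases "barrier c x (\<gamma>' (- t))") auto
    \<comment> \<open>Here the final piece of the loop is removed: the competitor starts at
      \<open>x\<close> and ends near \<gamma>'(-t) up to an integer vector.\<close>
    show "barrier c x (\<gamma>' (- t)) \<le> ereal (c * t - act \<gamma>' u' (- t) 0)"
    proof (rule ereal_le_epsilon2)
      fix e :: real assume "0 < e"
      then have e: "e / 2 > 0" by simp
      have mt: "- t \<le> 0" using t by simp
      have "\<forall>\<^sub>F n in sequentially. act (\<gamma> (r n)) (u (r n)) 0 (T (r n) - t) - c * (T (r n) - t) \<le> c * t - act \<gamma>' u' (- t) 0 + e"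
        using lsc[rule_format, of "- t" 0, OF conjI[OF mt e]] cost[OF e] Tge[of t]
      proof eventually_elim
        case (elim n)
        have le: "0 \<le> T (r n) - t" "T (r n) - t \<le> T (r n)" using elim(3) t by auto
        show ?case using act_combine[OF g(1)[of "r n"] le] elim(1,2) unfolding bwd by (simp add: algebra_simps)
      qed
      moreover have "(\<lambda>n. \<gamma> (r n) (T (r n) - t) - k (r n)) \<longlonglongrightarrow> \<gamma>' (- t)"
      proof (rule Lim_transform_eventually[OF lim[of "- t"]])
        show "\<forall>\<^sub>F n in sequentially. \<Gamma> (r n) (- t) = \<gamma> (r n) (T (r n) - t) - k (r n)"
          using t by (intro always_eventually) (auto simp: \<Gamma>_def algebra_simps)
      qed
      moreover have "(\<lambda>n. \<gamma> (r n) 0) \<longlonglongrightarrow> x" by (simp add: g(2))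
      ultimately have "barrier c x (\<gamma>' (- t)) \<le> ereal (c * t - act \<gamma>' u' (- t) 0 + e)"
        by (intro barrier_le_limit[OF H g(1) _ _ k Tlim])
      then show "barrier c x (\<gamma>' (- t)) \<le> ereal (c * t - act \<gamma>' u' (- t) 0) + ereal e" by simp
    qed
  qed
  ultimately show ?thesis using g' g0 by (intro exI[of _ R] exI[of _ \<gamma>'] exI[of _ u']) simp
qed

end

section \<open>The Aubry set and its calibrated curves\<close>

theorem theorem3p8:
  fixes f :: "'m::finite \<Rightarrow> real^'d \<Rightarrow> real^'d"
    and L :: "real^'d \<Rightarrow> real^'m \<Rightarrow> real"
    and x :: "real^'d"
  assumes "CARD('m) \<le> CARD('d)"
    and "\<forall>i. smooth (f i) \<and> periodic (f i)"
    and "hoermander f"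
    and "assm_F f" and "assm_L L" and "assm_S f L"
  shows "(x \<in> aubry f L \<longleftrightarrow>
           (\<exists>\<gamma> u. \<gamma> 0 = x \<and> (\<forall>a b. a \<le> b \<longrightarrow> admissible f \<gamma> u a b) \<and>
              (\<forall>t\<ge>0. peierls f L (\<gamma> t) x = - action L \<gamma> u 0 t + ereal (cbar f L * t) \<and>
                      peierls f L x (\<gamma> (-t)) = - action L \<gamma> u (-t) 0 + ereal (cbar f L * t))))
       \<and> (\<forall>\<gamma> u. \<gamma> 0 = x \<and> (\<forall>a b. a \<le> b \<longrightarrow> admissible f \<gamma> u a b) \<and>
              (\<forall>t\<ge>0. peierls f L (\<gamma> t) x = - action L \<gamma> u 0 t + ereal (cbar f L * t) \<and>
                      peierls f L x (\<gamma> (-t)) = - action L \<gamma> u (-t) 0 + ereal (cbar f L * t))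
            \<longrightarrow> (\<forall>t. \<gamma> t \<in> aubry f L))"
proof -
  obtain Lu K1 K2 \<sigma> where "lagrangian_system f L Lu K1 K2 \<sigma>"
    using assm_L_lagrangian_system[OF assms(2,5)] by (elim exE)
  then interpret lagrangian_system f L Lu K1 K2 \<sigma> .
  let ?c = "cbar f L"
  have peierls: "peierls f L = barrier ?c" by (intro ext) (simp add: peierls_def barrier_def)
  have aubry: "y \<in> aubry f L \<longleftrightarrow> barrier ?c y y = 0" for y by (simp add: aubry_def peierls)
  define cal where "cal \<gamma> u \<longleftrightarrow> \<gamma> 0 = x \<and> (\<forall>a b. a \<le> b \<longrightarrow> admissible f \<gamma> u a b) \<and>
      (\<forall>t\<ge>0. barrier ?c (\<gamma> t) x = - action L \<gamma> u 0 t + ereal (?c * t) \<and>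
        barrier ?c x (\<gamma> (-t)) = - action L \<gamma> u (-t) 0 + ereal (?c * t))" for \<gamma> u
  have ex: "\<exists>\<gamma> u. cal \<gamma> u" if x: "barrier ?c x x = 0"
  proof -
    obtain R \<gamma> u where g: "bounded_traj f R \<gamma> u" "\<gamma> 0 = x"
      "\<forall>t\<ge>0. barrier ?c (\<gamma> t) x = ereal (?c * t - act \<gamma> u 0 t) \<and> barrier ?c x (\<gamma> (- t)) = ereal (?c * t - act \<gamma> u (- t) 0)"
      using barrier_zero_imp_calibrated[OF assms(3) x] by (elim exE conjE)
    have "cal \<gamma> u"
      using g by (simp add: cal_def action_bounded_traj[OF g(1)] bounded_traj_admissible[OF g(1)])
    then show ?thesis by blast
  qed
  have zero: "barrier ?c x x = 0" if cal: "cal \<gamma> u" for \<gamma> u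
  proof -
    have "((\<lambda>s. L (\<gamma> s) (u s)) has_integral 0) {0..0}" by (rule has_integral_null_real) simp
    then have "action L \<gamma> u 0 0 = 0" by (auto simp: action_def integral_unique)
    moreover have "barrier ?c (\<gamma> 0) x = - action L \<gamma> u 0 0 + ereal (?c * 0)"
      using cal unfolding cal_def by (elim conjE allE[of _ "0::real"]) simp
    ultimately show ?thesis using cal by (simp add: cal_def)
  qed
  have all: "barrier ?c (\<gamma> t) (\<gamma> t) = 0" if cal: "cal \<gamma> u" for \<gamma> u t
  proof (cases "t \<ge> 0")
    case True
    show ?thesis
      by (rule calibrated_imp_barrier_zero[OF assms(3) zero[OF cal], of \<gamma> u 0 t]) (use True cal in \<open>auto simp: cal_def\<close>)
  next
    case False
    \<comment> \<open>For a negative time the backward identity is used at -t, on the interval from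
      t to 0.\<close>
    then have "- t \<ge> 0" by simp
    then have "barrier ?c x (\<gamma> (- (- t))) = - action L \<gamma> u (- (- t)) 0 + ereal (?c * - t)"
      using cal unfolding cal_def by blast
    then show ?thesis
      by (intro calibrated_imp_barrier_zero[OF assms(3) zero[OF cal], of \<gamma> u t 0]) (use False cal in \<open>auto simp: cal_def\<close>)
  qed
  show ?thesis
    unfolding aubry peierls cal_def[symmetric] using ex zero all by blast
qed

end
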